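(* Let $0<a<d$. All exponents below range over $[1,\infty]$ unless otherwise specified. (i) There exists $C$ with $\|H^{-a/2}f\|_q\le C\|f\|_1$ for all $f\in L^1(\mathbb{R}^d)$ if and only if $1\le q<\frac{d}{d-a}$. (ii) There exists $C$ with $\|H^{-a/2}f\|_\infty\le C\|f\|_p$ for all $f\in L^p(\mathbb{R}^d)$ if and only if $p>\frac{d}{a}$. (iii) There exists $C$ with $\|H^{-a/2}f\|_q\le C\|f\|_\infty$ for all $f\in L^\infty(\mathbb{R}^d)$ if and only if $q>\frac{d}{a}$. (iv) There exists $C$ with $\|H^{-a/2}f\|_1\le C\|f\|_p$ for all $f\in L^p(\mathbb{R}^d)$ if and only if $1\le p<\frac{d}{d-a}$. (v) If $1<p<\infty$, $1<q<\infty$ and $\frac1p-\frac ad\le\frac1q<\frac1p+\frac ad$, then there exists $C$ with $\|H^{-a/2}f\|_q\le C\|f\|_p$ for all $f\in L^p(\mathbb{R}^d)$.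
   Context: $H=-\Delta+|x|^2$ on $\mathbb{R}^d$. For $s>0$, $H^{-s}$ is the operator given by $H^{-s}f(x)=\int_{\mathbb{R}^d}K_s(x,y)f(y)\,dy$ with $K_s(x,y)=\frac{1}{\Gamma(s)}\int_0^\infty G_t(x,y)t^{s-1}dt$ and $G_t(x,y)=(2\pi\sinh 2t)^{-d/2}\exp(-\frac12|x-y|^2\coth 2t-x\cdot y\tanh t)$ (the heat kernel of $H$); on Hermite functions, $H^{-s}h_\alpha=(2|\alpha|+d)^{-s}h_\alpha$. *)

theory Defs
  imports "HOL-Analysis.Analysis" "HOL-Probability.Essential_Supremum"
begin

(* The L^p norm for an exponent p in [1, infinity], with values in [0, infinity].
   The inner "if" is the p-th root of I, extended by infinity at I = infinity. *)
definition Lp_norm :: "ennreal \<Rightarrow> 'b measure \<Rightarrow> ('b \<Rightarrow> complex) \<Rightarrow> ennreal" where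
  "Lp_norm p M f =
    (if p = \<infinity> then esssup M (\<lambda>x. ennreal (norm (f x)))
     else let I = \<integral>\<^sup>+ x. ennreal (norm (f x) powr enn2real p) \<partial>M
          in if I = \<infinity> then \<infinity> else ennreal (enn2real I powr (1 / enn2real p)))"

definition Lp_space :: "ennreal \<Rightarrow> 'b measure \<Rightarrow> ('b \<Rightarrow> complex) set" where
  "Lp_space p M = {f \<in> borel_measurable M. Lp_norm p M f < \<infinity>}"

(* The heat kernel of H = - Laplacian + |x|^2 (Mehler's formula), meant for t > 0;
   cosh (2 * t) / sinh (2 * t) is coth (2 * t). *)
definition mehler_kernel :: "real \<Rightarrow> 'a::euclidean_space \<Rightarrow> 'a \<Rightarrow> real" where
  "mehler_kernel t x y =
    (2 * pi * sinh (2 * t)) powr (- (real DIM('a) / 2)) *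
    exp (- (1/2) * (norm (x - y))\<^sup>2 * (cosh (2 * t) / sinh (2 * t)) - (x \<bullet> y) * tanh t)"

(* For x = y and s \<le> DIM('a) / 2 the integral diverges and the value below is the default 0;
   for fixed x this concerns a single point y and does not affect integrals over y. *)
definition harmonic_kernel :: "real \<Rightarrow> 'a::euclidean_space \<Rightarrow> 'a \<Rightarrow> real" where
  "harmonic_kernel s x y =
    1 / Gamma s * (LINT t:{0<..}|lborel. mehler_kernel t x y * t powr (s - 1))"

(* The operator H^(-s) *)
definition harmonic_neg_power ::
    "real \<Rightarrow> ('a::euclidean_space \<Rightarrow> complex) \<Rightarrow> 'a \<Rightarrow> complex" where
  "harmonic_neg_power s f x = (LINT y|lborel. harmonic_kernel s x y *\<^sub>R f y)"

(* There is C with ||H^(-s) f||_q \<le> C ||f||_p for all f in L^p. Since the Bochner integral of a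
   non-integrable function is 0, the requirement that the integral defining H^(-s) f (x)
   converges absolutely for almost every x is stated explicitly. *)
definition harmonic_neg_power_bounded ::
    "'a::euclidean_space itself \<Rightarrow> real \<Rightarrow> ennreal \<Rightarrow> ennreal \<Rightarrow> bool" where
  "harmonic_neg_power_bounded _ s p q \<longleftrightarrow>
    (\<exists>C::real. \<forall>f \<in> Lp_space p (lborel :: 'a measure).
       (AE x in lborel. integrable lborel (\<lambda>y. harmonic_kernel s x y *\<^sub>R f y)) \<and>
       Lp_norm q lborel (harmonic_neg_power s f) \<le> ennreal C * Lp_norm p lborel f)"

end

theory Submission
  imports Defs "HOL-Probability.Distributions" "HOL-Analysis.Ball_Volume"
begin

text \<open>
  Completing squares in Mehler's formula shows that the heat kernel at time \<open>t\<close> is bounded by a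
  Gaussian in \<open>x - y\<close> of width \<open>\<surd>t\<close> times \<open>exp (- c t |x|\<^sup>2)\<close>, with exponential decay for large \<open>t\<close>.
  Integrating over \<open>t\<close>, the kernel \<open>K\<close> of \<open>H\<^sup>-\<^sup>a\<^sup>/\<^sup>2\<close> has the following properties: its mass
  \<open>\<integral> K x y dy\<close> is comparable to \<open>(1 + |x|\<^sup>2)\<^sup>-\<^sup>a\<^sup>/\<^sup>2\<close>, also when \<open>K\<close> is weighted by
  \<open>(1 + |x - y|\<^sup>2)\<^sup>a\<^sup>/\<^sup>2\<close>; its integral over a set \<open>F\<close> is at most a constant times \<open>|F|\<^sup>a\<^sup>/\<^sup>d\<close>; and
  it is at least a constant times \<open>|x|\<^sup>a\<^sup>-\<^sup>d\<close> for \<open>|y| \<le> |x| \<le> 1/4\<close>.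

  For \<open>q \<le> p\<close> boundedness follows from the first property by Hoelder's inequality with the weight
  \<open>(1 + |x|\<^sup>2)\<^sup>a\<^sup>/\<^sup>2\<close>. For \<open>p < q\<close> it follows from the second one, which says that \<open>K\<close> maps
  characteristic functions as a Riesz potential does, so that a layer cake argument gives the
  Hardy--Littlewood--Sobolev inequality and its limiting cases. The counterexamples are normalised
  indicators of small balls and the constant function \<open>1\<close>; the remaining cases are dual to these.
\<close>

section \<open>Gaussian, Gamma and power integrals\<close>

text \<open>The exponents come from time scales. At x the potential damps the heat flow once t
  exceeds about 1/(1+|x|^2), so the mass of K is essentially the integral of t^(a/2-1) up to that
  time. The b-th power of the resulting function (1+|x|^2)^(-a/2) is integrable exactly when ab > d,
  which is the source of the strict bounds q > d/a and 1/q < 1/p + a/d. Near the diagonal K behaves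
  like |x-y|^(a-d), which just fails to lie in L^(d/(d-a)); hence strictness when p = 1 or q =
  \<infinity>. No pointwise upper bound for K is established. Only integrals of K over sets and
  against weights are estimated, by bounding the heat kernel at a fixed time and then integrating in
  time. The estimates concern nonnegative functions and integrals with values in [0, \<infinity>],
  so that Tonelli's theorem always applies; the complex operator is treated by comparison.\<close>

lemma nn_integral_gaussian_real:
  fixes c m :: real
  assumes c: "c > 0"
  shows "(\<integral>\<^sup>+ y. ennreal (exp (- c * (m - y)\<^sup>2)) \<partial>lborel) = ennreal (sqrt (pi / c))"
proof -
  define s where "s = sqrt (1 / (2 * c))"
  have s: "s > 0" "2 * s\<^sup>2 = 1 / c" using c by (auto simp: s_def)
  have eq: "exp (- c * (m - y)\<^sup>2) = sqrt (pi / c) * normal_density m s y" for y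
  proof -
    have "2 * pi * s\<^sup>2 = pi / c" using s(2) by (simp add: field_simps)
    moreover have "- (y - m)\<^sup>2 / (2 * s\<^sup>2) = - c * (m - y)\<^sup>2"
      unfolding s(2) using c by (simp add: power2_commute)
    ultimately show ?thesis using c by (simp add: normal_density_def)
  qed
  interpret prob_space "density lborel (normal_density m s)"
    using s(1) by (rule prob_space_normal_density)
  have one: "(\<integral>\<^sup>+ y. ennreal (normal_density m s y) \<partial>lborel) = 1"
    using emeasure_space_1 by (simp add: emeasure_density)
  show ?thesis
    unfolding eq using c one by (simp add: ennreal_mult nn_integral_cmult)
qed

lemma nn_integral_gaussian:
  fixes x :: "'a::euclidean_space"
  assumes c: "c > 0"
  shows "(\<integral>\<^sup>+ y. ennreal (exp (- c * (norm (x - y))\<^sup>2)) \<partial>lborel)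
    = ennreal ((pi / c) powr (real DIM('a) / 2))"
proof -
  have "exp (- c * (norm (x - y))\<^sup>2) = (\<Prod>b\<in>Basis. exp (- c * (x \<bullet> b - y \<bullet> b)\<^sup>2))" for y
  proof -
    have "(norm (x - y))\<^sup>2 = (\<Sum>b\<in>Basis. (x \<bullet> b - y \<bullet> b)\<^sup>2)"
      unfolding power2_norm_eq_inner
      by (subst euclidean_inner) (simp add: power2_eq_square inner_diff_left)
    then show ?thesis by (simp add: sum_distrib_left exp_sum)
  qed
  then have "(\<integral>\<^sup>+ y. ennreal (exp (- c * (norm (x - y))\<^sup>2)) \<partial>lborel)
    = (\<integral>\<^sup>+ y. (\<Prod>b\<in>Basis. ennreal (exp (- c * (x \<bullet> b - y \<bullet> b)\<^sup>2))) \<partial>(lborel :: 'a measure))"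
    by (simp add: prod_ennreal)
  also have "\<dots> = (\<Prod>b\<in>(Basis::'a set). \<integral>\<^sup>+ y. ennreal (exp (- c * (x \<bullet> b - y)\<^sup>2)) \<partial>lborel)"
    by (rule nn_integral_lborel_prod) auto
  also have "\<dots> = ennreal (sqrt (pi / c)) ^ DIM('a)"
    by (simp only: nn_integral_gaussian_real[OF c] prod_constant)
  also have "\<dots> = ennreal ((pi / c) powr (real DIM('a) / 2))"
    using c by (simp add: ennreal_power powr_half_sqrt[symmetric] powr_powr flip: powr_realpow)
  finally show ?thesis .
qed

lemma nn_integral_powr_exp:
  fixes z c :: real
  assumes z: "z > 0" and c: "c > 0"
  shows "(\<integral>\<^sup>+ t\<in>{0<..}. ennreal (t powr (z - 1) * exp (- (c * t))) \<partial>lborel)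
    = ennreal (Gamma z * c powr (- z))"
proof -
  \<comment> \<open>The closed and the open half-line agree pointwise, because
    \<open>0 powr (z - 1) = 0\<close>.\<close>
  have eq: "ennreal (indicator {0..} (0 + c * t) * (0 + c * t) powr (z - 1) / exp (0 + c * t))
      = ennreal (c powr (z - 1)) * (ennreal (t powr (z - 1) * exp (- (c * t))) * indicator {0<..} t)"
    for t :: real
    using c by (cases "t > 0")
      (auto simp: indicator_def powr_mult exp_minus divide_inverse zero_le_mult_iff not_less
        ennreal_mult''[symmetric] algebra_simps dest: antisym)
  have "ennreal (Gamma z) = ennreal c *
      (\<integral>\<^sup>+ t. ennreal (indicator {0..} (0 + c * t) * (0 + c * t) powr (z - 1) / exp (0 + c * t)) \<partial>lborel)"
    using c by (subst Gamma_conv_nn_integral_real[OF z], subst nn_integral_real_affine[where c = c and t = 0]) auto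
  also have "\<dots> = ennreal c * (ennreal (c powr (z - 1)) *
      (\<integral>\<^sup>+ t\<in>{0<..}. ennreal (t powr (z - 1) * exp (- (c * t))) \<partial>lborel))"
    unfolding eq by (subst nn_integral_cmult) auto
  also have "\<dots> = ennreal (c powr z) * (\<integral>\<^sup>+ t\<in>{0<..}. ennreal (t powr (z - 1) * exp (- (c * t))) \<partial>lborel)"
    using c by (simp add: mult.assoc[symmetric] ennreal_mult''[symmetric] powr_diff)
  finally have G: "ennreal (Gamma z) = \<dots>" .
  have "ennreal (Gamma z * c powr (- z)) = ennreal (c powr (- z)) * ennreal (Gamma z)"
    using Gamma_real_pos[OF z] by (simp add: ennreal_mult' mult.commute)
  also have "\<dots> = (\<integral>\<^sup>+ t\<in>{0<..}. ennreal (t powr (z - 1) * exp (- (c * t))) \<partial>lborel)"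
    unfolding G mult.assoc[symmetric] using c
    by (simp add: ennreal_mult''[symmetric] powr_add[symmetric])
  finally show ?thesis by simp
qed

text \<open>If the integral were finite, \<open>density M f\<close> would be a finite measure, hence
  continuous from above along \<open>A\<close>; the masses of the \<open>A n\<close>, all at least
  \<open>c\<close>, would tend to the mass 0 of the intersection. This detects logarithmic
  divergence, at the origin or at infinity, without polar coordinates.\<close>

lemma nn_integral_eq_top_if_tails_large:
  fixes f :: "'b \<Rightarrow> ennreal"
  assumes [measurable]: "f \<in> borel_measurable M" "\<And>n. A n \<in> sets M"
    and dec: "decseq A" and null: "(\<integral>\<^sup>+x\<in>(\<Inter>n. A n). f x \<partial>M) = 0"
    and c: "c > 0" and large: "\<And>n. (\<integral>\<^sup>+x\<in>A n. f x \<partial>M) \<ge> c"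
  shows "(\<integral>\<^sup>+x. f x \<partial>M) = \<infinity>"
proof (rule ccontr)
  assume fin: "(\<integral>\<^sup>+x. f x \<partial>M) \<noteq> \<infinity>"
  have [simp]: "emeasure (density M f) (A n) = (\<integral>\<^sup>+x\<in>A n. f x \<partial>M)" for n
    by (rule emeasure_density) auto
  have lim: "(\<lambda>n. emeasure (density M f) (A n)) \<longlonglongrightarrow> emeasure (density M f) (\<Inter>n. A n)"
  proof (rule Lim_emeasure_decseq)
    fix n show "emeasure (density M f) (A n) \<noteq> \<infinity>"
    proof -
      have "(\<integral>\<^sup>+x\<in>A n. f x \<partial>M) \<le> (\<integral>\<^sup>+x. f x \<partial>M)"
        by (intro nn_integral_mono) (auto simp: indicator_def)
      with fin show ?thesis by (auto simp: top_unique)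
    qed
  qed (use dec in auto)
  have "emeasure (density M f) (\<Inter>n. A n) = 0"
    using null by (subst emeasure_density) auto
  then have "c \<le> 0"
    using large by (intro LIMSEQ_le_const[OF lim[unfolded \<open>emeasure (density M f) (\<Inter>n. A n) = 0\<close>]]) auto
  with c show False by simp
qed

text \<open>Scale invariance: on the ball of radius r the integrand is at least r^(-d), which
  against the volume of that ball gives the volume of the unit ball, for every r.\<close>

lemma nn_integral_norm_powr_ball_eq_top:
  assumes d: "0 < \<delta>"
  shows "(\<integral>\<^sup>+x\<in>ball 0 \<delta>. ennreal (norm x powr (- real DIM('a))) \<partial>(lborel::'a::euclidean_space measure)) = \<infinity>"
proof (rule nn_integral_eq_top_if_tails_large[where A = "\<lambda>n. ball 0 (\<delta> / Suc n)" and c = "ennreal (unit_ball_vol (DIM('a)))"])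
  show "decseq (\<lambda>n. ball (0::'a) (\<delta> / Suc n))"
    using d by (intro decseq_SucI subset_ball divide_left_mono) auto
  show "(0::ennreal) < ennreal (unit_ball_vol (DIM('a)))" by (simp add: unit_ball_vol_pos)
  have "(\<Inter>n. ball (0::'a) (\<delta> / Suc n)) \<subseteq> {0}"
  proof
    fix x :: 'a assume x: "x \<in> (\<Inter>n. ball (0::'a) (\<delta> / Suc n))"
    have "norm x \<le> 0"
    proof (rule LIMSEQ_le_const[where X = "\<lambda>n. \<delta> / Suc n"])
      show "(\<lambda>n. \<delta> / real (Suc n)) \<longlonglongrightarrow> 0" by real_asymp
    qed (use x in \<open>auto intro!: less_imp_le\<close>)
    then show "x \<in> {0}" by simp
  qed
  then show "(\<integral>\<^sup>+x\<in>(\<Inter>n. ball (0::'a) (\<delta> / Suc n)). (ennreal (norm x powr (- real DIM('a))) * indicator (ball 0 \<delta>) x) \<partial>lborel) = 0"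
    by (subst nn_integral_0_iff_AE) (auto intro!: AE_I2 simp: indicator_def subset_iff simp del: of_nat_Suc INT_iff)
next
  fix n
  define r where "r = \<delta> / Suc n"
  have r: "0 < r" "r \<le> \<delta>" using d by (auto simp: r_def divide_le_eq mult_le_cancel_left1)
  have "ennreal (unit_ball_vol DIM('a)) = ennreal (r powr (- real DIM('a))) * emeasure lborel (ball (0::'a) r)"
    using r by (simp add: emeasure_ball ennreal_mult''[symmetric] unit_ball_vol_nonneg powr_minus powr_realpow field_simps)
  also have "\<dots> = (\<integral>\<^sup>+x. ennreal (r powr (- real DIM('a))) * indicator (ball 0 r) x \<partial>(lborel::'a measure))"
    by (subst nn_integral_cmult_indicator) auto
  also have "\<dots> \<le> (\<integral>\<^sup>+x\<in>ball 0 r. (ennreal (norm x powr (- real DIM('a))) * indicator (ball 0 \<delta>) x) \<partial>(lborel::'a measure))"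
  \<comment> \<open>The origin has to be excluded: there \<open>norm x powr (- real DIM('a))\<close>
    is 0, not infinite.\<close>
  proof (rule nn_integral_mono_AE, rule AE_mp[OF AE_lborel_singleton[of 0]], rule AE_I2, rule impI)
    fix x :: 'a assume "x \<noteq> 0"
    then show "ennreal (r powr (- real DIM('a))) * indicator (ball 0 r) x
      \<le> ennreal (norm x powr (- real DIM('a))) * indicator (ball 0 \<delta>) x * indicator (ball 0 r) x"
      using r by (auto simp: indicator_def intro!: ennreal_leI powr_mono2')
  qed
  finally show "ennreal (unit_ball_vol DIM('a)) \<le> (\<integral>\<^sup>+x\<in>ball 0 (\<delta> / Suc n). (ennreal (norm x powr (- real DIM('a))) * indicator (ball 0 \<delta>) x) \<partial>(lborel::'a measure))"
    by (simp add: r_def)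
qed (auto intro!: borel_measurable_times_ennreal borel_measurable_indicator)

text \<open>The Gamma integral writes the weight as a mixture of Gaussians exp(-t|x|^2), so by
  Tonelli convergence reduces to a Gamma integral with parameter (b-d)/2 > 0. For b at most d, each
  shell r <= |x| < 2r with r >= 1 contributes at least a fixed amount.\<close>

lemma nn_integral_weight_less_top_iff:
  "(\<integral>\<^sup>+x. ennreal ((1 + (norm x)\<^sup>2) powr (- (b / 2))) \<partial>(lborel::'a::euclidean_space measure)) < \<infinity>
    \<longleftrightarrow> real DIM('a) < b"
proof
  assume b: "real DIM('a) < b"
  then have b0: "b / 2 > 0" by simp
  have "ennreal (Gamma (b / 2)) * (\<integral>\<^sup>+x. ennreal ((1 + (norm x)\<^sup>2) powr (- (b / 2))) \<partial>(lborel::'a measure))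
    = (\<integral>\<^sup>+x. (\<integral>\<^sup>+t\<in>{0<..}. ennreal (t powr (b / 2 - 1) * exp (- ((1 + (norm x)\<^sup>2) * t))) \<partial>lborel) \<partial>(lborel::'a measure))"
    by (subst nn_integral_powr_exp[OF b0])
      (auto simp: add_pos_nonneg ennreal_mult'' nn_integral_cmult)
  also have "\<dots> = (\<integral>\<^sup>+t. (\<integral>\<^sup>+x. ennreal (t powr (b / 2 - 1) * exp (- ((1 + (norm x)\<^sup>2) * t))) * indicator {0<..} t \<partial>(lborel::'a measure)) \<partial>lborel)"
    by (rule lborel_pair.Fubini') measurable
  also have "\<dots> = (\<integral>\<^sup>+t\<in>{0<..}. (ennreal (pi powr (real DIM('a) / 2)) * ennreal (t powr ((b - DIM('a)) / 2 - 1) * exp (- (1 * t)))) \<partial>lborel)"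
  proof (rule nn_integral_cong)
    fix t :: real
    show "(\<integral>\<^sup>+x. ennreal (t powr (b / 2 - 1) * exp (- ((1 + (norm x)\<^sup>2) * t))) * indicator {0<..} t \<partial>(lborel::'a measure))
      = ennreal (pi powr (real DIM('a) / 2)) * ennreal (t powr ((b - DIM('a)) / 2 - 1) * exp (- (1 * t))) * indicator {0<..} t"
    proof (cases "t > 0")
      case True
      have "(\<integral>\<^sup>+x. ennreal (t powr (b / 2 - 1) * exp (- ((1 + (norm x)\<^sup>2) * t))) * indicator {0<..} t \<partial>(lborel::'a measure))
        = (\<integral>\<^sup>+x. ennreal (t powr (b / 2 - 1) * exp (- t)) * ennreal (exp (- t * (norm (0 - x))\<^sup>2)) \<partial>(lborel::'a measure))"
        using True by (intro nn_integral_cong) (auto simp: ennreal_mult''[symmetric] algebra_simps simp flip: exp_add)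
      also have "\<dots> = ennreal (t powr (b / 2 - 1) * exp (- t)) * ennreal ((pi / t) powr (real DIM('a) / 2))"
        by (subst nn_integral_cmult, simp, subst nn_integral_gaussian[OF True]) simp
      also have "\<dots> = ennreal (pi powr (real DIM('a) / 2)) * ennreal (t powr ((b - DIM('a)) / 2 - 1) * exp (- (1 * t)))"
        using True by (simp add: ennreal_mult''[symmetric] powr_divide diff_divide_distrib powr_diff ac_simps)
      finally show ?thesis using True by simp
    qed auto
  qed
  also have "\<dots> = ennreal (pi powr (real DIM('a) / 2)) * ennreal (Gamma ((b - DIM('a)) / 2) * 1 powr (- ((b - DIM('a)) / 2)))"
    using b by (subst nn_integral_powr_exp[symmetric]) (auto simp: nn_integral_cmult[symmetric] mult.assoc)
  also have "\<dots> < \<infinity>" by (simp add: ennreal_mult_less_top)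
  finally show "(\<integral>\<^sup>+x. ennreal ((1 + (norm x)\<^sup>2) powr (- (b / 2))) \<partial>(lborel::'a measure)) < \<infinity>"
    using Gamma_real_pos[OF b0] by (auto simp: ennreal_mult_less_top)
next
  assume fin: "(\<integral>\<^sup>+x. ennreal ((1 + (norm x)\<^sup>2) powr (- (b / 2))) \<partial>(lborel::'a measure)) < \<infinity>"
  show "real DIM('a) < b"
  proof (rule ccontr)
    assume nb: "\<not> real DIM('a) < b"
    \<comment> \<open>On the shell r <= |x| < 2r with r >= 1 one has 1+|x|^2 <= 5r^2, and the shell
      has volume (2^d - 1) r^d times that of the unit ball; the powers of r cancel.\<close>
    define c where "c = 5 powr (- (real DIM('a) / 2)) * unit_ball_vol (real DIM('a)) * (2 ^ DIM('a) - 1)"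
    have cpos: "c > 0"
      unfolding c_def by (intro mult_pos_pos) (auto simp: unit_ball_vol_pos one_less_power)
    have "(\<integral>\<^sup>+x. ennreal ((1 + (norm x)\<^sup>2) powr (- (b / 2))) \<partial>(lborel::'a measure)) = \<infinity>"
    proof (rule nn_integral_eq_top_if_tails_large[where A = "\<lambda>n. - ball 0 (real (Suc n))" and c = "ennreal c"])
      show "decseq (\<lambda>n. - ball (0::'a) (real (Suc n)))"
        by (intro decseq_SucI) auto
      have "(\<Inter>n. - ball (0::'a) (real (Suc n))) = {}"
      proof -
        have "\<exists>n. norm x < real (Suc n)" for x :: 'a
          by (metis reals_Archimedean2 less_trans lessI of_nat_less_iff)
        then have "\<exists>n. x \<notin> - ball (0::'a) (real (Suc n))" for x by simp
        then show ?thesis by blast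
      qed
      then show "(\<integral>\<^sup>+x\<in>(\<Inter>n. - ball 0 (real (Suc n))). ennreal ((1 + (norm x)\<^sup>2) powr (- (b / 2))) \<partial>(lborel::'a measure)) = 0"
        by simp
      fix n
      define r where "r = real (Suc n)"
      have r: "r \<ge> 1" by (simp add: r_def)
      have "emeasure lborel (ball (0::'a) (2 * r) - ball 0 r) = emeasure lborel (ball (0::'a) (2 * r)) - emeasure lborel (ball (0::'a) r)"
        using r by (intro emeasure_Diff) (auto simp: emeasure_ball)
      also have "\<dots> = ennreal (unit_ball_vol (real DIM('a)) * (2 ^ DIM('a) - 1) * r ^ DIM('a))"
        using r by (simp add: emeasure_ball ennreal_minus unit_ball_vol_nonneg power_mult_distrib algebra_simps)
      finally have vol: "emeasure lborel (ball (0::'a) (2 * r) - ball 0 r) = \<dots>" .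
      have "ennreal c = ennreal ((5 * r\<^sup>2) powr (- (real DIM('a) / 2))) * emeasure lborel (ball (0::'a) (2 * r) - ball 0 r)"
      proof -
        have "(r\<^sup>2) powr (- (real DIM('a) / 2)) = r powr (- real DIM('a))"
          using r by (simp add: powr_powr flip: powr_numeral)
        then have "5 powr (- (real DIM('a) / 2)) = (5 * r\<^sup>2) powr (- (real DIM('a) / 2)) * r ^ DIM('a)"
          using r by (simp add: powr_mult powr_minus powr_realpow)
        then have "c = (5 * r\<^sup>2) powr (- (real DIM('a) / 2)) * (unit_ball_vol (real DIM('a)) * (2 ^ DIM('a) - 1) * r ^ DIM('a))"
          unfolding c_def by (simp only: ac_simps)
        then show ?thesis unfolding vol by (simp add: ennreal_mult')
      qed
      also have "\<dots> = (\<integral>\<^sup>+x. ennreal ((5 * r\<^sup>2) powr (- (real DIM('a) / 2))) * indicator (ball 0 (2 * r) - ball 0 r) x \<partial>(lborel::'a measure))"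
        by (subst nn_integral_cmult_indicator) auto
      also have "\<dots> \<le> (\<integral>\<^sup>+x\<in>- ball 0 r. ennreal ((1 + (norm x)\<^sup>2) powr (- (b / 2))) \<partial>(lborel::'a measure))"
      proof (rule nn_integral_mono)
        fix x :: 'a
        have "(5 * r\<^sup>2) powr (- (real DIM('a) / 2)) \<le> (1 + (norm x)\<^sup>2) powr (- (b / 2))"
          if "norm x < 2 * r"
        proof -
          have "(norm x)\<^sup>2 \<le> (2 * r)\<^sup>2" using that by (intro power_mono) auto
          moreover have "r\<^sup>2 \<ge> 1" using r by simp
          ultimately have "1 + (norm x)\<^sup>2 \<le> 5 * r\<^sup>2" by (simp add: power_mult_distrib)
          then have "(5 * r\<^sup>2) powr (- (real DIM('a) / 2)) \<le> (1 + (norm x)\<^sup>2) powr (- (real DIM('a) / 2))"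
            by (intro powr_mono2') (auto simp: add_pos_nonneg)
          also have "\<dots> \<le> (1 + (norm x)\<^sup>2) powr (- (b / 2))"
            using nb by (intro powr_mono) auto
          finally show ?thesis .
        qed
        then show "ennreal ((5 * r\<^sup>2) powr (- (real DIM('a) / 2))) * indicator (ball 0 (2 * r) - ball 0 r) x
          \<le> ennreal ((1 + (norm x)\<^sup>2) powr (- (b / 2))) * indicator (- ball 0 r) x"
          by (auto simp: indicator_def intro!: ennreal_leI)
      qed
      finally show "ennreal c \<le> (\<integral>\<^sup>+x\<in>- ball 0 (real (Suc n)). ennreal ((1 + (norm x)\<^sup>2) powr (- (b / 2))) \<partial>(lborel::'a measure))"
        by (simp add: r_def)
    qed (use cpos in auto)
    with fin show False by simp
  qed
qed

section \<open>Power integrals on the half-line, and powers against exponentials\<close>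

lemma nn_integral_powr_from_0:
  fixes s T :: real
  assumes "s > 0" "T \<ge> 0"
  shows "(\<integral>\<^sup>+t\<in>{0..T}. ennreal (t powr (s - 1)) \<partial>lborel) = ennreal (T powr s / s)"
  using nn_integral_has_integral_lebesgue[OF _ has_integral_powr_from_0[of "s - 1" T]] assms
  by (simp add: mult.commute ennreal_mult' flip: ennreal_indicator)

lemma nn_integral_powr_to_inf:
  fixes s T :: real
  assumes "s > 0" "T > 0"
  shows "(\<integral>\<^sup>+t\<in>{T..}. ennreal (t powr (- s - 1)) \<partial>lborel) = ennreal (T powr (- s) / s)"
  using nn_integral_has_integral_lebesgue[OF _ has_integral_powr_to_inf[of "- s - 1" T]] assms
  by (simp add: mult.commute ennreal_mult' flip: ennreal_indicator)

lemma one_plus_powr_le_exp: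
  fixes s k :: real
  assumes s: "s > 0" and k: "k > 0"
  obtains M where "M > 0" "\<And>X. X \<ge> 0 \<Longrightarrow> (1 + X) powr s \<le> M * exp (k * X)"
proof
  \<comment> \<open>This is the maximum of (1+X)^s exp(-kX), attained at 1+X = s/k, which is where
    the tangent bound ln u <= u - 1 with u = (1+X)k/s is an equality.\<close>
  define M where "M = exp (k - s - s * ln (k / s))"
  show "M > 0" by (simp add: M_def)
  fix X :: real assume X: "X \<ge> 0"
  have "ln ((1 + X) * (k / s)) \<le> (1 + X) * (k / s) - 1"
    using X s k by (intro ln_le_minus_one) auto
  moreover have "ln ((1 + X) * (k / s)) = ln (1 + X) + ln (k / s)"
    using X s k by (intro ln_mult_pos) auto
  ultimately have "s * ln (1 + X) \<le> s * ((1 + X) * (k / s) - 1 - ln (k / s))"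
    using s by (intro mult_left_mono) auto
  also have "\<dots> = k - s - s * ln (k / s) + k * X"
    using s by (simp add: field_simps)
  finally show "(1 + X) powr s \<le> M * exp (k * X)"
    using X by (simp add: powr_def M_def flip: exp_add)
qed

section \<open>The heat kernel and its time integrals\<close>

lemma le_sinh_real:
  fixes t :: real
  assumes "t \<ge> 0"
  shows "t \<le> sinh t"
  using real_le_x_sinh[OF assms] by (simp add: sinh_field_def exp_minus)

lemma tanh_real_le:
  fixes t :: real
  assumes "t \<ge> 0"
  shows "tanh t \<le> t"
proof -
  have "0 * cosh 0 - sinh 0 \<le> t * cosh t - sinh t"
  proof (rule DERIV_nonneg_imp_nondecreasing[OF assms])
    fix x :: real assume "0 \<le> x" "x \<le> t"
    have "((\<lambda>t. t * cosh t - sinh t) has_real_derivative x * sinh x) (at x)"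
      by (auto intro!: derivative_eq_intros)
    with \<open>0 \<le> x\<close> show "\<exists>y. ((\<lambda>t. t * cosh t - sinh t) has_real_derivative y) (at x) \<and> 0 \<le> y"
      by (intro exI[of _ "x * sinh x"]) auto
  qed
  then show ?thesis by (simp add: tanh_def divide_le_eq)
qed

lemma le_tanh_real:
  fixes t :: real
  assumes "0 \<le> t" "t \<le> 1"
  shows "t / cosh 1 \<le> tanh t"
proof -
  have "cosh t \<le> cosh 1" using assms by (simp add: cosh_real_nonneg_le_iff)
  then show ?thesis
    unfolding tanh_def using assms le_sinh_real[of t]
    by (intro frac_le) (auto simp: cosh_real_pos)
qed

lemma norm_add_diff_power2:
  fixes x y :: "'a::real_inner"
  shows "(norm (x + y))\<^sup>2 + (norm (x - y))\<^sup>2 = 2 * (norm x)\<^sup>2 + 2 * (norm y)\<^sup>2"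
  by (simp add: power2_norm_eq_inner inner_simps inner_commute)

text \<open>Polarization of the inner product and the identity 2 coth 2t = coth t + tanh t
  diagonalize the exponent. Both squares get a positive coefficient: the one of x-y gives
  concentration near the diagonal, the one of x+y the confinement by the potential.\<close>

lemma mehler_kernel_eq:
  fixes x y :: "'a::euclidean_space"
  assumes t: "t > 0"
  shows "mehler_kernel t x y = (2 * pi * sinh (2 * t)) powr (- (real DIM('a) / 2)) *
    exp (- ((norm (x - y))\<^sup>2 / (4 * tanh t) + tanh t * (norm (x + y))\<^sup>2 / 4))"
proof -
  have dot: "x \<bullet> y = ((norm (x + y))\<^sup>2 - (norm (x - y))\<^sup>2) / 4"
    by (simp add: power2_norm_eq_inner inner_simps inner_commute)
  have coth: "cosh (2 * t) / sinh (2 * t) = (1 / tanh t + tanh t) / 2"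
  proof -
    have "cosh (2 * t) / sinh (2 * t) = (cosh t * cosh t + sinh t * sinh t) / (2 * sinh t * cosh t)"
      unfolding cosh_double sinh_double power2_eq_square by simp
    also have "\<dots> = (1 / tanh t + tanh t) / 2"
      using t cosh_real_pos[of t] unfolding tanh_def by (simp add: field_simps)
    finally show ?thesis .
  qed
  have "- (1/2) * u * ((1 / tanh t + tanh t) / 2) - (v - u) / 4 * tanh t = - (u / (4 * tanh t) + tanh t * v / 4)"
    for u v
    using t by (simp add: field_simps)
  then show ?thesis
    unfolding mehler_kernel_def coth dot by simp
qed

lemma mehler_kernel_commute: "mehler_kernel t x y = mehler_kernel t y x"
  by (simp add: mehler_kernel_def norm_minus_commute inner_commute)

lemma mehler_kernel_nonneg: "mehler_kernel t x y \<ge> 0"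
  by (simp add: mehler_kernel_def)

lemma mehler_kernel_measurable [measurable (raw)]:
  fixes f g :: "'b \<Rightarrow> 'a::euclidean_space"
  assumes [measurable]: "h \<in> borel_measurable M" "f \<in> borel_measurable M" "g \<in> borel_measurable M"
  shows "(\<lambda>z. mehler_kernel (h z) (f z) (g z)) \<in> borel_measurable M"
  unfolding mehler_kernel_def tanh_def sinh_field_def cosh_field_def by measurable

text \<open>Since |x+y|^2 + |x-y|^2 >= 2|x|^2, decay in x+y becomes decay in x at the cost of part
  of the Gaussian in x-y. With u = |x-y|^2 and h = tanh t < 1, the exponent u/(4h) is split into
  u/(16h), which is kept, u/(16h) >= u/16, and u/(8h) >= hu/8, which pays for the exchange. The
  factor exp(-u/16) does not depend on t and is reserved for absorbing polynomial weights in
  x-y.\<close>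

lemma mehler_kernel_le:
  fixes x y :: "'a::euclidean_space"
  assumes t: "t > 0"
  shows "mehler_kernel t x y \<le> (2 * pi * sinh (2 * t)) powr (- (real DIM('a) / 2)) *
    (exp (- (1 / (16 * tanh t)) * (norm (x - y))\<^sup>2) * exp (- ((norm (x - y))\<^sup>2 / 16))
      * exp (- (tanh t / 4 * (norm x)\<^sup>2)))"
proof -
  define h where "h = tanh t"
  define u v where "u = (norm (x - y))\<^sup>2" and "v = (norm (x + y))\<^sup>2"
  have h: "0 < h" "h < 1" using t by (auto simp: h_def tanh_real_lt_1)
  have uv: "u \<ge> 0" "v \<ge> 0" by (auto simp: u_def v_def)
  have uv2: "u + v \<ge> 2 * (norm x)\<^sup>2"
    using norm_add_diff_power2[of x y] zero_le_power2[of "norm y"]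
    unfolding u_def v_def by linarith
  have "h * (2 * (norm x)\<^sup>2) \<le> h * (u + v)" using h uv2 by (intro mult_left_mono) auto
  moreover have "h * h \<le> 1" using h by (simp add: mult_le_one)
  then have "h * u \<le> u / h" using h uv mult_right_mono[of "h * h" 1 u] by (simp add: field_simps)
  moreover have "u \<le> u / h" using h uv by (simp add: field_simps mult_left_le_one_le)
  moreover have "h * v \<ge> 0" using h uv by simp
  ultimately have "u / 16 / h + u / 16 + h / 4 * (norm x)\<^sup>2 \<le> u / 4 / h + h * v / 4"
    by (simp add: algebra_simps)
  then show ?thesis
    unfolding mehler_kernel_eq[OF t] using h
    by (simp add: u_def v_def h_def field_simps flip: exp_add)
qed

lemma mehler_kernel_le_powr:
  fixes x y :: "'a::euclidean_space"
  assumes t: "t > 0"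
  shows "mehler_kernel t x y \<le> t powr (- (real DIM('a) / 2))"
proof -
  have "1 * t \<le> (4 * pi) * t" using pi_gt3 t by (intro mult_right_mono) auto
  also have "\<dots> \<le> 2 * pi * sinh (2 * t)" using le_sinh_real[of "2 * t"] t by simp
  finally have "(2 * pi * sinh (2 * t)) powr (- (real DIM('a) / 2)) \<le> t powr (- (real DIM('a) / 2))"
    using t by (intro powr_mono2') auto
  moreover have "0 \<le> (norm (x - y))\<^sup>2 / (4 * tanh t) + tanh t * (norm (x + y))\<^sup>2 / 4"
    using t by (intro add_nonneg_nonneg divide_nonneg_nonneg mult_nonneg_nonneg) auto
  ultimately show ?thesis
    unfolding mehler_kernel_eq[OF t]
    by (intro order_trans[OF mult_left_le]) (simp_all only: exp_le_one_iff neg_le_0_iff_le powr_ge_zero)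
qed

text \<open>The factor exp(-|x-y|^2/16) absorbs the weight uniformly in t. The remaining Gaussian
  integrates to a multiple of tanh(t)^(d/2), and together with the prefactor this is a power of tanh
  t / sinh 2t = 1/(2 cosh^2 t): bounded for small t, and decaying at the rate d, the lowest
  eigenvalue of H.\<close>

lemma mehler_weighted_mass_le:
  fixes b :: real
  assumes b: "b > 0"
  obtains M where "M > 0" "\<And>t (x::'a::euclidean_space). t > 0 \<Longrightarrow>
    (\<integral>\<^sup>+y. ennreal ((1 + (norm (x - y))\<^sup>2) powr b * mehler_kernel t x y) \<partial>lborel)
      \<le> ennreal (M * exp (- (real DIM('a) * t)) * exp (- (tanh t / 4 * (norm x)\<^sup>2)))"
proof -
  obtain M0 where M0: "M0 > 0" "\<And>X. X \<ge> 0 \<Longrightarrow> (1 + X) powr b \<le> M0 * exp (1 / 16 * X)"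
    using one_plus_powr_le_exp[OF b, of "1 / 16"] by auto
  show ?thesis
  proof
    show "M0 * 4 ^ DIM('a) > 0" using M0 by simp
    fix t :: real and x :: 'a
    assume t: "t > 0"
    define h where "h = tanh t"
    define A where "A = (2 * pi * sinh (2 * t)) powr (- (real DIM('a) / 2))"
    define B where "B = exp (- (tanh t / 4 * (norm x)\<^sup>2))"
    have h: "0 < h" using t by (auto simp: h_def)
    have A: "A \<ge> 0" and B: "B \<ge> 0" by (auto simp: A_def B_def)
    have "(1 + (norm (x - y))\<^sup>2) powr b * mehler_kernel t x y
      \<le> M0 * A * B * exp (- (1 / (16 * h)) * (norm (x - y))\<^sup>2)" for y
    proof -
      have "(1 + (norm (x - y))\<^sup>2) powr b * mehler_kernel t x y
        \<le> (M0 * exp ((norm (x - y))\<^sup>2 / 16)) * (A * (exp (- (1 / (16 * tanh t)) * (norm (x - y))\<^sup>2) * exp (- ((norm (x - y))\<^sup>2 / 16)) * B))"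
        using M0(1) M0(2)[of "(norm (x - y))\<^sup>2"] mehler_kernel_le[OF t, of x y] unfolding A_def B_def
        by (intro mult_mono) (auto simp: mehler_kernel_nonneg)
      also have "\<dots> = M0 * A * B * exp (- (1 / (16 * h)) * (norm (x - y))\<^sup>2)"
        by (simp add: h_def exp_minus)
      finally show ?thesis .
    qed
    then have "(\<integral>\<^sup>+y. ennreal ((1 + (norm (x - y))\<^sup>2) powr b * mehler_kernel t x y) \<partial>lborel)
      \<le> (\<integral>\<^sup>+y. ennreal (M0 * A * B) * ennreal (exp (- (1 / (16 * h)) * (norm (x - y))\<^sup>2)) \<partial>lborel)"
      by (intro nn_integral_mono) (simp add: ennreal_mult''[symmetric] ennreal_leI)
    also have "\<dots> = ennreal (M0 * A * B) * ennreal ((pi / (1 / (16 * h))) powr (real DIM('a) / 2))"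
      using h by (subst nn_integral_cmult, simp, subst nn_integral_gaussian) auto
    also have "\<dots> = ennreal (M0 * B * (A * (16 * h * pi) powr (real DIM('a) / 2)))"
      using M0 A B by (simp add: ennreal_mult''[symmetric] ac_simps)
    also have "\<dots> \<le> ennreal (M0 * B * (4 ^ DIM('a) * exp (- (real DIM('a) * t))))"
    proof (intro ennreal_leI mult_left_mono)
      \<comment> \<open>The base equals (2 / cosh t)^2, and cosh t >= e^t / 2 bounds 2 / cosh t by 4
        e^(-t).\<close>
      have "A * (16 * h * pi) powr (real DIM('a) / 2) = (16 * h * pi / (2 * pi * sinh (2 * t))) powr (real DIM('a) / 2)"
        using t h by (subst powr_divide) (auto simp: A_def powr_minus field_simps)
      also have "16 * h * pi / (2 * pi * sinh (2 * t)) = (2 / cosh t) powr 2"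
        using t cosh_real_pos[of t] unfolding h_def tanh_def sinh_double by (simp add: power2_eq_square field_simps)
      also have "((2 / cosh t) powr 2) powr (real DIM('a) / 2) = (2 / cosh t) ^ DIM('a)"
        by (subst powr_powr) (simp add: cosh_real_pos powr_realpow)
      also have "\<dots> \<le> (4 * exp (- t)) ^ DIM('a)"
        by (intro power_mono) (auto simp: cosh_field_def field_simps exp_minus add_pos_nonneg intro!: divide_nonneg_nonneg)
      also have "\<dots> = 4 ^ DIM('a) * exp (- (real DIM('a) * t))"
        by (simp add: power_mult_distrib flip: exp_of_nat_mult)
      finally show "A * (16 * h * pi) powr (real DIM('a) / 2) \<le> 4 ^ DIM('a) * exp (- (real DIM('a) * t))" .
    qed (use M0 B in auto)
    finally show "(\<integral>\<^sup>+y. ennreal ((1 + (norm (x - y))\<^sup>2) powr b * mehler_kernel t x y) \<partial>lborel)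
      \<le> ennreal (M0 * 4 ^ DIM('a) * exp (- (real DIM('a) * t)) * exp (- (tanh t / 4 * (norm x)\<^sup>2)))"
      by (simp add: B_def ac_simps)
  qed
qed

text \<open>For t <= 1, tanh t is comparable to t and the integrand is dominated by that of a Gamma
  integral with rate proportional to 1+X, which yields (1+X)^(-s). For t > 1, tanh t is bounded
  below, so X enters through exp(-kX), which beats every power.\<close>

lemma nn_integral_time_le:
  fixes s d :: real
  assumes s: "s > 0" and d: "d \<ge> 1"
  obtains C where "C > 0" "\<And>X. X \<ge> 0 \<Longrightarrow>
    (\<integral>\<^sup>+t\<in>{0<..}. ennreal (t powr (s - 1) * (exp (- (d * t)) * exp (- (tanh t / 4 * X)))) \<partial>lborel)
      \<le> ennreal (C * (1 + X) powr (- s))"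
proof -
  \<comment> \<open>By \<open>le_tanh_real\<close>, tanh(t)/4 >= kt on [0,1] and tanh(t)/4 >= k
    beyond. As k <= 1 <= d, the factor exp(-dt) supplies the summand 1 in the rate k(1+X).\<close>
  define k :: real where "k = 1 / (4 * cosh 1)"
  have k: "0 < k" "k \<le> 1" using cosh_real_ge_1[of 1] by (auto simp: k_def cosh_real_pos divide_le_eq)
  obtain M where M: "M > 0" "\<And>X. X \<ge> 0 \<Longrightarrow> (1 + X) powr s \<le> M * exp (k * X)"
    using one_plus_powr_le_exp[OF s k(1)] by blast
  define C where "C = Gamma s * (k powr (- s) + M * d powr (- s))"
  have G: "Gamma s > 0" using s by (rule Gamma_real_pos)
  show ?thesis
  proof
    show "C > 0" unfolding C_def using G M k d by (intro mult_pos_pos add_pos_pos) auto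
    fix X :: real assume X: "X \<ge> 0"
    have pw: "exp (- (d * t)) * exp (- (tanh t / 4 * X)) \<le>
        exp (- (k * (1 + X) * t)) + M * (1 + X) powr (- s) * exp (- (d * t))"
      if t: "t > 0" for t
    proof (cases "t \<le> 1")
      case True
      have "k * t \<le> d * t" using t k d by (intro mult_right_mono) auto
      moreover have "k * t * X \<le> tanh t / 4 * X"
        using le_tanh_real[of t] True t X by (intro mult_right_mono) (auto simp: k_def)
      ultimately have "exp (- (d * t)) * exp (- (tanh t / 4 * X)) \<le> exp (- (k * (1 + X) * t))"
        by (simp add: algebra_simps flip: exp_add)
      moreover have "0 \<le> M * (1 + X) powr (- s) * exp (- (d * t))" using M by simp
      ultimately show ?thesis by linarith
    next
      case False
      have "tanh 1 \<le> tanh t" using False by simp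
      then have "1 / cosh 1 \<le> tanh t" using le_tanh_real[of 1] by linarith
      then have "k \<le> tanh t / 4" by (simp add: k_def)
      then have "exp (- (tanh t / 4 * X)) \<le> exp (- (k * X))"
        using X by (simp only: exp_le_cancel_iff neg_le_iff_le mult_right_mono)
      also have "\<dots> \<le> M * (1 + X) powr (- s)"
        using M(2)[OF X] X by (simp add: powr_minus exp_minus field_simps)
      finally have "exp (- (d * t)) * exp (- (tanh t / 4 * X)) \<le> M * (1 + X) powr (- s) * exp (- (d * t))"
        by (subst mult.commute) (intro mult_right_mono, auto)
      moreover have "0 \<le> exp (- (k * (1 + X) * t))" by simp
      ultimately show ?thesis by linarith
    qed
    have "(\<integral>\<^sup>+t\<in>{0<..}. ennreal (t powr (s - 1) * (exp (- (d * t)) * exp (- (tanh t / 4 * X)))) \<partial>lborel)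
      \<le> (\<integral>\<^sup>+t. ennreal (t powr (s - 1) * exp (- (k * (1 + X) * t))) * indicator {0<..} t
          + ennreal (M * (1 + X) powr (- s)) * (ennreal (t powr (s - 1) * exp (- (d * t))) * indicator {0<..} t) \<partial>lborel)"
    proof (rule nn_integral_mono)
      fix t :: real
      have "t powr (s - 1) * (exp (- (d * t)) * exp (- (tanh t / 4 * X))) \<le>
        t powr (s - 1) * exp (- (k * (1 + X) * t)) + M * (1 + X) powr (- s) * (t powr (s - 1) * exp (- (d * t)))" if "t > 0"
        using mult_left_mono[OF pw[OF that], of "t powr (s - 1)"] by (simp add: algebra_simps)
      then show "ennreal (t powr (s - 1) * (exp (- (d * t)) * exp (- (tanh t / 4 * X)))) * indicator {0<..} t
         \<le> ennreal (t powr (s - 1) * exp (- (k * (1 + X) * t))) * indicator {0<..} t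
          + ennreal (M * (1 + X) powr (- s)) * (ennreal (t powr (s - 1) * exp (- (d * t))) * indicator {0<..} t)"
        using M by (auto simp: indicator_def ennreal_mult''[symmetric] ennreal_plus[symmetric] intro!: ennreal_leI simp del: ennreal_plus)
    qed
    also have "\<dots> = ennreal (Gamma s * (k * (1 + X)) powr (- s)) + ennreal (M * (1 + X) powr (- s)) * ennreal (Gamma s * d powr (- s))"
      using k X d s by (subst nn_integral_add) (auto simp: nn_integral_cmult nn_integral_powr_exp)
    also have "\<dots> = ennreal (C * (1 + X) powr (- s))"
    proof -
      have "(k * (1 + X)) powr (- s) = k powr (- s) * (1 + X) powr (- s)"
        by (rule powr_mult)
      then show ?thesis
        using M G by (simp add: ennreal_mult''[symmetric] ennreal_plus[symmetric] C_def algebra_simps del: ennreal_plus)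
    qed
    finally show "(\<integral>\<^sup>+t\<in>{0<..}. ennreal (t powr (s - 1) * (exp (- (d * t)) * exp (- (tanh t / 4 * X)))) \<partial>lborel)
      \<le> ennreal (C * (1 + X) powr (- s))" .
  qed
qed

text \<open>
  Unlike \<^const>\<open>harmonic_kernel\<close>, this version takes the value \<open>\<infinity>\<close> where the time integral
  diverges; for fixed \<open>x\<close> the two agree almost everywhere.
\<close>

definition harmonic_nn :: "real \<Rightarrow> 'a::euclidean_space \<Rightarrow> 'a \<Rightarrow> ennreal" where
  "harmonic_nn s x y =
    ennreal (1 / Gamma s) * (\<integral>\<^sup>+t\<in>{0<..}. ennreal (mehler_kernel t x y * t powr (s - 1)) \<partial>lborel)"

lemma harmonic_nn_measurable [measurable (raw)]:
  fixes f g :: "'b \<Rightarrow> 'a::euclidean_space"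
  assumes [measurable]: "f \<in> borel_measurable M" "g \<in> borel_measurable M"
  shows "(\<lambda>z. harmonic_nn s (f z) (g z)) \<in> borel_measurable M"
  unfolding harmonic_nn_def by measurable

text \<open>Where the time integral diverges the identity persists because two defaults coincide:
  the Bochner integral is 0 and \<open>enn2real\<close> sends \<infinity> to 0.\<close>

lemma harmonic_kernel_eq:
  assumes "s > 0"
  shows "harmonic_kernel s x y = enn2real (harmonic_nn s x y)"
  unfolding harmonic_kernel_def harmonic_nn_def set_lebesgue_integral_def
  using Gamma_real_pos[OF assms]
  by (subst integral_eq_nn_integral)
    (auto simp: enn2real_mult mehler_kernel_nonneg ennreal_mult' mult.commute simp flip: ennreal_indicator
      intro!: nn_integral_cong arg_cong[where f = enn2real])

section \<open>Mass estimates for the time-integrated kernel\<close>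

lemma heat_mixture_Fubini:
  fixes w :: "'a::euclidean_space \<Rightarrow> ennreal"
  assumes [measurable]: "w \<in> borel_measurable borel" and s: "s > 0"
  shows "(\<integral>\<^sup>+y. harmonic_nn s x y * w y \<partial>lborel)
    = ennreal (1 / Gamma s) *
      (\<integral>\<^sup>+t\<in>{0<..}. ennreal (t powr (s - 1)) * (\<integral>\<^sup>+y. ennreal (mehler_kernel t x y) * w y \<partial>lborel) \<partial>lborel)"
proof -
  have "(\<integral>\<^sup>+y. harmonic_nn s x y * w y \<partial>lborel)
    = (\<integral>\<^sup>+y. (\<integral>\<^sup>+t. ennreal (1 / Gamma s) * (ennreal (t powr (s - 1)) * indicator {0<..} t * (ennreal (mehler_kernel t x y) * w y)) \<partial>lborel) \<partial>lborel)"
    unfolding harmonic_nn_def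
    by (intro nn_integral_cong, (subst nn_integral_cmult[symmetric] nn_integral_multc[symmetric], simp)+)
       (auto intro!: nn_integral_cong simp: ennreal_mult'' ac_simps mehler_kernel_nonneg)
  also have "\<dots> = (\<integral>\<^sup>+t. (\<integral>\<^sup>+y. ennreal (1 / Gamma s) * (ennreal (t powr (s - 1)) * indicator {0<..} t * (ennreal (mehler_kernel t x y) * w y)) \<partial>lborel) \<partial>lborel)"
    by (rule lborel_pair.Fubini') measurable
  also have "\<dots> = (\<integral>\<^sup>+t. ennreal (1 / Gamma s) * (ennreal (t powr (s - 1)) * indicator {0<..} t * (\<integral>\<^sup>+y. ennreal (mehler_kernel t x y) * w y \<partial>lborel)) \<partial>lborel)"
    by (intro nn_integral_cong) (simp add: nn_integral_cmult)
  also have "\<dots> = ennreal (1 / Gamma s) * (\<integral>\<^sup>+t. ennreal (t powr (s - 1)) * indicator {0<..} t * (\<integral>\<^sup>+y. ennreal (mehler_kernel t x y) * w y \<partial>lborel) \<partial>lborel)"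
    by (rule nn_integral_cmult) measurable
  also have "(\<integral>\<^sup>+t. ennreal (t powr (s - 1)) * indicator {0<..} t * (\<integral>\<^sup>+y. ennreal (mehler_kernel t x y) * w y \<partial>lborel) \<partial>lborel)
    = (\<integral>\<^sup>+t\<in>{0<..}. ennreal (t powr (s - 1)) * (\<integral>\<^sup>+y. ennreal (mehler_kernel t x y) * w y \<partial>lborel) \<partial>lborel)"
    by (intro nn_integral_cong) (auto simp: indicator_def)
  finally show ?thesis .
qed

text \<open>The weight in x-y is what later permits replacing a weight at y by the same weight at x;
  its power s is matched to the decay (1+|x|^2)^(-s) of the right-hand side.\<close>

lemma harmonic_weighted_mass_le:
  fixes s :: real
  assumes s: "s > 0"
  obtains C where "C > 0" "\<And>x::'a::euclidean_space.
    (\<integral>\<^sup>+y. ennreal ((1 + (norm (x - y))\<^sup>2) powr s) * harmonic_nn s x y \<partial>lborel)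
      \<le> ennreal (C * (1 + (norm x)\<^sup>2) powr (- s))"
proof -
  obtain M where M: "M > 0" "\<And>t (x::'a). t > 0 \<Longrightarrow>
    (\<integral>\<^sup>+y. ennreal ((1 + (norm (x - y))\<^sup>2) powr s * mehler_kernel t x y) \<partial>lborel)
      \<le> ennreal (M * exp (- (real DIM('a) * t)) * exp (- (tanh t / 4 * (norm x)\<^sup>2)))"
    using mehler_weighted_mass_le[OF s] by blast
  have "real DIM('a) \<ge> 1" by (simp add: Suc_leI)
  then obtain C where C: "C > 0" "\<And>X. X \<ge> 0 \<Longrightarrow>
    (\<integral>\<^sup>+t\<in>{0<..}. ennreal (t powr (s - 1) * (exp (- (real DIM('a) * t)) * exp (- (tanh t / 4 * X)))) \<partial>lborel)
      \<le> ennreal (C * (1 + X) powr (- s))"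
    using nn_integral_time_le[OF s] by blast
  have G: "Gamma s > 0" using s by (rule Gamma_real_pos)
  show ?thesis
  proof
    show "M * C / Gamma s > 0" using M C G by simp
    fix x :: 'a
    have "(\<integral>\<^sup>+y. ennreal ((1 + (norm (x - y))\<^sup>2) powr s) * harmonic_nn s x y \<partial>lborel)
      = ennreal (1 / Gamma s) * (\<integral>\<^sup>+t\<in>{0<..}. ennreal (t powr (s - 1)) * (\<integral>\<^sup>+y. ennreal ((1 + (norm (x - y))\<^sup>2) powr s * mehler_kernel t x y) \<partial>lborel) \<partial>lborel)"
      using heat_mixture_Fubini[of "\<lambda>y. ennreal ((1 + (norm (x - y))\<^sup>2) powr s)" s x] s
      by (simp add: mult.commute ennreal_mult'')
    also have "\<dots> \<le> ennreal (1 / Gamma s) * (\<integral>\<^sup>+t. ennreal M * (ennreal (t powr (s - 1) * (exp (- (real DIM('a) * t)) * exp (- (tanh t / 4 * (norm x)\<^sup>2)))) * indicator {0<..} t) \<partial>lborel)"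
    proof (intro mult_left_mono nn_integral_mono)
      fix t :: real
      have "ennreal (t powr (s - 1)) * (\<integral>\<^sup>+y. ennreal ((1 + (norm (x - y))\<^sup>2) powr s * mehler_kernel t x y) \<partial>lborel)
        \<le> ennreal (t powr (s - 1)) * ennreal (M * exp (- (real DIM('a) * t)) * exp (- (tanh t / 4 * (norm x)\<^sup>2)))" if "t > 0"
        using M(2)[OF that, of x] by (intro mult_left_mono) auto
      then show "ennreal (t powr (s - 1)) * (\<integral>\<^sup>+y. ennreal ((1 + (norm (x - y))\<^sup>2) powr s * mehler_kernel t x y) \<partial>lborel) * indicator {0<..} t
        \<le> ennreal M * (ennreal (t powr (s - 1) * (exp (- (real DIM('a) * t)) * exp (- (tanh t / 4 * (norm x)\<^sup>2)))) * indicator {0<..} t)"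
        using M(1) by (auto simp: indicator_def ennreal_mult''[symmetric] ac_simps)
    qed auto
    also have "\<dots> = ennreal (M / Gamma s) * (\<integral>\<^sup>+t\<in>{0<..}. ennreal (t powr (s - 1) * (exp (- (real DIM('a) * t)) * exp (- (tanh t / 4 * (norm x)\<^sup>2)))) \<partial>lborel)"
      using M G by (subst nn_integral_cmult) (auto simp: tanh_def sinh_field_def cosh_field_def ennreal_mult''[symmetric] mult.assoc[symmetric])
    also have "\<dots> \<le> ennreal (M / Gamma s) * ennreal (C * (1 + (norm x)\<^sup>2) powr (- s))"
      by (intro mult_left_mono C) auto
    also have "\<dots> = ennreal (M * C / Gamma s * (1 + (norm x)\<^sup>2) powr (- s))"
      using M C G by (simp add: ennreal_mult''[symmetric])
    finally show "(\<integral>\<^sup>+y. ennreal ((1 + (norm (x - y))\<^sup>2) powr s) * harmonic_nn s x y \<partial>lborel)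
      \<le> ennreal (M * C / Gamma s * (1 + (norm x)\<^sup>2) powr (- s))" .
  qed
qed

text \<open>The confining term is bounded from above by |x+y|^2 <= 8|x|^2 + 2|x-y|^2. With h = tanh
  t <= t, the part in x costs at most 2t|x|^2 and the part in x-y only enlarges the Gaussian
  exponent from |x-y|^2/(4h) to 3|x-y|^2/(4h), so a Gaussian integral remains.\<close>

lemma mehler_mass_ge:
  obtains c where "c > 0" "\<And>t (x::'a::euclidean_space). 0 < t \<Longrightarrow> t \<le> 1 \<Longrightarrow>
    ennreal (c * exp (- (2 * t * (norm x)\<^sup>2))) \<le> (\<integral>\<^sup>+y. ennreal (mehler_kernel t x y) \<partial>lborel)"
proof
  \<comment> \<open>Prefactor times Gaussian integral equals (3 cosh^2 t)^(-d/2), which is smallest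
    on (0,1] at t = 1.\<close>
  define c where "c = (1 / (3 * (cosh (1::real))\<^sup>2)) powr (real DIM('a) / 2)"
  show "c > 0" using cosh_real_pos[of 1] by (simp add: c_def)
  fix t :: real and x :: 'a
  assume t: "0 < t" "t \<le> 1"
  define h where "h = tanh t"
  define A where "A = (2 * pi * sinh (2 * t)) powr (- (real DIM('a) / 2))"
  have h: "0 < h" "h < 1" "h \<le> t" using t by (auto simp: h_def tanh_real_lt_1 tanh_real_le)
  have "A * exp (- (2 * t * (norm x)\<^sup>2)) * exp (- (3 / (4 * h)) * (norm (x - y))\<^sup>2) \<le> mehler_kernel t x y" for y
  proof -
    define u v where "u = (norm (x - y))\<^sup>2" and "v = (norm (x + y))\<^sup>2"
    have u: "u \<ge> 0" by (simp add: u_def)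
    \<comment> \<open>With x+y = 2x - (x-y), the parallelogram law for 2x and x-y bounds v.\<close>
    have "v = (norm (2 *\<^sub>R x - (x - y)))\<^sup>2" by (simp add: v_def scaleR_2)
    moreover have "(norm (2 *\<^sub>R x - (x - y)))\<^sup>2 + (norm (2 *\<^sub>R x + (x - y)))\<^sup>2 = 2 * (norm (2 *\<^sub>R x))\<^sup>2 + 2 * u"
      using norm_add_diff_power2[of "2 *\<^sub>R x" "x - y"] by (simp add: u_def)
    moreover have "(norm (2 *\<^sub>R x))\<^sup>2 = 4 * (norm x)\<^sup>2" by (simp add: power_mult_distrib)
    ultimately have v: "v \<le> 8 * (norm x)\<^sup>2 + 2 * u"
      using zero_le_power2[of "norm (2 *\<^sub>R x + (x - y))"] by linarith
    have "h * v \<le> h * (8 * (norm x)\<^sup>2 + 2 * u)" using v h by (intro mult_left_mono) auto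
    moreover have "h * h \<le> 1" using h by (simp add: mult_le_one)
    then have "h * u \<le> u / h" using h u mult_right_mono[of "h * h" 1 u] by (simp add: field_simps)
    moreover have "h * (norm x)\<^sup>2 \<le> t * (norm x)\<^sup>2" using h by (intro mult_right_mono) auto
    ultimately have "1 / 4 * (u / h) + h * v / 4 \<le> 3 / 4 * (u / h) + 2 * (t * (norm x)\<^sup>2)"
      unfolding distrib_left by linarith
    moreover have "- (3 / (4 * h)) * u = - (3 / 4 * (u / h))" "u / (4 * h) = 1 / 4 * (u / h)" by simp_all
    ultimately have "exp (- (2 * t * (norm x)\<^sup>2)) * exp (- (3 / (4 * h)) * u) \<le> exp (- (u / (4 * h) + h * v / 4))"
      unfolding exp_add[symmetric] exp_le_cancel_iff by linarith
    then have "A * (exp (- (2 * t * (norm x)\<^sup>2)) * exp (- (3 / (4 * h)) * u)) \<le> A * exp (- (u / (4 * h) + h * v / 4))"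
      by (intro mult_left_mono) (auto simp: A_def)
    then show ?thesis
      unfolding mehler_kernel_eq[OF t(1)] by (simp add: A_def u_def v_def h_def mult.assoc)
  qed
  then have "(\<integral>\<^sup>+y. ennreal (A * exp (- (2 * t * (norm x)\<^sup>2))) * ennreal (exp (- (3 / (4 * h)) * (norm (x - y))\<^sup>2)) \<partial>lborel)
      \<le> (\<integral>\<^sup>+y. ennreal (mehler_kernel t x y) \<partial>lborel)"
    by (intro nn_integral_mono) (simp add: ennreal_mult''[symmetric] ennreal_leI)
  also have "(\<integral>\<^sup>+y. ennreal (A * exp (- (2 * t * (norm x)\<^sup>2))) * ennreal (exp (- (3 / (4 * h)) * (norm (x - y))\<^sup>2)) \<partial>lborel)
    = ennreal (A * exp (- (2 * t * (norm x)\<^sup>2))) * ennreal ((pi / (3 / (4 * h))) powr (real DIM('a) / 2))"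
    using h by (subst nn_integral_cmult, simp, subst nn_integral_gaussian) auto
  also have "\<dots> = ennreal ((A * (4 * h * pi / 3) powr (real DIM('a) / 2)) * exp (- (2 * t * (norm x)\<^sup>2)))"
    by (simp add: A_def ennreal_mult''[symmetric] ac_simps)
  finally have le: "\<dots> \<le> (\<integral>\<^sup>+y. ennreal (mehler_kernel t x y) \<partial>lborel)" .
  have "c \<le> (1 / (3 * (cosh t)\<^sup>2)) powr (real DIM('a) / 2)"
    unfolding c_def using t cosh_real_pos[of t] by (intro powr_mono2 divide_left_mono) (auto simp: cosh_real_nonneg_le_iff)
  also have "1 / (3 * (cosh t)\<^sup>2) = (4 * h * pi / 3) / (2 * pi * sinh (2 * t))"
    using t cosh_real_pos[of t] unfolding h_def tanh_def sinh_double by (simp add: power2_eq_square field_simps)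
  also have "\<dots> powr (real DIM('a) / 2) = A * (4 * h * pi / 3) powr (real DIM('a) / 2)"
    using t h by (subst powr_divide) (auto simp: A_def powr_minus field_simps)
  finally have "ennreal (c * exp (- (2 * t * (norm x)\<^sup>2))) \<le> ennreal ((A * (4 * h * pi / 3) powr (real DIM('a) / 2)) * exp (- (2 * t * (norm x)\<^sup>2)))"
    by (intro ennreal_leI mult_right_mono) auto
  with le show "ennreal (c * exp (- (2 * t * (norm x)\<^sup>2))) \<le> (\<integral>\<^sup>+y. ennreal (mehler_kernel t x y) \<partial>lborel)"
    by (rule order_trans[rotated])
qed

text \<open>Only the times t <= T = 1/(1+|x|^2) are kept. There t|x|^2 <= 1, so the mass of the heat
  kernel is at least c e^(-2), and t^(s-1) integrates to T^s / s over (0,T].\<close>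

lemma harmonic_mass_ge:
  fixes s :: real
  assumes s: "s > 0"
  obtains c where "c > 0" "\<And>x::'a::euclidean_space.
    ennreal (c * (1 + (norm x)\<^sup>2) powr (- s)) \<le> (\<integral>\<^sup>+y. harmonic_nn s x y \<partial>lborel)"
proof -
  obtain c where c: "c > 0" "\<And>t (x::'a). 0 < t \<Longrightarrow> t \<le> 1 \<Longrightarrow>
    ennreal (c * exp (- (2 * t * (norm x)\<^sup>2))) \<le> (\<integral>\<^sup>+y. ennreal (mehler_kernel t x y) \<partial>lborel)"
    by (rule mehler_mass_ge) blast
  have G: "Gamma s > 0" using s by (rule Gamma_real_pos)
  show ?thesis
  proof
    show "c * exp (- 2) / (s * Gamma s) > 0" using c s G by simp
    fix x :: 'a
    define T where "T = 1 / (1 + (norm x)\<^sup>2)"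
    have X: "1 + (norm x)\<^sup>2 > 0" by (simp add: add_pos_nonneg)
    have T: "0 < T" "T \<le> 1" using X by (auto simp: T_def divide_le_eq)
    have "ennreal (c * exp (- 2) / (s * Gamma s) * (1 + (norm x)\<^sup>2) powr (- s))
      = ennreal (1 / Gamma s) * (ennreal (c * exp (- 2)) * ennreal (T powr s / s))"
      using G s c X by (simp add: ennreal_mult''[symmetric] T_def powr_minus powr_divide field_simps)
    also have "ennreal (c * exp (- 2)) * ennreal (T powr s / s)
      = (\<integral>\<^sup>+t. ennreal (c * exp (- 2)) * (ennreal (t powr (s - 1)) * indicator {0..T} t) \<partial>lborel)"
      using T s by (subst nn_integral_cmult) (auto simp: nn_integral_powr_from_0)
    also have "\<dots> \<le> (\<integral>\<^sup>+t\<in>{0<..}. ennreal (t powr (s - 1)) * (\<integral>\<^sup>+y. ennreal (mehler_kernel t x y) * 1 \<partial>lborel) \<partial>lborel)"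
    proof (rule nn_integral_mono)
      fix t :: real
      have "ennreal (c * exp (- 2)) \<le> (\<integral>\<^sup>+y. ennreal (mehler_kernel t x y) \<partial>lborel)" if t: "0 < t" "t \<le> T"
      proof -
        have "t * (norm x)\<^sup>2 \<le> T * (1 + (norm x)\<^sup>2)" using t T by (intro mult_mono) auto
        also have "\<dots> = 1" using X by (simp add: T_def)
        finally have "ennreal (c * exp (- 2)) \<le> ennreal (c * exp (- (2 * t * (norm x)\<^sup>2)))"
          using c by (intro ennreal_leI mult_left_mono) auto
        also have "\<dots> \<le> (\<integral>\<^sup>+y. ennreal (mehler_kernel t x y) \<partial>lborel)" using t T by (intro c) auto
        finally show ?thesis .
      qed
      then show "ennreal (c * exp (- 2)) * (ennreal (t powr (s - 1)) * indicator {0..T} t)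
        \<le> ennreal (t powr (s - 1)) * (\<integral>\<^sup>+y. ennreal (mehler_kernel t x y) * 1 \<partial>lborel) * indicator {0<..} t"
        by (cases "t = 0") (auto simp: indicator_def mult.commute intro!: mult_left_mono)
    qed
    finally show "ennreal (c * exp (- 2) / (s * Gamma s) * (1 + (norm x)\<^sup>2) powr (- s)) \<le> (\<integral>\<^sup>+y. harmonic_nn s x y \<partial>lborel)"
      using heat_mixture_Fubini[of "\<lambda>_. 1" s x] s by (simp add: mult_left_mono)
  qed
qed

text \<open>The heat kernel has two bounds for its mass on F: a constant M, and v t^(-d/2) from its
  supremum. The first is integrated over small times, where s > 0 gives convergence, the second over
  large times, where s < d/2 does. This rate depends on F only through its volume, as for the Riesz
  kernel, whose integral over sets of given volume is largest on balls.\<close>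

lemma harmonic_nn_set_le:
  fixes x :: "'a::euclidean_space"
  assumes s: "0 < s" "s < real DIM('a) / 2"
  obtains C where "C > 0" "\<And>(x::'a) F v. F \<in> sets borel \<Longrightarrow> v > 0 \<Longrightarrow> emeasure lborel F \<le> ennreal v \<Longrightarrow>
    (\<integral>\<^sup>+y\<in>F. harmonic_nn s x y \<partial>lborel) \<le> ennreal (C * v powr (2 * s / DIM('a)))"
proof -
  obtain M where M: "M > 0" "\<And>t (x::'a). t > 0 \<Longrightarrow>
    (\<integral>\<^sup>+y. ennreal ((1 + (norm (x - y))\<^sup>2) powr s * mehler_kernel t x y) \<partial>lborel)
      \<le> ennreal (M * exp (- (real DIM('a) * t)) * exp (- (tanh t / 4 * (norm x)\<^sup>2)))"
    using mehler_weighted_mass_le[OF s(1)] by blast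
  have G: "Gamma s > 0" using s(1) by (rule Gamma_real_pos)
  define d where "d = real DIM('a)"
  have d: "d \<ge> 1" by (simp add: d_def Suc_leI)
  define C where "C = (M / s + 1 / (d / 2 - s)) / Gamma s"
  show ?thesis
  proof
    show "C > 0" unfolding C_def using M G s by (intro divide_pos_pos add_pos_pos) (auto simp: d_def)
    fix x :: 'a and F :: "'a set" and v :: real
    assume [measurable]: "F \<in> sets borel" and v: "v > 0" "emeasure lborel F \<le> ennreal v"
    \<comment> \<open>At this time the two mass bounds balance up to a constant; both halves of the
      time integral are then multiples of v^(2s/d).\<close>
    define T where "T = v powr (2 / d)"
    have T: "T > 0" using v by (simp add: T_def)
    have mass: "(\<integral>\<^sup>+y. ennreal (mehler_kernel t x y) * indicator F y \<partial>lborel) \<le> ennreal M" if t: "t > 0" for t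
    proof -
      have "(\<integral>\<^sup>+y. ennreal (mehler_kernel t x y) * indicator F y \<partial>lborel)
        \<le> (\<integral>\<^sup>+y. ennreal ((1 + (norm (x - y))\<^sup>2) powr s * mehler_kernel t x y) \<partial>lborel)"
      proof (rule nn_integral_mono)
        fix y
        have "mehler_kernel t x y \<le> (1 + (norm (x - y))\<^sup>2) powr s * mehler_kernel t x y"
          using s mult_right_mono[of 1 "(1 + (norm (x - y))\<^sup>2) powr s" "mehler_kernel t x y"]
          by (simp add: mehler_kernel_nonneg ge_one_powr_ge_zero)
        then show "ennreal (mehler_kernel t x y) * indicator F y \<le> ennreal ((1 + (norm (x - y))\<^sup>2) powr s * mehler_kernel t x y)"
          by (auto simp: indicator_def intro: ennreal_leI)
      qed
      also have "\<dots> \<le> ennreal (M * exp (- (real DIM('a) * t)) * exp (- (tanh t / 4 * (norm x)\<^sup>2)))"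
        using M t by blast
      also have "\<dots> \<le> ennreal M"
        using M t by (auto intro!: ennreal_leI mult_left_le order_trans[OF mult_left_le] mult_nonneg_nonneg)
      finally show ?thesis .
    qed
    have vol: "(\<integral>\<^sup>+y. ennreal (mehler_kernel t x y) * indicator F y \<partial>lborel) \<le> ennreal (t powr (- (d / 2)) * v)" if t: "t > 0" for t
    proof -
      have "(\<integral>\<^sup>+y. ennreal (mehler_kernel t x y) * indicator F y \<partial>lborel) \<le> (\<integral>\<^sup>+y. ennreal (t powr (- (d / 2))) * indicator F y \<partial>lborel)"
        using mehler_kernel_le_powr[OF t, of x] by (intro nn_integral_mono mult_right_mono ennreal_leI) (auto simp: d_def)
      also have "\<dots> = ennreal (t powr (- (d / 2))) * emeasure lborel F"
        by (subst nn_integral_cmult_indicator) auto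
      also have "\<dots> \<le> ennreal (t powr (- (d / 2))) * ennreal v"
        by (intro mult_left_mono v) auto
      finally show ?thesis using v by (simp add: ennreal_mult'')
    qed
    have "(\<integral>\<^sup>+y\<in>F. harmonic_nn s x y \<partial>lborel)
      = ennreal (1 / Gamma s) * (\<integral>\<^sup>+t\<in>{0<..}. ennreal (t powr (s - 1)) * (\<integral>\<^sup>+y. ennreal (mehler_kernel t x y) * indicator F y \<partial>lborel) \<partial>lborel)"
      using s by (subst heat_mixture_Fubini) auto
    also have "\<dots> \<le> ennreal (1 / Gamma s) * (\<integral>\<^sup>+t. ennreal M * (ennreal (t powr (s - 1)) * indicator {0..T} t)
        + ennreal v * (ennreal (t powr (- (d / 2 - s) - 1)) * indicator {T..} t) \<partial>lborel)"
    proof (intro mult_left_mono nn_integral_mono)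
      fix t :: real
      consider "t \<le> 0" | "0 < t" "t \<le> T" | "t > 0" "t > T" by linarith
      then show "ennreal (t powr (s - 1)) * (\<integral>\<^sup>+y. ennreal (mehler_kernel t x y) * indicator F y \<partial>lborel) * indicator {0<..} t
        \<le> ennreal M * (ennreal (t powr (s - 1)) * indicator {0..T} t) + ennreal v * (ennreal (t powr (- (d / 2 - s) - 1)) * indicator {T..} t)"
      proof cases
        case 2
        have "ennreal (t powr (s - 1)) * (\<integral>\<^sup>+y. ennreal (mehler_kernel t x y) * indicator F y \<partial>lborel) \<le> ennreal (t powr (s - 1)) * ennreal M"
          by (intro mult_left_mono mass 2) auto
        then show ?thesis using 2 by (auto simp: mult.commute intro: add_increasing2)
      next
        case 3
        have "ennreal (t powr (s - 1)) * (\<integral>\<^sup>+y. ennreal (mehler_kernel t x y) * indicator F y \<partial>lborel) \<le> ennreal (t powr (s - 1)) * ennreal (t powr (- (d / 2)) * v)"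
          by (intro mult_left_mono vol 3) auto
        also have "\<dots> = ennreal v * ennreal (t powr (- (d / 2 - s) - 1))"
        proof -
          have "t powr (- (d / 2 - s) - 1) = t powr (s - 1) * t powr (- (d / 2))"
            by (simp add: algebra_simps flip: powr_add)
          then show ?thesis using v by (simp add: ennreal_mult''[symmetric] ac_simps)
        qed
        finally show ?thesis using 3 by simp
      qed auto
    qed auto
    also have "\<dots> = ennreal (1 / Gamma s) * (ennreal M * ennreal (T powr s / s) + ennreal v * ennreal (T powr (- (d / 2 - s)) / (d / 2 - s)))"
    proof -
      have "d / 2 - s > 0" using s by (simp add: d_def)
      from nn_integral_powr_to_inf[OF this T] show ?thesis
        using s T by (subst nn_integral_add)
          (simp_all add: nn_integral_cmult nn_integral_powr_from_0 del: minus_diff_eq)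
    qed
    also have "\<dots> = ennreal (C * v powr (2 * s / DIM('a)))"
    proof -
      have T1: "T powr s = v powr (2 * s / d)" by (simp add: T_def powr_powr)
      have "2 / d * (- (d / 2 - s)) = 2 * s / d - 1" using d by (simp add: field_simps)
      then have "T powr (- (d / 2 - s)) = v powr (2 * s / d - 1)" unfolding T_def powr_powr by simp
      then have T2: "v * T powr (- (d / 2 - s)) = v powr (2 * s / d)"
        using v by (simp add: powr_diff)
      have "ennreal (1 / Gamma s) * (ennreal M * ennreal (T powr s / s) + ennreal v * ennreal (T powr (- (d / 2 - s)) / (d / 2 - s)))
        = ennreal ((1 / Gamma s) * (M * (T powr s / s) + v * T powr (- (d / 2 - s)) / (d / 2 - s)))"
        using G M v s by (simp add: ennreal_mult''[symmetric] ennreal_plus[symmetric] d_def del: ennreal_plus)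
      also have "(1 / Gamma s) * (M * (T powr s / s) + v * T powr (- (d / 2 - s)) / (d / 2 - s)) = C * v powr (2 * s / d)"
        unfolding T1 T2 C_def by (simp add: algebra_simps add_divide_distrib)
      finally show ?thesis by (simp add: d_def)
    qed
    finally show "(\<integral>\<^sup>+y\<in>F. harmonic_nn s x y \<partial>lborel) \<le> ennreal (C * v powr (2 * s / DIM('a)))" .
  qed
qed

text \<open>With r = |x|^2, only the times between r and 2r are kept, when the Gaussian has width
  about |x|. Both |x-y| and |x+y| are at most 2|x|, so the heat kernel is at least a multiple of
  r^(-d/2), t^(s-1) is at least a multiple of r^(s-1), and the interval has length r. The
  restriction |x| <= 1/4 keeps 2t in [0,1], where hyperbolic functions are compared with linear
  ones. The bound is uniform in y, so it survives averaging over a ball about the origin.\<close>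

lemma harmonic_nn_ge_near_origin:
  fixes s :: real
  assumes s: "s > 0"
  obtains c where "c > 0" "\<And>x y::'a::euclidean_space. 0 < norm x \<Longrightarrow> norm x \<le> 1 / 4 \<Longrightarrow> norm y \<le> norm x \<Longrightarrow>
    ennreal (c * norm x powr (2 * s - DIM('a))) \<le> harmonic_nn s x y"
proof -
  define k where "k = cosh (1::real)"
  have k: "k \<ge> 1" by (simp add: k_def cosh_real_ge_1)
  \<comment> \<open>Here 8 pi k r bounds 2 pi sinh 2t; in the exponent, k bounds |x-y|^2 / (4 tanh
    t) and 1 bounds the confining term; the factor 1/2 comes from r^s/(2r) <= t^(s-1).\<close>
  define c0 where "c0 = (8 * pi * k) powr (- (real DIM('a) / 2)) * exp (- (k + 1)) / 2"
  have c0: "c0 > 0" using k by (simp add: c0_def)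
  have G: "Gamma s > 0" using s by (rule Gamma_real_pos)
  show ?thesis
  proof
    show "c0 / Gamma s > 0" using c0 G by simp
    fix x y :: 'a
    assume x: "0 < norm x" "norm x \<le> 1 / 4" and y: "norm y \<le> norm x"
    define r where "r = (norm x)\<^sup>2"
    have r: "0 < r" "r \<le> 1 / 16"
      using x power_mono[of "norm x" "1 / 4" 2] by (auto simp: r_def power2_eq_square)
    have u: "(norm (x - y))\<^sup>2 \<le> 4 * r"
      using power_mono[OF order_trans[OF norm_triangle_ineq4, of x y "2 * norm x"], of 2] y by (simp add: r_def power_mult_distrib)
    have v: "(norm (x + y))\<^sup>2 \<le> 4 * r"
      using power_mono[OF order_trans[OF norm_triangle_ineq, of x y "2 * norm x"], of 2] y by (simp add: r_def power_mult_distrib)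
    have mehler: "(8 * pi * k * r) powr (- (real DIM('a) / 2)) * exp (- (k + 1)) \<le> mehler_kernel t x y"
      if t: "r \<le> t" "t \<le> 2 * r" for t
    proof -
      have t01: "0 < t" "2 * t \<le> 1" using t r by auto
      define h where "h = tanh t"
      have h: "0 < h" "h \<le> 1" "r / k \<le> h"
        using le_tanh_real[of t] t01 t k tanh_real_lt_1[of t] divide_right_mono[of r t k] by (auto simp: h_def k_def)
      have "sinh (2 * t) \<le> 2 * t * cosh (2 * t)"
        using tanh_real_le[of "2 * t"] t01 cosh_real_pos[of "2 * t"] by (simp add: tanh_def divide_le_eq)
      also have "\<dots> \<le> 4 * r * k"
        unfolding k_def by (rule mult_mono) (use t t01 r in \<open>auto simp: cosh_real_nonneg_le_iff\<close>)
      finally have "2 * pi * sinh (2 * t) \<le> 8 * pi * k * r" by (simp add: ac_simps)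
      then have "(8 * pi * k * r) powr (- (real DIM('a) / 2)) \<le> (2 * pi * sinh (2 * t)) powr (- (real DIM('a) / 2))"
        using t01 by (intro powr_mono2') auto
      moreover have "exp (- (k + 1)) \<le> exp (- ((norm (x - y))\<^sup>2 / (4 * h) + h * (norm (x + y))\<^sup>2 / 4))"
      proof -
        have "(norm (x - y))\<^sup>2 / (4 * h) \<le> 4 * r / (4 * h)" using u h by (intro divide_right_mono) auto
        also have "\<dots> \<le> k" using h k by (simp add: field_simps)
        finally have 1: "(norm (x - y))\<^sup>2 / (4 * h) \<le> k" .
        have "h * (norm (x + y))\<^sup>2 \<le> 1 * (4 * r)" using h v r by (intro mult_mono) auto
        then have "h * (norm (x + y))\<^sup>2 / 4 \<le> 1" using r by simp
        with 1 show ?thesis by simp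
      qed
      ultimately show ?thesis
        unfolding mehler_kernel_eq[OF t01(1)] h_def by (intro mult_mono) auto
    qed
    have "c0 * norm x powr (2 * s - DIM('a)) = (8 * pi * k * r) powr (- (real DIM('a) / 2)) * exp (- (k + 1)) * (r powr s / (2 * r)) * r"
    proof -
      have "r powr s = norm x powr (2 * s)" "r powr (- (real DIM('a) / 2)) = norm x powr (- DIM('a))"
        using x by (simp_all add: r_def powr_powr flip: powr_numeral)
      then show ?thesis
        using x r by (simp add: c0_def powr_mult powr_diff powr_minus field_simps)
    qed
    then have "c0 / Gamma s * norm x powr (2 * s - DIM('a))
      = 1 / Gamma s * ((8 * pi * k * r) powr (- (real DIM('a) / 2)) * exp (- (k + 1)) * (r powr s / (2 * r)) * r)"
      by (metis mult.assoc mult.commute times_divide_eq_left mult_1)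
    then have "ennreal (c0 / Gamma s * norm x powr (2 * s - DIM('a)))
      = ennreal (1 / Gamma s) * (ennreal ((8 * pi * k * r) powr (- (real DIM('a) / 2)) * exp (- (k + 1)) * (r powr s / (2 * r))) * emeasure lborel {r..2 * r})"
      using G r by (simp only:) (simp add: ennreal_mult''[symmetric])
    also have "\<dots> = ennreal (1 / Gamma s) * (\<integral>\<^sup>+t. ennreal ((8 * pi * k * r) powr (- (real DIM('a) / 2)) * exp (- (k + 1)) * (r powr s / (2 * r))) * indicator {r..2 * r} t \<partial>lborel)"
      by (subst nn_integral_cmult_indicator) auto
    also have "\<dots> \<le> harmonic_nn s x y"
      unfolding harmonic_nn_def
    proof (intro mult_left_mono nn_integral_mono)
      fix t :: real
      have "(8 * pi * k * r) powr (- (real DIM('a) / 2)) * exp (- (k + 1)) * (r powr s / (2 * r)) \<le> mehler_kernel t x y * t powr (s - 1)"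
        if t: "r \<le> t" "t \<le> 2 * r"
      proof (intro mult_mono mehler t)
        \<comment> \<open>Writing t^(s-1) as t^s / t makes the estimate independent of the sign of
          s-1.\<close>
        have "r powr s / (2 * r) \<le> t powr s / t" using t r s by (intro frac_le powr_mono2) auto
        also have "\<dots> = t powr (s - 1)" using t r by (simp add: powr_diff)
        finally show "r powr s / (2 * r) \<le> t powr (s - 1)" .
      qed (use r in \<open>auto simp: mehler_kernel_nonneg\<close>)
      then show "ennreal ((8 * pi * k * r) powr (- (real DIM('a) / 2)) * exp (- (k + 1)) * (r powr s / (2 * r))) * indicator {r..2 * r} t
        \<le> ennreal (mehler_kernel t x y * t powr (s - 1)) * indicator {0<..} t"
        using r by (auto simp: indicator_def intro: ennreal_leI)
    qed auto
    finally show "ennreal (c0 / Gamma s * norm x powr (2 * s - DIM('a))) \<le> harmonic_nn s x y" .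
  qed
qed

section \<open>Operators with symmetric kernels\<close>

text \<open>Duality of L^q norms for a function that may be infinite. Testing on normalized
  indicators of balls gives finiteness almost everywhere, which the second conclusion could not
  detect as \<open>enn2real\<close> hides \<infinity>. The norm bound comes from testing on the
  extremal function of Hoelder's inequality, after truncation so that the integral divided by is
  finite.\<close>

lemma converse_Holder:
  fixes U :: "'a::euclidean_space \<Rightarrow> ennreal"
  assumes [measurable]: "U \<in> borel_measurable borel" and q: "q > 1" and C: "C \<ge> 0"
    and test: "\<And>h. h \<in> borel_measurable borel \<Longrightarrow> (\<And>x. 0 \<le> h x) \<Longrightarrow>
      (\<integral>\<^sup>+x. ennreal (h x powr (q / (q - 1))) \<partial>lborel) \<le> 1 \<Longrightarrow>
      (\<integral>\<^sup>+x. U x * ennreal (h x) \<partial>lborel) \<le> ennreal C"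
  shows "(AE x in lborel. U x < \<infinity>) \<and> (\<integral>\<^sup>+x. ennreal (enn2real (U x) powr q) \<partial>lborel) \<le> ennreal (C powr q)"
proof -
  \<comment> \<open>Bounding both U and the domain makes the q-th power integrable on each
    \<open>A n\<close>; the sets exhaust the points where U is finite.\<close>
  define A :: "nat \<Rightarrow> 'a set" where "A n = {x. U x \<le> of_nat n} \<inter> ball 0 (real n)" for n
  have A[measurable]: "A n \<in> sets borel" for n unfolding A_def by measurable
  have incA: "incseq A"
  proof (rule incseq_SucI, rule subsetI)
    fix n x assume "x \<in> A n"
    then show "x \<in> A (Suc n)" by (auto simp: A_def intro: order_trans)
  qed
  have UA: "(\<Union>n. A n) = {x. U x < \<infinity>}"
  proof (intro set_eqI iffI)
    fix x assume "x \<in> {x. U x < \<infinity>}"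
    then obtain r where r: "U x = ennreal r" "r \<ge> 0" by (cases "U x") auto
    obtain n where "max r (norm x) < real n" using reals_Archimedean2 by blast
    then have "x \<in> A n" using r
      by (auto simp: A_def ennreal_of_nat_eq_real_of_nat intro!: ennreal_leI)
    then show "x \<in> (\<Union>n. A n)" by blast
  next
    fix x assume "x \<in> (\<Union>n. A n)"
    then show "x \<in> {x. U x < \<infinity>}"
      by (auto simp: A_def ennreal_of_nat_eq_real_of_nat intro: le_less_trans)
  qed
  have fin_ball: "AE x in lborel. x \<in> ball (0::'a) (real (Suc n)) \<longrightarrow> U x < \<infinity>" for n
  proof -
    have [measurable]: "ball (0::'a) (real (Suc n)) \<in> sets borel" by simp
    define m where "m = measure lborel (ball (0::'a) (real (Suc n)))"
    have m: "m > 0" "emeasure lborel (ball (0::'a) (real (Suc n))) = ennreal m"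
      using emeasure_lborel_ball_finite[of "0::'a" "real (Suc n)"]
      by (auto simp: m_def less_top[symmetric] simp del: of_nat_Suc intro!: emeasure_eq_ennreal_measure)
    \<comment> \<open>This normalizes the indicator of the ball in the conjugate exponent
      q/(q-1).\<close>
    define c where "c = m powr (- ((q - 1) / q))"
    have c: "c > 0" using m by (simp add: c_def)
    have e: "- ((q - 1) / q) * (q / (q - 1)) = - 1" using q by (simp add: field_simps)
    have cpow: "c powr (q / (q - 1)) = 1 / m"
      unfolding c_def powr_powr e using m by (simp add: powr_minus_divide)
    have "(\<integral>\<^sup>+x. U x * ennreal (c * indicator (ball 0 (real (Suc n))) x) \<partial>lborel) \<le> ennreal C"
    proof (rule test)
      have "(\<integral>\<^sup>+x. ennreal ((c * indicator (ball 0 (real (Suc n))) x) powr (q / (q - 1))) \<partial>(lborel::'a measure))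
        = (\<integral>\<^sup>+x. ennreal (1 / m) * indicator (ball 0 (real (Suc n))) x \<partial>(lborel::'a measure))"
        by (intro nn_integral_cong) (auto simp: indicator_def cpow)
      also have "\<dots> = 1"
        using m by (simp add: nn_integral_cmult_indicator ennreal_mult''[symmetric] del: of_nat_Suc)
      finally show "(\<integral>\<^sup>+x. ennreal ((c * indicator (ball 0 (real (Suc n))) x) powr (q / (q - 1))) \<partial>(lborel::'a measure)) \<le> 1"
        by simp
      show "(\<lambda>x. c * indicator (ball 0 (real (Suc n))) x) \<in> borel_measurable (borel :: 'a measure)"
        by measurable
    qed (use c in auto)
    then have "(\<integral>\<^sup>+x. U x * ennreal (c * indicator (ball 0 (real (Suc n))) x) \<partial>lborel) \<noteq> \<infinity>"
      by (auto simp: top_unique)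
    then have "AE x in lborel. U x * ennreal (c * indicator (ball 0 (real (Suc n))) x) \<noteq> \<infinity>"
      by (intro nn_integral_PInf_AE) measurable
    then show ?thesis
      by eventually_elim (use c in \<open>auto simp: less_top ennreal_top_mult ennreal_mult_eq_top_iff\<close>)
  qed
  then have "AE x in lborel. \<forall>n. x \<in> ball (0::'a) (real (Suc n)) \<longrightarrow> U x < \<infinity>"
    unfolding AE_all_countable by blast
  then have AE_fin: "AE x in lborel. U x < \<infinity>"
  proof eventually_elim
    fix x assume *: "\<forall>n. x \<in> ball (0::'a) (real (Suc n)) \<longrightarrow> U x < \<infinity>"
    obtain n where "norm x < real n" using reals_Archimedean2 by blast
    with *[rule_format, of n] show "U x < \<infinity>" by simp
  qed
  have le_A: "(\<integral>\<^sup>+x\<in>A n. ennreal (enn2real (U x) powr q) \<partial>lborel) \<le> ennreal (C powr q)" for n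
  proof -
    define u where "u x = enn2real (U x) * indicator (A n) x" for x
    have [measurable]: "u \<in> borel_measurable borel" unfolding u_def by measurable
    have u0: "u x \<ge> 0" for x by (simp add: u_def)
    have Uu: "U x * indicator (A n) x = ennreal (u x)" for x
      by (cases "U x") (auto simp: u_def A_def indicator_def top_unique ennreal_of_nat_eq_real_of_nat)
    define I where "I = (\<integral>\<^sup>+x. ennreal (u x powr q) \<partial>lborel)"
    have "I \<le> (\<integral>\<^sup>+x. ennreal (real n powr q) * indicator (ball 0 (real n)) x \<partial>(lborel::'a measure))"
      unfolding I_def
    proof (rule nn_integral_mono)
      fix x
      have "enn2real (U x) \<le> real n" if "U x \<le> of_nat n"
        using that by (cases "U x") (auto simp: ennreal_of_nat_eq_real_of_nat top_unique)
      then show "ennreal (u x powr q) \<le> ennreal (real n powr q) * indicator (ball 0 (real n)) x"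
        using q by (auto simp: u_def A_def indicator_def intro!: ennreal_leI powr_mono2)
    qed
    also have "\<dots> < \<infinity>"
      using emeasure_lborel_ball_finite[of "0::'a" "real n"]
      by (simp add: nn_integral_cmult_indicator ennreal_mult_less_top less_top)
    finally obtain i where i: "I = ennreal i" "i \<ge> 0" by (cases I) auto
    have "i \<le> C powr q"
    proof (cases "i = 0")
      case False
      with i have i0: "i > 0" by simp
      \<comment> \<open>The extremal function u^(q-1), normalized in the conjugate exponent; its
        pairing with U is i^(1/q), the L^q norm of u.\<close>
      define h where "h x = i powr (- ((q - 1) / q)) * u x powr (q - 1)" for x
      have "(\<integral>\<^sup>+x. U x * ennreal (h x) \<partial>lborel) \<le> ennreal C"
      proof (rule test)
        show "h \<in> borel_measurable borel" unfolding h_def by measurable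
        show "0 \<le> h x" for x by (simp add: h_def)
        have "h x powr (q / (q - 1)) = 1 / i * u x powr q" for x
        proof -
          have "- ((q - 1) / q) * (q / (q - 1)) = - 1" "(q - 1) * (q / (q - 1)) = q" using q by (simp_all add: field_simps)
          then show ?thesis
            unfolding h_def powr_mult powr_powr using i0 by (simp only: powr_minus_divide powr_one)
        qed
        then have "(\<integral>\<^sup>+x. ennreal (h x powr (q / (q - 1))) \<partial>lborel) = (\<integral>\<^sup>+x. ennreal (1 / i) * ennreal (u x powr q) \<partial>lborel)"
          by (simp add: ennreal_mult''[symmetric])
        also have "\<dots> = ennreal (1 / i) * I" by (simp add: nn_integral_cmult I_def)
        also have "\<dots> = 1" using i0 i by (simp add: ennreal_mult''[symmetric])
        finally show "(\<integral>\<^sup>+x. ennreal (h x powr (q / (q - 1))) \<partial>lborel) \<le> 1" by simp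
      qed
      moreover have "U x * ennreal (h x) = ennreal (i powr (- ((q - 1) / q))) * ennreal (u x powr q)" for x
      proof (cases "x \<in> A n")
        case True
        then have "U x = ennreal (u x)" using Uu[of x] by simp
        moreover have "u x * h x = i powr (- ((q - 1) / q)) * u x powr q"
          using u0[of x] by (cases "u x = 0") (auto simp: h_def powr_diff)
        ultimately show ?thesis using u0 by (simp add: ennreal_mult''[symmetric] h_def)
      qed (simp add: h_def u_def)
      then have "(\<integral>\<^sup>+x. U x * ennreal (h x) \<partial>lborel) = ennreal (i powr (- ((q - 1) / q))) * I"
        by (simp add: nn_integral_cmult I_def)
      also have "\<dots> = ennreal (i powr (1 / q))"
      proof -
        have "i powr (- ((q - 1) / q)) * i = i powr (- ((q - 1) / q) + 1)"
          unfolding powr_add using i0 by simp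
        also have "- ((q - 1) / q) + 1 = 1 / q" using q by (simp add: field_simps)
        finally show ?thesis using i by (simp add: ennreal_mult''[symmetric])
      qed
      ultimately have "i powr (1 / q) \<le> C" using C by simp
      then have "(i powr (1 / q)) powr q \<le> C powr q" using q by (intro powr_mono2) auto
      then show ?thesis using i0 q by (simp add: powr_powr)
    qed simp
    moreover have "(\<integral>\<^sup>+x\<in>A n. ennreal (enn2real (U x) powr q) \<partial>lborel) = I"
      unfolding I_def by (intro nn_integral_cong) (auto simp: u_def indicator_def)
    ultimately show ?thesis using i by (auto intro: ennreal_leI)
  qed
  have "(\<integral>\<^sup>+x. ennreal (enn2real (U x) powr q) \<partial>lborel) = (\<integral>\<^sup>+x\<in>(\<Union>n. A n). ennreal (enn2real (U x) powr q) \<partial>lborel)"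
    using AE_fin by (intro nn_integral_cong_AE) (auto simp: UA)
  also have "\<dots> = emeasure (density lborel (\<lambda>x. ennreal (enn2real (U x) powr q))) (\<Union>n. A n)"
    by (subst emeasure_density) auto
  also have "\<dots> = (SUP n. emeasure (density lborel (\<lambda>x. ennreal (enn2real (U x) powr q))) (A n))"
    using incA by (intro SUP_emeasure_incseq[symmetric]) auto
  also have "\<dots> \<le> ennreal (C powr q)"
    using le_A by (intro SUP_least) (simp add: emeasure_density)
  finally show ?thesis using AE_fin by blast
qed

lemma emeasure_superlevel_le:
  fixes f :: "'a::euclidean_space \<Rightarrow> real"
  assumes [measurable]: "f \<in> borel_measurable borel" and int: "(\<integral>\<^sup>+x. ennreal (f x powr p) \<partial>lborel) \<le> 1"
    and t: "t > 0" and p: "p \<ge> 0"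
  shows "emeasure lborel {x. t < f x} \<le> ennreal (t powr (- p))"
proof -
  have "ennreal (t powr p) * emeasure lborel {x. t < f x} = (\<integral>\<^sup>+x. ennreal (t powr p) * indicator {x. t < f x} x \<partial>lborel)"
    by (subst nn_integral_cmult_indicator) auto
  also have "\<dots> \<le> (\<integral>\<^sup>+x. ennreal (f x powr p) \<partial>lborel)"
    using t p by (intro nn_integral_mono) (auto simp: indicator_def intro!: ennreal_leI powr_mono2)
  finally have "ennreal (t powr p) * emeasure lborel {x. t < f x} \<le> 1" using int by (rule order_trans)
  then have "ennreal (t powr (- p)) * (ennreal (t powr p) * emeasure lborel {x. t < f x}) \<le> ennreal (t powr (- p)) * 1"
    by (intro mult_left_mono) auto
  then show ?thesis
    using t by (simp add: mult.assoc[symmetric] ennreal_mult''[symmetric] flip: powr_add)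
qed

locale symmetric_kernel =
  fixes K :: "'a::euclidean_space \<Rightarrow> 'a \<Rightarrow> ennreal"
  assumes K_measurable: "(\<lambda>z. K (fst z) (snd z)) \<in> borel_measurable borel"
    and K_commute: "K x y = K y x"
begin

lemma K_measurable' [measurable (raw)]:
  assumes [measurable]: "f \<in> borel_measurable M" "g \<in> borel_measurable M"
  shows "(\<lambda>z. K (f z) (g z)) \<in> borel_measurable M"
  using measurable_compose[OF _ K_measurable, of "\<lambda>z. (f z, g z)" M] by (simp add: borel_prod[symmetric])

definition T :: "('a \<Rightarrow> real) \<Rightarrow> 'a \<Rightarrow> ennreal" where
  "T f x = (\<integral>\<^sup>+y. K x y * ennreal (f y) \<partial>lborel)"

lemma T_measurable [measurable]:
  assumes [measurable]: "f \<in> borel_measurable borel"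
  shows "T f \<in> borel_measurable borel"
  unfolding T_def by measurable

lemma T_mono_AE: "AE y in lborel. f y \<le> g y \<Longrightarrow> T f x \<le> T g x"
  unfolding T_def
  by (intro nn_integral_mono_AE, erule eventually_mono) (intro mult_left_mono ennreal_leI, auto)

lemma T_cmult:
  assumes [measurable]: "f \<in> borel_measurable borel" and "c \<ge> 0"
  shows "T (\<lambda>y. c * f y) x = ennreal c * T f x"
  unfolding T_def using assms(2) by (subst nn_integral_cmult[symmetric]) (auto simp: ennreal_mult' ac_simps)

text \<open>Tonelli and the symmetry of K make T self-adjoint for the bilinear pairing; every
  duality argument below rests on this.\<close>

lemma T_swap:
  assumes [measurable]: "f \<in> borel_measurable borel" "h \<in> borel_measurable borel"
  shows "(\<integral>\<^sup>+x. T f x * ennreal (h x) \<partial>lborel) = (\<integral>\<^sup>+x. T h x * ennreal (f x) \<partial>lborel)"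
proof -
  have "(\<integral>\<^sup>+x. T f x * ennreal (h x) \<partial>lborel) = (\<integral>\<^sup>+x. (\<integral>\<^sup>+y. K x y * ennreal (f y) * ennreal (h x) \<partial>lborel) \<partial>lborel)"
    unfolding T_def by (simp add: nn_integral_multc)
  also have "\<dots> = (\<integral>\<^sup>+y. (\<integral>\<^sup>+x. K x y * ennreal (f y) * ennreal (h x) \<partial>lborel) \<partial>lborel)"
    by (rule lborel_pair.Fubini') measurable
  also have "\<dots> = (\<integral>\<^sup>+y. (\<integral>\<^sup>+x. K y x * ennreal (h x) * ennreal (f y) \<partial>lborel) \<partial>lborel)"
    by (simp add: K_commute ac_simps)
  also have "\<dots> = (\<integral>\<^sup>+x. T h x * ennreal (f x) \<partial>lborel)"
    unfolding T_def by (simp add: nn_integral_multc)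
  finally show ?thesis .
qed

text \<open>
  By homogeneity it suffices to test on the unit ball, which avoids \<open>p\<close>-th roots of extended reals.
  Since \<^const>\<open>enn2real\<close> maps \<open>\<infinity>\<close> to \<open>0\<close>, finiteness has to be required separately.
\<close>

definition strong_type :: "real \<Rightarrow> real \<Rightarrow> bool" where
  "strong_type p q \<longleftrightarrow> (\<exists>C\<ge>0. \<forall>f \<in> borel_measurable borel. (\<forall>x. 0 \<le> f x) \<longrightarrow>
    (\<integral>\<^sup>+x. ennreal (f x powr p) \<partial>lborel) \<le> 1 \<longrightarrow>
    (AE x in lborel. T f x < \<infinity>) \<and> (\<integral>\<^sup>+x. ennreal (enn2real (T f x) powr q) \<partial>lborel) \<le> ennreal C)"

text \<open>Up to the factor 2^p this is Hoelder's inequality (T f)^p <= m^(p-1) T(f^p) for a kernel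
  of mass at most m. It is obtained by integrating f <= l + l^(1-p) f^p and choosing l separately
  for each x.\<close>

lemma T_powr_le:
  assumes [measurable]: "f \<in> borel_measurable borel" and f0: "\<And>x. 0 \<le> f x"
    and p: "p \<ge> 1" and m: "m > 0" "(\<integral>\<^sup>+y. K x y \<partial>lborel) \<le> ennreal m"
    and fin: "T (\<lambda>y. f y powr p) x < \<infinity>"
  shows "T f x < \<infinity>"
    and "ennreal (enn2real (T f x) powr p) \<le> ennreal (2 powr p * m powr (p - 1)) * T (\<lambda>y. f y powr p) x"
proof -
  obtain S where S: "T (\<lambda>y. f y powr p) x = ennreal S" "S \<ge> 0"
    using fin by (cases "T (\<lambda>y. f y powr p) x") auto
  have split: "T f x \<le> ennreal (l * m + l powr (1 - p) * S)" if l: "l > 0" for l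
  proof -
    have "f y \<le> l + l powr (1 - p) * f y powr p" for y
    proof (cases "f y \<le> l")
      case False
      then have "f y powr (p - 1) \<ge> l powr (p - 1)" using l p by (intro powr_mono2) auto
      then have "l powr (p - 1) * f y \<le> f y powr (p - 1) * f y" using f0 by (intro mult_right_mono)
      also have "\<dots> = f y powr p" using False l by (simp add: powr_diff)
      finally have "l powr (1 - p) * (l powr (p - 1) * f y) \<le> l powr (1 - p) * f y powr p"
        by (intro mult_left_mono) auto
      then show ?thesis using l by (simp add: mult.assoc[symmetric] flip: powr_add)
    qed (use l in \<open>auto intro: add_increasing2\<close>)
    then have "T f x \<le> (\<integral>\<^sup>+y. K x y * (ennreal l + ennreal (l powr (1 - p)) * ennreal (f y powr p)) \<partial>lborel)"
      unfolding T_def using l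
      by (intro nn_integral_mono mult_left_mono) (auto simp: ennreal_mult''[symmetric] ennreal_plus[symmetric] intro!: ennreal_leI simp del: ennreal_plus)
    also have "\<dots> = (\<integral>\<^sup>+y. ennreal l * K x y + ennreal (l powr (1 - p)) * (K x y * ennreal (f y powr p)) \<partial>lborel)"
      by (intro nn_integral_cong) (simp add: distrib_left ac_simps)
    also have "\<dots> = ennreal l * (\<integral>\<^sup>+y. K x y \<partial>lborel) + ennreal (l powr (1 - p)) * T (\<lambda>y. f y powr p) x"
      unfolding T_def by (simp add: nn_integral_add nn_integral_cmult)
    also have "\<dots> \<le> ennreal l * ennreal m + ennreal (l powr (1 - p)) * ennreal S"
      unfolding S by (intro add_mono mult_left_mono m) auto
    also have "\<dots> = ennreal (l * m + l powr (1 - p) * S)"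
      using l m S by (simp add: ennreal_mult''[symmetric] ennreal_plus[symmetric] del: ennreal_plus)
    finally show ?thesis .
  qed
  show fin: "T f x < \<infinity>"
    using split[of 1] by (auto intro: le_less_trans)
  define \<tau> where "\<tau> = enn2real (T f x)"
  have eq: "T f x = ennreal \<tau>" using fin by (simp add: \<tau>_def)
  have \<tau>: "\<tau> \<ge> 0" by (simp add: \<tau>_def)
  have split': "\<tau> \<le> l * m + l powr (1 - p) * S" if "l > 0" for l
    using split[OF that] that m S unfolding eq by (subst (asm) ennreal_le_iff) auto
  \<comment> \<open>For S = 0 the bound is l m for every l > 0, and l tends to 0; otherwise there is
    a balancing l.\<close>
  have "\<tau> powr p \<le> 2 powr p * m powr (p - 1) * S"
  proof (cases "S = 0")
    case True
    have "\<tau> \<le> 0 + e" if "e > 0" for e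
      using split'[of "e / m"] m that True by simp
    then have "\<tau> \<le> 0" by (rule field_le_epsilon)
    with \<tau> True show ?thesis by simp
  next
    case False
    with S have S0: "S > 0" by simp
    \<comment> \<open>The choice that makes the two terms l m and l^(1-p) S equal.\<close>
    define l where "l = (S / m) powr (1 / p)"
    have l: "l > 0" using S0 m by (simp add: l_def)
    have lp: "l powr p = S / m" using S0 m p by (simp add: l_def powr_powr)
    have "l powr (1 - p) * S = l * m"
      using lp l S0 m by (simp add: powr_diff)
    with split'[OF l] have "\<tau> \<le> 2 * (l * m)" by simp
    then have "\<tau> powr p \<le> (2 * (l * m)) powr p" using \<tau> p by (intro powr_mono2) auto
    also have "\<dots> = 2 powr p * (S / m * m powr p)"
      using l m by (simp add: powr_mult lp)
    also have "\<dots> = 2 powr p * m powr (p - 1) * S"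
      using m by (simp add: powr_diff)
    finally show ?thesis .
  qed
  then show "ennreal (enn2real (T f x) powr p) \<le> ennreal (2 powr p * m powr (p - 1)) * T (\<lambda>y. f y powr p) x"
    unfolding S \<tau>_def using S m by (simp add: ennreal_mult''[symmetric] ennreal_leI)
qed

text \<open>
  With \<open>H = (w T f)\<^sup>p\<close>, Hoelder's inequality bounds \<open>H\<close> by \<open>w T (f\<^sup>p)\<close>, which is integrable by the
  weighted mass bound; then \<open>(T f)\<^sup>q = H\<^sup>q\<^sup>/\<^sup>p w\<^sup>-\<^sup>q\<close> is split by Young's inequality.
\<close>

lemma strong_type_weight:
  fixes w :: "'a \<Rightarrow> real"
  assumes pq: "1 \<le> q" "q \<le> p"
    and [measurable]: "w \<in> borel_measurable borel" and w1: "\<And>x. w x \<ge> 1" and M: "M > 0"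
    and mass: "\<And>x. (\<integral>\<^sup>+y. K x y \<partial>lborel) \<le> ennreal (M / w x)"
    and wmass: "\<And>x. (\<integral>\<^sup>+y. ennreal (w y) * K x y \<partial>lborel) \<le> ennreal M"
    and wint: "q < p \<Longrightarrow> (\<integral>\<^sup>+x. ennreal (w x powr (- (q * p / (p - q)))) \<partial>lborel) < \<infinity>"
  shows "strong_type p q"
proof -
  \<comment> \<open>For q = p there is no complementary factor. The formula would then read w^0 = 1,
    as division by 0 gives 0, and would not be integrable.\<close>
  define J where "J = (if q < p then (\<integral>\<^sup>+x. ennreal (w x powr (- (q * p / (p - q)))) \<partial>lborel) else 0)"
  have J: "J < \<infinity>" using wint by (simp add: J_def)
  have w0: "w x > 0" for x using w1[of x] by simp
  show ?thesis
    unfolding strong_type_def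
  proof (intro exI[of _ "2 powr p * M powr p + enn2real J"] conjI ballI impI)
    show "0 \<le> 2 powr p * M powr p + enn2real J" by simp
    fix f :: "'a \<Rightarrow> real"
    assume f[measurable]: "f \<in> borel_measurable borel" and f0: "\<forall>x. 0 \<le> f x"
      and fp: "(\<integral>\<^sup>+x. ennreal (f x powr p) \<partial>lborel) \<le> 1"
    define S where "S = T (\<lambda>y. f y powr p)"
    have [measurable]: "S \<in> borel_measurable borel" unfolding S_def by measurable
    \<comment> \<open>Self-adjointness moves T onto the weight, and \<open>wmass\<close> says that T
      w is at most M.\<close>
    have "(\<integral>\<^sup>+x. S x * ennreal (w x) \<partial>lborel) = (\<integral>\<^sup>+x. T w x * ennreal (f x powr p) \<partial>lborel)"
      unfolding S_def by (rule T_swap) auto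
    also have "\<dots> \<le> (\<integral>\<^sup>+x. ennreal M * ennreal (f x powr p) \<partial>lborel)"
      using wmass by (intro nn_integral_mono mult_right_mono) (auto simp: T_def mult.commute)
    also have "\<dots> \<le> ennreal M"
      using mult_left_mono[OF fp, of "ennreal M"] by (simp add: nn_integral_cmult)
    finally have Sw: "(\<integral>\<^sup>+x. S x * ennreal (w x) \<partial>lborel) \<le> ennreal M" .
    then have "(\<integral>\<^sup>+x. S x * ennreal (w x) \<partial>lborel) \<noteq> \<infinity>" by (auto simp: top_unique)
    then have "AE x in lborel. S x * ennreal (w x) \<noteq> \<infinity>"
      by (intro nn_integral_PInf_AE) auto
    then have Sfin: "AE x in lborel. S x < \<infinity>"
    proof eventually_elim
      fix x assume "S x * ennreal (w x) \<noteq> \<infinity>"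
      then show "S x < \<infinity>" using w0[of x] by (cases "S x") (auto simp: ennreal_top_mult)
    qed
    have bd: "T f x < \<infinity> \<and> ennreal (enn2real (T f x) powr p * w x powr p) \<le> ennreal (2 powr p * M powr (p - 1)) * (S x * ennreal (w x))"
      if "S x < \<infinity>" for x
    proof
      have m: "M / w x > 0" using M w0 by simp
      note * = T_powr_le[OF f f0[rule_format] _ m mass that[unfolded S_def]]
      show "T f x < \<infinity>" using * pq by simp
      have "ennreal (enn2real (T f x) powr p * w x powr p) = ennreal (w x powr p) * ennreal (enn2real (T f x) powr p)"
        by (simp add: ennreal_mult''[symmetric] mult.commute)
      also have "\<dots> \<le> ennreal (w x powr p) * (ennreal (2 powr p * (M / w x) powr (p - 1)) * S x)"
        unfolding S_def using * pq by (intro mult_left_mono) auto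
      also have "\<dots> = ennreal (w x powr p * (2 powr p * (M / w x) powr (p - 1))) * S x"
        using w0[of x] by (simp add: ennreal_mult''[symmetric] mult.assoc[symmetric])
      \<comment> \<open>Power count: the mass bound M/w enters to the power p-1, so of w^p exactly
        one factor w is left, the one that can be paired with S.\<close>
      also have "w x powr p * (2 powr p * (M / w x) powr (p - 1)) = 2 powr p * M powr (p - 1) * w x"
        using w0[of x] M by (simp add: powr_divide powr_diff)
      finally show "ennreal (enn2real (T f x) powr p * w x powr p) \<le> ennreal (2 powr p * M powr (p - 1)) * (S x * ennreal (w x))"
        using w0[of x] by (simp add: ennreal_mult'' ac_simps)
    qed
    show "AE x in lborel. T f x < \<infinity>" using Sfin by eventually_elim (use bd in blast)
    define H where "H x = enn2real (T f x) powr p * w x powr p" for x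
    have [measurable]: "H \<in> borel_measurable borel" unfolding H_def by measurable
    have "(\<integral>\<^sup>+x. ennreal (H x) \<partial>lborel) \<le> (\<integral>\<^sup>+x. ennreal (2 powr p * M powr (p - 1)) * (S x * ennreal (w x)) \<partial>lborel)"
      using Sfin bd unfolding H_def by (intro nn_integral_mono_AE) auto
    also have "\<dots> \<le> ennreal (2 powr p * M powr (p - 1)) * ennreal M"
      using Sw by (subst nn_integral_cmult) (auto intro: mult_left_mono)
    also have "\<dots> = ennreal (2 powr p * M powr p)"
      using M by (simp add: ennreal_mult''[symmetric] powr_diff)
    finally have H: "(\<integral>\<^sup>+x. ennreal (H x) \<partial>lborel) \<le> ennreal (2 powr p * M powr p)" .
    have pw: "enn2real (T f x) powr q \<le> H x + (if q < p then w x powr (- (q * p / (p - q))) else 0)" for x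
    proof (cases "q < p")
      case False
      then have "q = p" using pq by simp
      then show ?thesis
        using w1[of x] pq by (simp add: H_def mult_le_cancel_left1 ge_one_powr_ge_zero)
    next
      case True
      define B where "B = w x powr (- (q * p / (p - q)))"
      have B: "B > 0" using w0[of x] by (simp add: B_def)
      have \<theta>: "0 < q / p" "q / p < 1" "0 < (p - q) / p" using True pq by auto
      have "enn2real (T f x) powr q = H x powr (q / p) * B powr ((p - q) / p)"
      proof -
        have "H x powr (q / p) = enn2real (T f x) powr q * w x powr q"
          using pq by (simp add: H_def powr_mult powr_powr)
        moreover have "B powr ((p - q) / p) = w x powr (- q)"
          using True pq by (simp add: B_def powr_powr)
        ultimately show ?thesis using w0[of x] by (simp add: powr_minus)
      qed
      \<comment> \<open>The exponents q/p and (p-q)/p add up to 1, so the product of powers is at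
        most the maximum; this is Young's inequality in the weak form that suffices.\<close>
      also have "\<dots> \<le> max (H x) B powr (q / p) * max (H x) B powr ((p - q) / p)"
        using \<theta> B by (intro mult_mono powr_mono2) (auto simp: H_def)
      also have "\<dots> = max (H x) B"
        using True pq B by (simp flip: powr_add add_divide_distrib)
      also have "\<dots> \<le> H x + B" using B by (simp add: H_def)
      finally show ?thesis using True by (simp add: B_def)
    qed
    have "(\<integral>\<^sup>+x. ennreal (enn2real (T f x) powr q) \<partial>lborel)
      \<le> (\<integral>\<^sup>+x. ennreal (H x) + ennreal (if q < p then w x powr (- (q * p / (p - q))) else 0) \<partial>lborel)"
      using pw by (intro nn_integral_mono) (auto simp: ennreal_plus[symmetric] H_def simp del: ennreal_plus intro!: ennreal_leI)
    also have "\<dots> = (\<integral>\<^sup>+x. ennreal (H x) \<partial>lborel) + J"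
      unfolding J_def by (subst nn_integral_add) auto
    also have "\<dots> \<le> ennreal (2 powr p * M powr p) + ennreal (enn2real J)"
      using H J by (intro add_mono) auto
    finally show "(\<integral>\<^sup>+x. ennreal (enn2real (T f x) powr q) \<partial>lborel) \<le> ennreal (2 powr p * M powr p + enn2real J)"
      by simp
  qed
qed

text \<open>Dual of a bound from L^p to L^\<infinity>: for f in the unit ball of L^1, the pairing of
  T f with h equals that of T h with f and is at most C, so \<open>converse_Holder\<close> applies
  with the conjugate exponent.\<close>

lemma strong_type_from_one_if_T_bounded:
  assumes p: "p > 1" and C: "C \<ge> 0"
    and bd: "\<And>h. h \<in> borel_measurable borel \<Longrightarrow> (\<And>x. 0 \<le> h x) \<Longrightarrow>
      (\<integral>\<^sup>+x. ennreal (h x powr p) \<partial>lborel) \<le> 1 \<Longrightarrow> AE x in lborel. T h x \<le> ennreal C"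
  shows "strong_type 1 (p / (p - 1))"
  unfolding strong_type_def
proof (intro exI[of _ "C powr (p / (p - 1))"] conjI[of "0 \<le> _"] ballI impI)
  fix f :: "'a \<Rightarrow> real"
  assume f[measurable]: "f \<in> borel_measurable borel" and f0: "\<forall>x. 0 \<le> f x"
    and f1: "(\<integral>\<^sup>+x. ennreal (f x powr 1) \<partial>lborel) \<le> 1"
  have conj: "p / (p - 1) / (p / (p - 1) - 1) = p" "p / (p - 1) > 1" using p by (simp_all add: field_simps)
  show "(AE x in lborel. T f x < \<infinity>) \<and> (\<integral>\<^sup>+x. ennreal (enn2real (T f x) powr (p / (p - 1))) \<partial>lborel) \<le> ennreal (C powr (p / (p - 1)))"
  proof (rule converse_Holder)
    fix h :: "'a \<Rightarrow> real"
    assume h[measurable]: "h \<in> borel_measurable borel" and h0: "\<And>x. 0 \<le> h x"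
      and hp: "(\<integral>\<^sup>+x. ennreal (h x powr (p / (p - 1) / (p / (p - 1) - 1))) \<partial>lborel) \<le> 1"
    have "(\<integral>\<^sup>+x. T f x * ennreal (h x) \<partial>lborel) = (\<integral>\<^sup>+x. T h x * ennreal (f x) \<partial>lborel)"
      by (rule T_swap) auto
    also have "\<dots> \<le> (\<integral>\<^sup>+x. ennreal C * ennreal (f x) \<partial>lborel)"
      by (intro nn_integral_mono_AE eventually_mono[OF bd[OF h h0 hp[unfolded conj]]] mult_right_mono) auto
    also have "\<dots> \<le> ennreal C"
      using mult_left_mono[OF f1, of "ennreal C"] f0 by (simp add: nn_integral_cmult)
    finally show "(\<integral>\<^sup>+x. T f x * ennreal (h x) \<partial>lborel) \<le> ennreal C" .
  qed (use conj C in auto)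
qed simp

text \<open>The integral of T h is the pairing of h with the mass function T 1; a bound from L^p to
  L^1 thus says that T 1 defines a bounded functional on L^p.\<close>

lemma mass_in_Lp_if_into_L1:
  assumes p: "p > 1" and C: "C \<ge> 0"
    and bd: "\<And>h. h \<in> borel_measurable borel \<Longrightarrow> (\<And>x. 0 \<le> h x) \<Longrightarrow>
      (\<integral>\<^sup>+x. ennreal (h x powr p) \<partial>lborel) \<le> 1 \<Longrightarrow> (\<integral>\<^sup>+x. T h x \<partial>lborel) \<le> ennreal C"
  shows "(\<integral>\<^sup>+x. ennreal (enn2real (T (\<lambda>_. 1) x) powr (p / (p - 1))) \<partial>lborel) < \<infinity>"
proof -
  have conj: "p / (p - 1) / (p / (p - 1) - 1) = p" "p / (p - 1) > 1" using p by (simp_all add: field_simps)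
  have "(AE x in lborel. T (\<lambda>_. 1) x < \<infinity>) \<and> (\<integral>\<^sup>+x. ennreal (enn2real (T (\<lambda>_. 1) x) powr (p / (p - 1))) \<partial>lborel) \<le> ennreal (C powr (p / (p - 1)))"
  proof (rule converse_Holder)
    fix h :: "'a \<Rightarrow> real"
    assume h[measurable]: "h \<in> borel_measurable borel" and h0: "\<And>x. 0 \<le> h x"
      and hp: "(\<integral>\<^sup>+x. ennreal (h x powr (p / (p - 1) / (p / (p - 1) - 1))) \<partial>lborel) \<le> 1"
    show "(\<integral>\<^sup>+x. T (\<lambda>_. 1) x * ennreal (h x) \<partial>lborel) \<le> ennreal C"
      using bd[OF h h0 hp[unfolded conj]] by (subst T_swap) auto
  qed (use conj C in auto)
  then show ?thesis by (auto intro: le_less_trans)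
qed

end

text \<open>A restricted bound into L^\<infinity>, for indicators only. The Riesz kernel |x-y|^(a-d)
  satisfies it with \<alpha> = a/d. The exponent is a parameter so that it can be set to 1/p -
  1/q.\<close>

locale restricted_weak_kernel = symmetric_kernel +
  fixes B \<alpha> :: real
  assumes B: "B > 0" and \<alpha>: "\<alpha> > 0"
    and set_le: "\<And>x F v. F \<in> sets borel \<Longrightarrow> v > 0 \<Longrightarrow> emeasure lborel F \<le> ennreal v \<Longrightarrow>
      (\<integral>\<^sup>+y\<in>F. K x y \<partial>lborel) \<le> ennreal (B * v powr \<alpha>)"
begin

text \<open>Layer cake restricted to heights in I: the length of \<open>I \<inter> {..<f y}\<close>
  is the part of f(y) lying at these heights. After Tonelli, K is integrated over superlevel sets {f
  > t}, whose volume is at most t^(-p) by Chebyshev.\<close>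

lemma layer_le:
  assumes [measurable]: "f \<in> borel_measurable borel" "I \<in> sets borel"
    and p: "p \<ge> 0" and fp: "(\<integral>\<^sup>+x. ennreal (f x powr p) \<partial>lborel) \<le> 1" and I: "I \<subseteq> {0<..}"
  shows "(\<integral>\<^sup>+y. K x y * emeasure lborel (I \<inter> {..<f y}) \<partial>lborel)
    \<le> ennreal B * (\<integral>\<^sup>+t\<in>I. ennreal (t powr (- (p * \<alpha>))) \<partial>lborel)"
proof -
  have em: "emeasure lborel (I \<inter> {..<f y}) = (\<integral>\<^sup>+t. indicator I t * indicator {x. t < f x} y \<partial>lborel)" for y
  proof -
    have "(\<integral>\<^sup>+t. indicator I t * indicator {x. t < f x} y \<partial>lborel) = (\<integral>\<^sup>+t. indicator (I \<inter> {..<f y}) t \<partial>lborel)"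
      by (intro nn_integral_cong) (auto simp: indicator_def)
    then show ?thesis by simp
  qed
  have "(\<integral>\<^sup>+y. K x y * emeasure lborel (I \<inter> {..<f y}) \<partial>lborel)
    = (\<integral>\<^sup>+y. (\<integral>\<^sup>+t. K x y * (indicator I t * indicator {x. t < f x} y) \<partial>lborel) \<partial>lborel)"
    unfolding em by (intro nn_integral_cong, subst nn_integral_cmult) auto
  also have "\<dots> = (\<integral>\<^sup>+t. (\<integral>\<^sup>+y. K x y * (indicator I t * indicator {x. t < f x} y) \<partial>lborel) \<partial>lborel)"
    by (rule lborel_pair.Fubini') measurable
  also have "\<dots> \<le> (\<integral>\<^sup>+t. ennreal B * (ennreal (t powr (- (p * \<alpha>))) * indicator I t) \<partial>lborel)"
  proof (rule nn_integral_mono)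
    fix t :: real
    show "(\<integral>\<^sup>+y. K x y * (indicator I t * indicator {x. t < f x} y) \<partial>lborel) \<le> ennreal B * (ennreal (t powr (- (p * \<alpha>))) * indicator I t)"
    proof (cases "t \<in> I")
      case True
      then have t: "t > 0" using I by auto
      have "(\<integral>\<^sup>+y\<in>{x. t < f x}. K x y \<partial>lborel) \<le> ennreal (B * (t powr (- p)) powr \<alpha>)"
        using t p fp by (intro set_le emeasure_superlevel_le) auto
      then show ?thesis using True B by (simp add: powr_powr ennreal_mult'')
    qed simp
  qed
  also have "\<dots> = ennreal B * (\<integral>\<^sup>+t\<in>I. ennreal (t powr (- (p * \<alpha>))) \<partial>lborel)"
    by (rule nn_integral_cmult) auto
  finally show ?thesis .
qed

text \<open>The truncation of f at m consists of the heights in (0,m], and p\<alpha> < 1 makes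
  t^(-p\<alpha>) integrable at 0.\<close>

lemma T_min_le:
  assumes [measurable]: "f \<in> borel_measurable borel" and f0: "\<And>x. 0 \<le> f x"
    and p: "p \<ge> 0" "p * \<alpha> < 1" and fp: "(\<integral>\<^sup>+x. ennreal (f x powr p) \<partial>lborel) \<le> 1" and m: "m \<ge> 0"
  shows "T (\<lambda>y. min (f y) m) x \<le> ennreal (B / (1 - p * \<alpha>) * m powr (1 - p * \<alpha>))"
proof -
  have "T (\<lambda>y. min (f y) m) x = (\<integral>\<^sup>+y. K x y * emeasure lborel ({0<..m} \<inter> {..<f y}) \<partial>lborel)"
    unfolding T_def
  proof (rule nn_integral_cong)
    fix y
    have "{0<..m} \<inter> {..<f y} = (if m < f y then {0<..m} else {0<..<f y})" by auto
    then show "K x y * ennreal (min (f y) m) = K x y * emeasure lborel ({0<..m} \<inter> {..<f y})"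
      using f0[of y] m by simp
  qed
  also have "\<dots> \<le> ennreal B * (\<integral>\<^sup>+t\<in>{0<..m}. ennreal (t powr (- (p * \<alpha>))) \<partial>lborel)"
    using p fp by (intro layer_le) auto
  also have "(\<integral>\<^sup>+t\<in>{0<..m}. ennreal (t powr (- (p * \<alpha>))) \<partial>lborel) \<le> (\<integral>\<^sup>+t\<in>{0..m}. ennreal (t powr (1 - p * \<alpha> - 1)) \<partial>lborel)"
    by (intro nn_integral_mono) (auto simp: indicator_def)
  also have "\<dots> = ennreal (m powr (1 - p * \<alpha>) / (1 - p * \<alpha>))"
    using p m by (intro nn_integral_powr_from_0) auto
  finally show ?thesis using B p by (simp add: ennreal_mult''[symmetric] mult_left_mono)
qed

text \<open>Heights below 1 are controlled by the total mass, heights above 1 by the layer bound,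
  where p\<alpha> > 1 makes t^(-p\<alpha>) integrable at infinity.\<close>

lemma T_bounded:
  assumes M: "\<And>x. (\<integral>\<^sup>+y. K x y \<partial>lborel) \<le> ennreal M" "M \<ge> 0"
    and [measurable]: "f \<in> borel_measurable borel" and f0: "\<And>x. 0 \<le> f x"
    and p: "p \<ge> 0" "p * \<alpha> > 1" and fp: "(\<integral>\<^sup>+x. ennreal (f x powr p) \<partial>lborel) \<le> 1"
  shows "T f x \<le> ennreal (M + B / (p * \<alpha> - 1))"
proof -
  have "T f x \<le> (\<integral>\<^sup>+y. K x y + K x y * emeasure lborel ({1..} \<inter> {..<f y}) \<partial>lborel)"
    unfolding T_def
  proof (rule nn_integral_mono)
    fix y
    have "{1..} \<inter> {..<f y} = {1..<f y}" by auto
    then have "ennreal (f y) \<le> 1 + emeasure lborel ({1..} \<inter> {..<f y})"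
      by (cases "f y \<ge> 1") (auto simp: ennreal_plus[symmetric] simp del: ennreal_plus simp flip: ennreal_1 intro!: ennreal_leI)
    then have "K x y * ennreal (f y) \<le> K x y * (1 + emeasure lborel ({1..} \<inter> {..<f y}))"
      by (intro mult_left_mono) auto
    then show "K x y * ennreal (f y) \<le> K x y + K x y * emeasure lborel ({1..} \<inter> {..<f y})"
      by (simp add: distrib_left)
  qed
  also have "\<dots> = (\<integral>\<^sup>+y. K x y \<partial>lborel) + (\<integral>\<^sup>+y. K x y * emeasure lborel ({1..} \<inter> {..<f y}) \<partial>lborel)"
  proof (rule nn_integral_add)
    have "{1..} \<inter> {..<f y} = {1..<f y}" for y by auto
    then have "emeasure lborel ({1..} \<inter> {..<f y}) = ennreal (max 0 (f y - 1))" for y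
      by (cases "1 \<le> f y") auto
    then show "(\<lambda>y. K x y * emeasure lborel ({1..} \<inter> {..<f y})) \<in> borel_measurable lborel"
      by simp
  qed simp
  also have "\<dots> \<le> ennreal M + ennreal B * (\<integral>\<^sup>+t\<in>{1..}. ennreal (t powr (- (p * \<alpha> - 1) - 1)) \<partial>lborel)"
  proof -
    have "{1..} \<subseteq> {0::real<..}" by auto
    then show ?thesis using layer_le[of f "{1..}" p x] p fp by (intro add_mono M) auto
  qed
  also have "(\<integral>\<^sup>+t\<in>{1..}. ennreal (t powr (- (p * \<alpha> - 1) - 1)) \<partial>lborel) = ennreal (1 powr (- (p * \<alpha> - 1)) / (p * \<alpha> - 1))"
    using p by (intro nn_integral_powr_to_inf) auto
  finally show ?thesis using B p M by (simp add: ennreal_mult''[symmetric] ennreal_plus[symmetric] del: ennreal_plus)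
qed

text \<open>
  In the bilinear form, the pairs with \<open>h x \<le> f y powr (p / r)\<close> are separated from the others, where
  \<open>r\<close> is conjugate to \<open>q\<close>. In each part one of the two functions is cut off at a height depending on
  the other one, and integrating it against \<open>K\<close> uses only Chebyshev's bound for its superlevel sets.
\<close>

lemma strong_type_Hardy_Littlewood_Sobolev:
  assumes pq: "1 < p" "p < q" and eq: "\<alpha> = 1 / p - 1 / q"
  shows "strong_type p q"
proof -
  define r where "r = q / (q - 1)"
  have r: "r > 1" "1 / r = 1 - 1 / q" using pq by (auto simp: r_def field_simps)
  have pa: "1 - p * \<alpha> = p / q" using pq by (simp add: eq field_simps)
  \<comment> \<open>Here p > 1 enters: p = 1 would give r\<alpha> = 1, and the layer integral for h
    would diverge logarithmically at height 0.\<close>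
  have ra: "r * \<alpha> < 1"
  proof -
    have "1 / p < 1" using pq by simp
    then have "\<alpha> < 1 / r" unfolding r(2) eq by simp
    then show ?thesis using r(1) by (simp add: pos_less_divide_eq mult.commute)
  qed
  \<comment> \<open>\<open>e1\<close> and \<open>e2\<close> express that the cut-off heights respect
    scaling: after integrating out the truncated function, the other one appears exactly to the
    power controlled by its norm, h^r and f^p respectively.\<close>
  have e1: "1 + r / p * (1 - p * \<alpha>) = r"
  proof -
    have "r / p * (1 - p * \<alpha>) = r / q" using pq by (simp add: pa)
    moreover have "r = 1 + r / q" using pq by (simp add: r_def field_simps)
    ultimately show ?thesis by simp
  qed
  have e2: "1 + p / r * (1 - r * \<alpha>) = p"
  proof -
    have "p / r * (1 - r * \<alpha>) = p * (1 / r) - p * \<alpha>" using r by (simp add: field_simps)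
    also have "\<dots> = p - 1" unfolding r(2) using pa by (simp add: algebra_simps)
    finally show ?thesis by simp
  qed
  have pp: "p * \<alpha> < 1" using pa pq by (smt (verit) divide_pos_pos)
  define C1 where "C1 = B / (1 - p * \<alpha>)"
  define C2 where "C2 = B / (1 - r * \<alpha>)"
  have C: "C1 > 0" "C2 > 0" using B pp ra by (auto simp: C1_def C2_def)
  show ?thesis
    unfolding strong_type_def
  proof (intro exI[of _ "(C1 + C2) powr q"] conjI[of "0 \<le> _"] ballI impI)
    fix f :: "'a \<Rightarrow> real"
    assume f[measurable]: "f \<in> borel_measurable borel" and f0: "\<forall>x. 0 \<le> f x"
      and fp: "(\<integral>\<^sup>+x. ennreal (f x powr p) \<partial>lborel) \<le> 1"
    show "(AE x in lborel. T f x < \<infinity>) \<and> (\<integral>\<^sup>+x. ennreal (enn2real (T f x) powr q) \<partial>lborel) \<le> ennreal ((C1 + C2) powr q)"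
    proof (rule converse_Holder)
      fix h :: "'a \<Rightarrow> real"
      assume h[measurable]: "h \<in> borel_measurable borel" and h0: "\<And>x. 0 \<le> h x"
        and "(\<integral>\<^sup>+x. ennreal (h x powr (q / (q - 1))) \<partial>lborel) \<le> 1"
      then have hr: "(\<integral>\<^sup>+x. ennreal (h x powr r) \<partial>lborel) \<le> 1" by (simp add: r_def)
      have split: "f y * h x \<le> h x * min (f y) (h x powr (r / p)) + f y * min (h x) (f y powr (p / r))" for x y
      proof (cases "h x \<le> f y powr (p / r)")
        case True
        then show ?thesis using f0 h0 by (auto simp: mult.commute intro!: add_increasing)
      next
        case False
        then have "(f y powr (p / r)) powr (r / p) \<le> h x powr (r / p)" using pq r by (intro powr_mono2) auto
        then have "f y \<le> h x powr (r / p)" using pq r f0 by (simp add: powr_powr)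
        then show ?thesis using f0 h0 by (auto simp: mult.commute intro!: add_increasing2)
      qed
      have "(\<integral>\<^sup>+x. T f x * ennreal (h x) \<partial>lborel) = (\<integral>\<^sup>+x. (\<integral>\<^sup>+y. K x y * ennreal (f y * h x) \<partial>lborel) \<partial>lborel)"
        unfolding T_def using f0 h0 by (simp add: nn_integral_multc[symmetric] ennreal_mult'' mult.assoc)
      also have "\<dots> \<le> (\<integral>\<^sup>+x. (\<integral>\<^sup>+y. K x y * ennreal (h x * min (f y) (h x powr (r / p))) + K x y * ennreal (f y * min (h x) (f y powr (p / r))) \<partial>lborel) \<partial>lborel)"
        using f0 h0 split
        by (intro nn_integral_mono) (auto simp: distrib_left[symmetric] ennreal_plus[symmetric] simp del: ennreal_plus intro!: mult_left_mono ennreal_leI)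
      also have "\<dots> = (\<integral>\<^sup>+x. (\<integral>\<^sup>+y. K x y * ennreal (h x * min (f y) (h x powr (r / p))) \<partial>lborel) \<partial>lborel)
          + (\<integral>\<^sup>+x. (\<integral>\<^sup>+y. K x y * ennreal (f y * min (h x) (f y powr (p / r))) \<partial>lborel) \<partial>lborel)"
        by (simp add: nn_integral_add)
      \<comment> \<open>In this part h is the truncated function, so the order of integration is
        exchanged to integrate it first, with y fixed.\<close>
      also have "(\<integral>\<^sup>+x. (\<integral>\<^sup>+y. K x y * ennreal (f y * min (h x) (f y powr (p / r))) \<partial>lborel) \<partial>lborel)
        = (\<integral>\<^sup>+y. (\<integral>\<^sup>+x. K x y * ennreal (f y * min (h x) (f y powr (p / r))) \<partial>lborel) \<partial>lborel)"
        by (rule lborel_pair.Fubini'[symmetric]) measurable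
      also have "\<dots> \<le> (\<integral>\<^sup>+y. ennreal C2 * ennreal (f y powr p) \<partial>lborel)"
      proof (rule nn_integral_mono)
        fix y
        have "(\<integral>\<^sup>+x. K x y * ennreal (f y * min (h x) (f y powr (p / r))) \<partial>lborel) = ennreal (f y) * T (\<lambda>x. min (h x) (f y powr (p / r))) y"
          unfolding T_def using f0 h0 by (subst nn_integral_cmult[symmetric]) (auto simp: K_commute[of _ y] ennreal_mult'' ac_simps)
        also have "\<dots> \<le> ennreal (f y) * ennreal (C2 * (f y powr (p / r)) powr (1 - r * \<alpha>))"
          unfolding C2_def using r ra hr h0 by (intro mult_left_mono T_min_le) auto
        also have "\<dots> = ennreal (C2 * f y powr p)"
        proof (cases "f y = 0")
          case False
          then have "f y * f y powr (p / r * (1 - r * \<alpha>)) = f y powr (1 + p / r * (1 - r * \<alpha>))"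
            using f0 by (simp add: powr_add powr_one)
          then show ?thesis unfolding e2 using f0 C by (simp add: ennreal_mult''[symmetric] powr_powr ac_simps)
        qed simp
        finally show "(\<integral>\<^sup>+x. K x y * ennreal (f y * min (h x) (f y powr (p / r))) \<partial>lborel) \<le> ennreal C2 * ennreal (f y powr p)"
          using C by (simp add: ennreal_mult'')
      qed
      also have "\<dots> \<le> ennreal C2"
        using mult_left_mono[OF fp, of "ennreal C2"] by (simp add: nn_integral_cmult)
      also have "(\<integral>\<^sup>+x. (\<integral>\<^sup>+y. K x y * ennreal (h x * min (f y) (h x powr (r / p))) \<partial>lborel) \<partial>lborel) \<le> (\<integral>\<^sup>+x. ennreal C1 * ennreal (h x powr r) \<partial>lborel)"
      proof (rule nn_integral_mono)
        fix x
        have "(\<integral>\<^sup>+y. K x y * ennreal (h x * min (f y) (h x powr (r / p))) \<partial>lborel) = ennreal (h x) * T (\<lambda>y. min (f y) (h x powr (r / p))) x"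
          unfolding T_def using f0 h0 by (subst nn_integral_cmult[symmetric]) (auto simp: ennreal_mult'' ac_simps)
        also have "\<dots> \<le> ennreal (h x) * ennreal (C1 * (h x powr (r / p)) powr (1 - p * \<alpha>))"
          unfolding C1_def using pq pp fp f0 by (intro mult_left_mono T_min_le) auto
        also have "\<dots> = ennreal (C1 * h x powr r)"
        proof (cases "h x = 0")
          case False
          then have "h x * h x powr (r / p * (1 - p * \<alpha>)) = h x powr (1 + r / p * (1 - p * \<alpha>))"
            using h0 by (simp add: powr_add powr_one)
          then show ?thesis unfolding e1 using h0 C by (simp add: ennreal_mult''[symmetric] powr_powr ac_simps)
        qed simp
        finally show "(\<integral>\<^sup>+y. K x y * ennreal (h x * min (f y) (h x powr (r / p))) \<partial>lborel) \<le> ennreal C1 * ennreal (h x powr r)"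
          using C by (simp add: ennreal_mult'')
      qed
      also have "\<dots> \<le> ennreal C1"
        using mult_left_mono[OF hr, of "ennreal C1"] by (simp add: nn_integral_cmult)
      finally show "(\<integral>\<^sup>+x. T f x * ennreal (h x) \<partial>lborel) \<le> ennreal (C1 + C2)"
        using C by (simp add: add_mono)
    qed (use pq C in auto)
  qed simp
qed

end

section \<open>Transfer to the complex operator and its \<open>L\<^sup>p\<close> norms\<close>

lemma Lp_norm_ennreal_le_iff:
  assumes p: "p \<ge> 1" and C: "C \<ge> 0"
  shows "Lp_norm (ennreal p) M f \<le> ennreal C \<longleftrightarrow>
    (\<integral>\<^sup>+x. ennreal (norm (f x) powr p) \<partial>M) \<le> ennreal (C powr p)"
proof (cases "\<integral>\<^sup>+x. ennreal (norm (f x) powr p) \<partial>M")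
  case (real i)
  have "i powr (1 / p) \<le> C \<longleftrightarrow> i \<le> C powr p"
  proof
    assume "i powr (1 / p) \<le> C"
    then have "(i powr (1 / p)) powr p \<le> C powr p" using p by (intro powr_mono2) auto
    then show "i \<le> C powr p" using p real by (simp add: powr_powr)
  next
    assume "i \<le> C powr p"
    then have "i powr (1 / p) \<le> (C powr p) powr (1 / p)" using p real by (intro powr_mono2) auto
    then show "i powr (1 / p) \<le> C" using p C by (simp add: powr_powr)
  qed
  then show ?thesis using real p C by (simp add: Lp_norm_def)
qed (use p in \<open>simp add: Lp_norm_def top_unique\<close>)

text \<open>Normalization to the unit ball, where \<open>strong_type\<close> tests. Division by the
  norm N fails for N = 0; then g = 0 serves, and f vanishes only almost everywhere, which is why the
  domination is an almost-everywhere statement.\<close>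

lemma Lp_space_ennreal_decompose:
  assumes p: "p \<ge> 1" and f: "f \<in> Lp_space (ennreal p) (lborel :: 'a::euclidean_space measure)"
  obtains N g where "N \<ge> 0" "g \<in> borel_measurable borel" "\<And>x. 0 \<le> g x"
    "(\<integral>\<^sup>+x. ennreal (g x powr p) \<partial>lborel) \<le> 1" "AE x in lborel. norm (f x) \<le> N * g x"
    "Lp_norm (ennreal p) lborel f = ennreal N"
proof -
  have [measurable]: "f \<in> borel_measurable borel" and fin: "Lp_norm (ennreal p) lborel f < \<infinity>"
    using f by (auto simp: Lp_space_def)
  define N where "N = enn2real (Lp_norm (ennreal p) lborel f)"
  have N: "N \<ge> 0" "Lp_norm (ennreal p) lborel f = ennreal N" using fin by (auto simp: N_def)
  have int: "(\<integral>\<^sup>+x. ennreal (norm (f x) powr p) \<partial>lborel) \<le> ennreal (N powr p)"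
    using Lp_norm_ennreal_le_iff[OF p N(1), of lborel f] N(2) by simp
  show ?thesis
  proof (cases "N = 0")
    case True
    then have "(\<integral>\<^sup>+x. ennreal (norm (f x) powr p) \<partial>lborel) = 0" using int p by simp
    then have "AE x in lborel. ennreal (norm (f x) powr p) = 0"
      by (subst (asm) nn_integral_0_iff_AE) auto
    then have "AE x in lborel. norm (f x) \<le> N * 0" by eventually_elim auto
    with N show ?thesis by (intro that[of N "\<lambda>_. 0"]) auto
  next
    case False
    with N have N0: "N > 0" by simp
    show ?thesis
    proof (rule that[of N "\<lambda>x. norm (f x) / N"])
      have "(\<integral>\<^sup>+x. ennreal ((norm (f x) / N) powr p) \<partial>lborel) = (\<integral>\<^sup>+x. ennreal (1 / N powr p) * ennreal (norm (f x) powr p) \<partial>lborel)"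
        using N0 by (simp add: powr_divide ennreal_mult''[symmetric])
      also have "\<dots> \<le> ennreal (1 / N powr p) * ennreal (N powr p)"
        using int by (subst nn_integral_cmult) (auto intro: mult_left_mono)
      also have "\<dots> = 1" using N0 by (simp add: ennreal_mult''[symmetric])
      finally show "(\<integral>\<^sup>+x. ennreal ((norm (f x) / N) powr p) \<partial>lborel) \<le> 1" .
    qed (use N N0 in auto)
  qed
qed

interpretation harmonic: symmetric_kernel "harmonic_nn s :: 'a::euclidean_space \<Rightarrow> 'a \<Rightarrow> ennreal" for s
proof
  show "(\<lambda>z. harmonic_nn s (fst z) (snd z :: 'a)) \<in> borel_measurable borel"
    unfolding borel_prod[symmetric] by measurable
  show "harmonic_nn s x y = harmonic_nn s y x" for x y :: 'a
    by (simp add: harmonic_nn_def mehler_kernel_commute)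
qed

text \<open>Collects the hypotheses of \<open>strong_type_weight\<close> for the weight (1+|x|^2)^s.
  For the weight at y, Peetre's inequality 1+|y|^2 <= 2(1+|x|^2)(1+|x-y|^2) costs a factor
  (1+|x|^2)^s, which the decay in \<open>harmonic_weighted_mass_le\<close> cancels exactly.\<close>

lemma harmonic_mass:
  fixes s :: real
  assumes s: "s > 0"
  obtains M where "M > 0"
    "\<And>x::'a::euclidean_space. (\<integral>\<^sup>+y. harmonic_nn s x y \<partial>lborel) \<le> ennreal (M / (1 + (norm x)\<^sup>2) powr s)"
    "\<And>x::'a. (\<integral>\<^sup>+y. ennreal ((1 + (norm y)\<^sup>2) powr s) * harmonic_nn s x y \<partial>lborel) \<le> ennreal M"
    "\<And>x::'a. (\<integral>\<^sup>+y. harmonic_nn s x y \<partial>lborel) \<le> ennreal M"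
proof -
  obtain C where C: "C > 0" "\<And>x::'a.
    (\<integral>\<^sup>+y. ennreal ((1 + (norm (x - y))\<^sup>2) powr s) * harmonic_nn s x y \<partial>lborel)
      \<le> ennreal (C * (1 + (norm x)\<^sup>2) powr (- s))"
    using harmonic_weighted_mass_le[OF s] by blast
  define M where "M = 2 powr s * C"
  have M: "M > 0" "C \<le> M" using C s by (auto simp: M_def ge_one_powr_ge_zero)
  have mass: "(\<integral>\<^sup>+y. harmonic_nn s x y \<partial>lborel) \<le> ennreal (M / (1 + (norm x)\<^sup>2) powr s)" for x :: 'a
  proof -
    have "(\<integral>\<^sup>+y. harmonic_nn s x y \<partial>lborel) \<le> (\<integral>\<^sup>+y. ennreal ((1 + (norm (x - y))\<^sup>2) powr s) * harmonic_nn s x y \<partial>lborel)"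
    proof (rule nn_integral_mono)
      fix y
      have "1 \<le> ennreal ((1 + (norm (x - y))\<^sup>2) powr s)"
        using s by (simp add: ge_one_powr_ge_zero)
      then show "harmonic_nn s x y \<le> ennreal ((1 + (norm (x - y))\<^sup>2) powr s) * harmonic_nn s x y"
        using mult_right_mono[of 1 "ennreal ((1 + (norm (x - y))\<^sup>2) powr s)" "harmonic_nn s x y"] by simp
    qed
    also have "\<dots> \<le> ennreal (C * (1 + (norm x)\<^sup>2) powr (- s))" by (rule C)
    also have "\<dots> \<le> ennreal (M / (1 + (norm x)\<^sup>2) powr s)"
      using M(2) by (intro ennreal_leI) (simp add: powr_minus_divide divide_right_mono)
    finally show ?thesis .
  qed
  show ?thesis
  proof (rule that[OF M(1) mass])
    fix x :: 'a
    have pos: "1 + (norm x)\<^sup>2 > 0" by (simp add: add_pos_nonneg)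
    have "(\<integral>\<^sup>+y. ennreal ((1 + (norm y)\<^sup>2) powr s) * harmonic_nn s x y \<partial>lborel)
      \<le> (\<integral>\<^sup>+y. ennreal ((2 * (1 + (norm x)\<^sup>2)) powr s) * (ennreal ((1 + (norm (x - y))\<^sup>2) powr s) * harmonic_nn s x y) \<partial>lborel)"
    proof (rule nn_integral_mono)
      fix y
      \<comment> \<open>As y = x - (x-y), the parallelogram law gives |y|^2 <= 2|x|^2 +
        2|x-y|^2.\<close>
      have "(norm (x - (x - y)))\<^sup>2 \<le> 2 * (norm x)\<^sup>2 + 2 * (norm (x - y))\<^sup>2"
        using norm_add_diff_power2[of x "x - y"] zero_le_power2[of "norm (x + (x - y))"] by linarith
      then have "(norm y)\<^sup>2 \<le> 2 * (norm x)\<^sup>2 + 2 * (norm (x - y))\<^sup>2" by simp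
      moreover have "(norm x)\<^sup>2 * (norm (x - y))\<^sup>2 \<ge> 0" by simp
      ultimately have "1 + (norm y)\<^sup>2 \<le> 2 * (1 + (norm x)\<^sup>2) * (1 + (norm (x - y))\<^sup>2)"
        unfolding distrib_left distrib_right by linarith
      then have "(1 + (norm y)\<^sup>2) powr s \<le> (2 * (1 + (norm x)\<^sup>2) * (1 + (norm (x - y))\<^sup>2)) powr s"
        using s by (intro powr_mono2) auto
      also have "\<dots> = (2 * (1 + (norm x)\<^sup>2)) powr s * (1 + (norm (x - y))\<^sup>2) powr s"
        by (rule powr_mult)
      finally have "ennreal ((1 + (norm y)\<^sup>2) powr s) \<le> ennreal ((2 * (1 + (norm x)\<^sup>2)) powr s) * ennreal ((1 + (norm (x - y))\<^sup>2) powr s)"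
        by (simp add: ennreal_mult''[symmetric] ennreal_leI)
      then show "ennreal ((1 + (norm y)\<^sup>2) powr s) * harmonic_nn s x y
        \<le> ennreal ((2 * (1 + (norm x)\<^sup>2)) powr s) * (ennreal ((1 + (norm (x - y))\<^sup>2) powr s) * harmonic_nn s x y)"
        unfolding mult.assoc[symmetric] by (rule mult_right_mono) simp
    qed
    also have "\<dots> \<le> ennreal ((2 * (1 + (norm x)\<^sup>2)) powr s) * ennreal (C * (1 + (norm x)\<^sup>2) powr (- s))"
      using C(2)[of x] by (subst nn_integral_cmult) (auto intro: mult_left_mono)
    also have "\<dots> = ennreal M"
    proof -
      have "(2 * (1 + (norm x)\<^sup>2)) powr s = 2 powr s * (1 + (norm x)\<^sup>2) powr s" by (rule powr_mult)
      moreover have "(1 + (norm x)\<^sup>2) powr s * (1 + (norm x)\<^sup>2) powr (- s) = 1"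
        using pos by (simp flip: powr_add)
      ultimately have "(2 * (1 + (norm x)\<^sup>2)) powr s * (C * (1 + (norm x)\<^sup>2) powr (- s)) = M"
        by (simp add: M_def)
      moreover have "ennreal ((2 * (1 + (norm x)\<^sup>2)) powr s) * ennreal (C * (1 + (norm x)\<^sup>2) powr (- s))
        = ennreal ((2 * (1 + (norm x)\<^sup>2)) powr s * (C * (1 + (norm x)\<^sup>2) powr (- s)))"
        using C(1) by (intro ennreal_mult''[symmetric]) auto
      ultimately show ?thesis by simp
    qed
    finally show "(\<integral>\<^sup>+y. ennreal ((1 + (norm y)\<^sup>2) powr s) * harmonic_nn s x y \<partial>lborel) \<le> ennreal M" .
    have "(1 + (norm x)\<^sup>2) powr s \<ge> 1" using s by (simp add: ge_one_powr_ge_zero)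
    then have "M / (1 + (norm x)\<^sup>2) powr s \<le> M" using M(1) by (simp add: divide_le_eq mult_le_cancel_left1)
    then show "(\<integral>\<^sup>+y. harmonic_nn s x y \<partial>lborel) \<le> ennreal M"
      using mass[of x] by (meson ennreal_leI order_trans)
  qed
qed

lemma harmonic_mass_bounded:
  fixes s :: real
  assumes s: "s > 0"
  obtains M where "M > 0" "\<And>x::'a::euclidean_space. (\<integral>\<^sup>+y. harmonic_nn s x y \<partial>lborel) \<le> ennreal M"
  by (rule harmonic_mass[OF s, where 'a = 'a]) (rule that, assumption+)

text \<open>The total mass in y is finite, so for each x the extended kernel is infinite only on a
  null set of y; only there do the two kernels differ.\<close>

lemma ennreal_harmonic_kernel:
  fixes x :: "'a::euclidean_space"
  assumes s: "s > 0"
  shows "AE y in lborel. ennreal (harmonic_kernel s x y) = harmonic_nn s x y"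
proof -
  obtain M where M: "\<And>x::'a. (\<integral>\<^sup>+y. harmonic_nn s x y \<partial>lborel) \<le> ennreal M"
    by (rule harmonic_mass_bounded[OF s]) blast
  have "(\<integral>\<^sup>+y. harmonic_nn s x y \<partial>lborel) \<noteq> \<infinity>" using M[of x] by (auto simp: top_unique)
  then have "AE y in lborel. harmonic_nn s x y \<noteq> \<infinity>" by (intro nn_integral_PInf_AE) measurable
  then show ?thesis
    by eventually_elim (simp add: harmonic_kernel_eq[OF s] less_top)
qed

lemma harmonic_kernel_nonneg: "s > 0 \<Longrightarrow> harmonic_kernel s x y \<ge> 0"
  by (simp add: harmonic_kernel_eq)

lemma harmonic_kernel_measurable:
  fixes f g :: "'b \<Rightarrow> 'a::euclidean_space"
  assumes "s > 0" and [measurable]: "f \<in> borel_measurable M" "g \<in> borel_measurable M"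
  shows "(\<lambda>z. harmonic_kernel s (f z) (g z)) \<in> borel_measurable M"
  unfolding harmonic_kernel_eq[OF assms(1)] by measurable

lemma harmonic_T_eq:
  assumes s: "s > 0"
  shows "harmonic.T s f x = (\<integral>\<^sup>+y. ennreal (harmonic_kernel s x y * f y) \<partial>lborel)"
  unfolding harmonic.T_def
proof (rule nn_integral_cong_AE, rule eventually_mono[OF ennreal_harmonic_kernel[OF s, of x]])
  fix y assume "ennreal (harmonic_kernel s x y) = harmonic_nn s x y"
  then show "harmonic_nn s x y * ennreal (f y) = ennreal (harmonic_kernel s x y * f y)"
    using harmonic_kernel_nonneg[OF s, of x y] by (simp only: ennreal_mult')
qed

lemma integrable_harmonic_kernel_iff:
  fixes f :: "'a::euclidean_space \<Rightarrow> complex"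
  assumes s: "s > 0" and [measurable]: "f \<in> borel_measurable borel"
  shows "integrable lborel (\<lambda>y. harmonic_kernel s x y *\<^sub>R f y) \<longleftrightarrow> harmonic.T s (\<lambda>y. norm (f y)) x < \<infinity>"
proof -
  have [measurable]: "(\<lambda>y. harmonic_kernel s x y) \<in> borel_measurable borel"
    by (rule harmonic_kernel_measurable[OF s]) auto
  show ?thesis
    by (simp add: integrable_iff_bounded harmonic_T_eq[OF s] harmonic_kernel_nonneg[OF s])
qed

lemma norm_harmonic_neg_power_le:
  fixes f :: "'a::euclidean_space \<Rightarrow> complex"
  assumes s: "s > 0" and [measurable]: "f \<in> borel_measurable borel"
  shows "norm (harmonic_neg_power s f x) \<le> enn2real (harmonic.T s (\<lambda>y. norm (f y)) x)"
proof (cases "integrable lborel (\<lambda>y. harmonic_kernel s x y *\<^sub>R f y)")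
  case True
  then have fin: "harmonic.T s (\<lambda>y. norm (f y)) x < \<infinity>"
    using integrable_harmonic_kernel_iff[OF s, of f x] by simp
  have "ennreal (norm (harmonic_neg_power s f x)) \<le> (\<integral>\<^sup>+y. norm (harmonic_kernel s x y *\<^sub>R f y) \<partial>lborel)"
    unfolding harmonic_neg_power_def using True by (rule integral_norm_bound_ennreal)
  also have "\<dots> = harmonic.T s (\<lambda>y. norm (f y)) x"
    by (simp add: harmonic_T_eq[OF s] harmonic_kernel_nonneg[OF s])
  finally show ?thesis using fin by (metis enn2real_ennreal enn2real_mono norm_ge_zero infinity_ennreal_def)
qed (simp add: harmonic_neg_power_def not_integrable_integral_eq)

text \<open>Divergent points are covered as well: there both the Bochner integral and
  \<open>enn2real\<close> give 0.\<close>

lemma harmonic_neg_power_of_real: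
  fixes f :: "'a::euclidean_space \<Rightarrow> real"
  assumes s: "s > 0" and [measurable]: "f \<in> borel_measurable borel" and f: "\<And>y. 0 \<le> f y"
  shows "harmonic_neg_power s (\<lambda>y. complex_of_real (f y)) x = complex_of_real (enn2real (harmonic.T s f x))"
proof -
  have [measurable]: "(\<lambda>y. harmonic_kernel s x y) \<in> borel_measurable borel"
    by (rule harmonic_kernel_measurable[OF s]) auto
  have "harmonic_neg_power s (\<lambda>y. complex_of_real (f y)) x = complex_of_real (LINT y|lborel. harmonic_kernel s x y * f y)"
    unfolding harmonic_neg_power_def
    by (subst integral_complex_of_real[symmetric]) (simp add: scaleR_conv_of_real)
  also have "(LINT y|lborel. harmonic_kernel s x y * f y) = enn2real (harmonic.T s f x)"
    unfolding harmonic_T_eq[OF s] using f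
    by (intro integral_eq_nn_integral) (auto simp: harmonic_kernel_nonneg[OF s])
  finally show ?thesis .
qed

lemma harmonic_neg_power_measurable:
  fixes f :: "'a::euclidean_space \<Rightarrow> complex"
  assumes s: "s > 0" and [measurable]: "f \<in> borel_measurable borel"
  shows "harmonic_neg_power s f \<in> borel_measurable borel"
proof -
  have [measurable]: "(\<lambda>z. harmonic_kernel s (fst z) (snd z :: 'a)) \<in> borel_measurable (borel \<Otimes>\<^sub>M borel)"
    by (rule harmonic_kernel_measurable[OF s]) measurable
  have "(\<lambda>x. LINT y|lborel. harmonic_kernel s (fst (x, y)) (snd (x, y)) *\<^sub>R f y) \<in> borel_measurable (borel :: 'a measure)"
    by measurable
  then show ?thesis by (simp add: harmonic_neg_power_def[abs_def])
qed


section \<open>Passage between bounds for T on nonnegative functions and boundedness of the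
  operator\<close>

abbreviation harmonic_strong_type :: "'a::euclidean_space itself \<Rightarrow> real \<Rightarrow> real \<Rightarrow> real \<Rightarrow> bool" where
  "harmonic_strong_type _ s p q \<equiv> symmetric_kernel.strong_type (harmonic_nn s :: 'a \<Rightarrow> 'a \<Rightarrow> ennreal) p q"

text \<open>Homogeneity: f is dominated by N g with g in the unit ball, hence the operator by N T g.
  The finiteness part of \<open>strong_type\<close> gives absolute convergence, and its constant
  bounds the q-th power, whence the root C^(1/q).\<close>

lemma bounded_if_strong_type:
  assumes s: "s > 0" and pq: "p \<ge> 1" "q \<ge> 1"
    and strong: "harmonic_strong_type TYPE('a::euclidean_space) s p q"
  shows "harmonic_neg_power_bounded TYPE('a) s (ennreal p) (ennreal q)"
proof -
  obtain C where C: "C \<ge> 0" and T: "\<And>g :: 'a \<Rightarrow> real. g \<in> borel_measurable borel \<Longrightarrow> (\<And>x. 0 \<le> g x) \<Longrightarrow>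
      (\<integral>\<^sup>+x. ennreal (g x powr p) \<partial>lborel) \<le> 1 \<Longrightarrow>
      (AE x in lborel. harmonic.T s g x < \<infinity>) \<and> (\<integral>\<^sup>+x. ennreal (enn2real (harmonic.T s g x) powr q) \<partial>lborel) \<le> ennreal C"
    using strong unfolding harmonic.strong_type_def by blast
  show ?thesis
    unfolding harmonic_neg_power_bounded_def
  proof (intro exI[of _ "C powr (1 / q)"] ballI)
    fix f :: "'a \<Rightarrow> complex" assume f: "f \<in> Lp_space (ennreal p) lborel"
    then have [measurable]: "f \<in> borel_measurable borel" by (simp add: Lp_space_def)
    obtain N g where g: "N \<ge> 0" "g \<in> borel_measurable borel" "\<And>x. 0 \<le> g x"
      "(\<integral>\<^sup>+x. ennreal (g x powr p) \<partial>lborel) \<le> 1" "AE x in lborel. norm (f x) \<le> N * g x"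
      "Lp_norm (ennreal p) lborel f = ennreal N"
      using Lp_space_ennreal_decompose[OF pq(1) f] by blast
    note Tg = T[OF g(2,3,4)]
    have le: "harmonic.T s (\<lambda>y. norm (f y)) x \<le> ennreal N * harmonic.T s g x" for x
      using harmonic.T_mono_AE[OF g(5), of s x] harmonic.T_cmult[OF g(2) g(1), of s x] by simp
    have AE_fin: "AE x in lborel. harmonic.T s g x < \<infinity>" using Tg by blast
    have "AE x in lborel. integrable lborel (\<lambda>y. harmonic_kernel s x y *\<^sub>R f y)"
      using AE_fin
    proof eventually_elim
      fix x assume "harmonic.T s g x < \<infinity>"
      then show "integrable lborel (\<lambda>y. harmonic_kernel s x y *\<^sub>R f y)"
        unfolding integrable_harmonic_kernel_iff[OF s \<open>f \<in> borel_measurable borel\<close>]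
        by (intro le_less_trans[OF le]) (simp add: ennreal_mult_less_top)
    qed
    moreover have "Lp_norm (ennreal q) lborel (harmonic_neg_power s f) \<le> ennreal (N * C powr (1 / q))"
    proof (subst Lp_norm_ennreal_le_iff)
      have "(\<integral>\<^sup>+x. ennreal (norm (harmonic_neg_power s f x) powr q) \<partial>lborel)
        \<le> (\<integral>\<^sup>+x. ennreal (N powr q) * ennreal (enn2real (harmonic.T s g x) powr q) \<partial>lborel)"
      proof (rule nn_integral_mono_AE, rule eventually_mono[OF AE_fin])
        fix x assume fin: "harmonic.T s g x < \<infinity>"
        have "norm (harmonic_neg_power s f x) \<le> enn2real (harmonic.T s (\<lambda>y. norm (f y)) x)"
          by (rule norm_harmonic_neg_power_le[OF s]) simp
        also have "\<dots> \<le> enn2real (ennreal N * harmonic.T s g x)"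
          using fin by (intro enn2real_mono le) (simp add: ennreal_mult_less_top)
        also have "\<dots> = N * enn2real (harmonic.T s g x)" using g(1) by (simp add: enn2real_mult)
        finally have "norm (harmonic_neg_power s f x) powr q \<le> (N * enn2real (harmonic.T s g x)) powr q"
          using pq by (intro powr_mono2) auto
        also have "\<dots> = N powr q * enn2real (harmonic.T s g x) powr q"
          by (rule powr_mult)
        finally show "ennreal (norm (harmonic_neg_power s f x) powr q) \<le> ennreal (N powr q) * ennreal (enn2real (harmonic.T s g x) powr q)"
          by (simp add: ennreal_mult''[symmetric] ennreal_leI)
      qed
      also have "\<dots> = ennreal (N powr q) * (\<integral>\<^sup>+x. ennreal (enn2real (harmonic.T s g x) powr q) \<partial>lborel)"
        using harmonic.T_measurable[OF g(2), of s] by (intro nn_integral_cmult) simp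
      also have "\<dots> \<le> ennreal (N powr q) * ennreal C"
        using Tg by (intro mult_left_mono) auto
      also have "\<dots> = ennreal ((N * C powr (1 / q)) powr q)"
        using C pq by (simp add: powr_mult powr_powr ennreal_mult''[symmetric])
      finally show "(\<integral>\<^sup>+x. ennreal (norm (harmonic_neg_power s f x) powr q) \<partial>lborel) \<le> ennreal ((N * C powr (1 / q)) powr q)" .
    qed (use pq g(1) in auto)
    ultimately show "(AE x in lborel. integrable lborel (\<lambda>y. harmonic_kernel s x y *\<^sub>R f y)) \<and>
      Lp_norm (ennreal q) lborel (harmonic_neg_power s f) \<le> ennreal (C powr (1 / q)) * Lp_norm (ennreal p) lborel f"
      unfolding g(6) using g(1) by (simp add: ennreal_mult''[symmetric] mult.commute)
  qed
qed

lemma bounded_into_infinity_if: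
  assumes s: "s > 0" and p: "p \<ge> 1" and C: "C \<ge> 0"
    and T: "\<And>(g :: 'a::euclidean_space \<Rightarrow> real) x. g \<in> borel_measurable borel \<Longrightarrow> (\<And>x. 0 \<le> g x) \<Longrightarrow>
      (\<integral>\<^sup>+x. ennreal (g x powr p) \<partial>lborel) \<le> 1 \<Longrightarrow> harmonic.T s g x \<le> ennreal C"
  shows "harmonic_neg_power_bounded TYPE('a) s (ennreal p) \<infinity>"
  unfolding harmonic_neg_power_bounded_def
proof (intro exI[of _ C] ballI conjI)
  fix f :: "'a \<Rightarrow> complex" assume f: "f \<in> Lp_space (ennreal p) lborel"
  then have fm[measurable]: "f \<in> borel_measurable borel" by (simp add: Lp_space_def)
  obtain N g where g: "N \<ge> 0" "g \<in> borel_measurable borel" "\<And>x. 0 \<le> g x"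
    "(\<integral>\<^sup>+x. ennreal (g x powr p) \<partial>lborel) \<le> 1" "AE x in lborel. norm (f x) \<le> N * g x"
    "Lp_norm (ennreal p) lborel f = ennreal N"
    using Lp_space_ennreal_decompose[OF p f] by blast
  have le: "harmonic.T s (\<lambda>y. norm (f y)) x \<le> ennreal (N * C)" for x
    using harmonic.T_mono_AE[OF g(5), of s x] harmonic.T_cmult[OF g(2) g(1), of s x]
      mult_left_mono[OF T[OF g(2,3,4), of x], of "ennreal N"] C
    by (simp add: ennreal_mult'')
  then show "AE x in lborel. integrable lborel (\<lambda>y. harmonic_kernel s x y *\<^sub>R f y)"
    unfolding integrable_harmonic_kernel_iff[OF s fm] by (intro AE_I2 le_less_trans[OF le]) simp
  have "norm (harmonic_neg_power s f x) \<le> N * C" for x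
  proof -
    have "norm (harmonic_neg_power s f x) \<le> enn2real (harmonic.T s (\<lambda>y. norm (f y)) x)"
      by (rule norm_harmonic_neg_power_le[OF s fm])
    also have "\<dots> \<le> enn2real (ennreal (N * C))" by (intro enn2real_mono le) simp
    finally show ?thesis using g(1) C by simp
  qed
  then show "Lp_norm \<infinity> lborel (harmonic_neg_power s f) \<le> ennreal C * Lp_norm (ennreal p) lborel f"
    using harmonic_neg_power_measurable[OF s fm] g(1,6) C
    by (auto simp: Lp_norm_def ennreal_mult''[symmetric] mult.commute intro!: esssup_I ennreal_leI)
qed

lemma AE_norm_le_Lp_norm_infinity:
  assumes "f \<in> Lp_space \<infinity> M"
  obtains N where "N \<ge> 0" "AE x in M. norm (f x) \<le> N" "Lp_norm \<infinity> M f = ennreal N"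
proof -
  define N where "N = enn2real (Lp_norm \<infinity> M f)"
  have N: "Lp_norm \<infinity> M f = ennreal N" using assms by (auto simp: N_def Lp_space_def)
  have "AE x in M. ennreal (norm (f x)) \<le> ennreal N"
    unfolding N[symmetric] Lp_norm_def by (simp add: esssup_AE)
  then have "AE x in M. norm (f x) \<le> N" by eventually_elim (simp add: N_def)
  with N show ?thesis by (intro that[of N]) (auto simp: N_def)
qed

text \<open>Pointwise, the operator is bounded by the norm of f times the mass function T 1, so
  integrability of T 1 decides; for q = \<infinity> its boundedness does.\<close>

lemma bounded_from_infinity_if:
  assumes s: "s > 0"
    and q: "q = \<infinity> \<or> (\<exists>r\<ge>1. q = ennreal r \<and>
      (\<integral>\<^sup>+x. ennreal (enn2real (harmonic.T s (\<lambda>_. 1) (x::'a::euclidean_space)) powr r) \<partial>lborel) < \<infinity>)"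
  shows "harmonic_neg_power_bounded TYPE('a) s \<infinity> q"
proof -
  obtain M where M: "M > 0" "\<And>x::'a. (\<integral>\<^sup>+y. harmonic_nn s x y \<partial>lborel) \<le> ennreal M"
    by (rule harmonic_mass_bounded[OF s]) blast
  have T1: "harmonic.T s (\<lambda>_. 1) x \<le> ennreal M" for x :: 'a
    using M(2)[of x] by (simp add: harmonic.T_def)
  have T1m[measurable]: "harmonic.T s (\<lambda>_. 1) \<in> borel_measurable (borel :: 'a measure)"
    by (rule harmonic.T_measurable) simp
  have main: "(AE x in lborel. integrable lborel (\<lambda>y. harmonic_kernel s x y *\<^sub>R f y)) \<and>
      (\<forall>x. norm (harmonic_neg_power s f x) \<le> N * enn2real (harmonic.T s (\<lambda>_. 1) x))"
    if f: "f \<in> borel_measurable borel" and N: "N \<ge> 0" "AE x in lborel. norm (f x) \<le> N"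
    for f :: "'a \<Rightarrow> complex" and N
  proof -
    have le: "harmonic.T s (\<lambda>y. norm (f y)) x \<le> ennreal N * harmonic.T s (\<lambda>_. 1) x" for x
      using harmonic.T_mono_AE[of "\<lambda>y. norm (f y)" "\<lambda>y. N * 1" s x] harmonic.T_cmult[of "\<lambda>_. 1" N s x] N by simp
    have fin: "ennreal N * harmonic.T s (\<lambda>_. 1) x < \<infinity>" for x :: 'a
      using le_less_trans[OF T1[of x]] by (simp add: ennreal_mult_less_top)
    have "norm (harmonic_neg_power s f x) \<le> N * enn2real (harmonic.T s (\<lambda>_. 1) x)" for x
    proof -
      have "norm (harmonic_neg_power s f x) \<le> enn2real (harmonic.T s (\<lambda>y. norm (f y)) x)"
        by (rule norm_harmonic_neg_power_le[OF s f])
      also have "\<dots> \<le> enn2real (ennreal N * harmonic.T s (\<lambda>_. 1) x)"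
        using fin by (intro enn2real_mono le) auto
      finally show ?thesis using N by (simp add: enn2real_mult)
    qed
    moreover have "harmonic.T s (\<lambda>y. norm (f y)) x < \<infinity>" for x
      using le fin by (rule le_less_trans)
    ultimately show ?thesis by (simp add: integrable_harmonic_kernel_iff[OF s f])
  qed
  from q show ?thesis
  proof (elim disjE exE conjE)
    assume q: "q = \<infinity>"
    show ?thesis
      unfolding harmonic_neg_power_bounded_def q
    proof (intro exI[of _ M] ballI)
      fix f :: "'a \<Rightarrow> complex" assume f: "f \<in> Lp_space \<infinity> lborel"
      then have fm: "f \<in> borel_measurable borel" by (simp add: Lp_space_def)
      obtain N where N: "N \<ge> 0" "AE x in lborel. norm (f x) \<le> N" "Lp_norm \<infinity> lborel f = ennreal N"
        using AE_norm_le_Lp_norm_infinity[OF f] .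
      have "norm (harmonic_neg_power s f x) \<le> M * N" for x
      proof -
        have "enn2real (harmonic.T s (\<lambda>_. 1) x) \<le> M"
          using enn2real_mono[OF T1[of x]] M(1) by simp
        then have "N * enn2real (harmonic.T s (\<lambda>_. 1) x) \<le> N * M" using N by (intro mult_left_mono)
        with main[OF fm N(1,2)] show ?thesis by (metis mult.commute order_trans)
      qed
      then have "Lp_norm \<infinity> lborel (harmonic_neg_power s f) \<le> ennreal M * Lp_norm \<infinity> lborel f"
        unfolding N(3) using harmonic_neg_power_measurable[OF s fm] M(1) N(1)
        by (auto simp: Lp_norm_def ennreal_mult''[symmetric] intro!: esssup_I ennreal_leI)
      with main[OF fm N(1,2)] show "(AE x in lborel. integrable lborel (\<lambda>y. harmonic_kernel s x y *\<^sub>R f y)) \<and>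
        Lp_norm \<infinity> lborel (harmonic_neg_power s f) \<le> ennreal M * Lp_norm \<infinity> lborel f"
        by blast
    qed
  next
    fix r assume r: "1 \<le> r" "q = ennreal r"
      and fin: "(\<integral>\<^sup>+x. ennreal (enn2real (harmonic.T s (\<lambda>_. 1) (x::'a)) powr r) \<partial>lborel) < \<infinity>"
    then obtain J where J: "J \<ge> 0" "(\<integral>\<^sup>+x. ennreal (enn2real (harmonic.T s (\<lambda>_. 1) (x::'a)) powr r) \<partial>lborel) = ennreal J"
      by (cases "\<integral>\<^sup>+x. ennreal (enn2real (harmonic.T s (\<lambda>_. 1) (x::'a)) powr r) \<partial>lborel") auto
    show ?thesis
      unfolding harmonic_neg_power_bounded_def r(2)
    proof (intro exI[of _ "J powr (1 / r)"] ballI)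
      fix f :: "'a \<Rightarrow> complex" assume f: "f \<in> Lp_space \<infinity> lborel"
      then have fm: "f \<in> borel_measurable borel" by (simp add: Lp_space_def)
      obtain N where N: "N \<ge> 0" "AE x in lborel. norm (f x) \<le> N" "Lp_norm \<infinity> lborel f = ennreal N"
        using AE_norm_le_Lp_norm_infinity[OF f] .
      have "Lp_norm (ennreal r) lborel (harmonic_neg_power s f) \<le> ennreal (J powr (1 / r) * N)"
      proof (subst Lp_norm_ennreal_le_iff)
        have "(\<integral>\<^sup>+x. ennreal (norm (harmonic_neg_power s f x) powr r) \<partial>lborel)
          \<le> (\<integral>\<^sup>+x. ennreal (N powr r) * ennreal (enn2real (harmonic.T s (\<lambda>_. 1) (x::'a)) powr r) \<partial>lborel)"
        proof (rule nn_integral_mono)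
          fix x :: 'a
          have "norm (harmonic_neg_power s f x) powr r \<le> (N * enn2real (harmonic.T s (\<lambda>_. 1) x)) powr r"
            using main[OF fm N(1,2)] r by (intro powr_mono2) auto
          also have "\<dots> = N powr r * enn2real (harmonic.T s (\<lambda>_. 1) x) powr r" by (rule powr_mult)
          finally show "ennreal (norm (harmonic_neg_power s f x) powr r) \<le> ennreal (N powr r) * ennreal (enn2real (harmonic.T s (\<lambda>_. 1) x) powr r)"
            by (simp add: ennreal_mult''[symmetric] ennreal_leI)
        qed
        also have "\<dots> = ennreal (N powr r) * ennreal J"
          unfolding J(2)[symmetric] by (rule nn_integral_cmult) measurable
        also have "\<dots> = ennreal ((J powr (1 / r) * N) powr r)"
          using J r by (simp add: powr_mult powr_powr ennreal_mult''[symmetric] mult.commute)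
        finally show "(\<integral>\<^sup>+x. ennreal (norm (harmonic_neg_power s f x) powr r) \<partial>lborel) \<le> ennreal ((J powr (1 / r) * N) powr r)" .
      qed (use r N in auto)
      with main[OF fm N(1,2)] show "(AE x in lborel. integrable lborel (\<lambda>y. harmonic_kernel s x y *\<^sub>R f y)) \<and>
        Lp_norm (ennreal r) lborel (harmonic_neg_power s f) \<le> ennreal (J powr (1 / r)) * Lp_norm \<infinity> lborel f"
        unfolding N(3) using N(1) by (simp add: ennreal_mult''[symmetric])
    qed
  qed
qed

lemma bounded_on_nonneg:
  assumes s: "s > 0" and bd: "harmonic_neg_power_bounded TYPE('a::euclidean_space) s p q"
  obtains C where "C \<ge> 0" "\<And>f :: 'a \<Rightarrow> real. f \<in> borel_measurable borel \<Longrightarrow> (\<And>x. 0 \<le> f x) \<Longrightarrow>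
      Lp_norm p lborel (\<lambda>x. complex_of_real (f x)) \<le> 1 \<Longrightarrow>
      (AE x in lborel. harmonic.T s f x < \<infinity>) \<and>
      Lp_norm q lborel (\<lambda>x. complex_of_real (enn2real (harmonic.T s f x))) \<le> ennreal C"
proof -
  obtain C where C: "\<And>f. f \<in> Lp_space p (lborel :: 'a measure) \<Longrightarrow>
       (AE x in lborel. integrable lborel (\<lambda>y. harmonic_kernel s x y *\<^sub>R f y)) \<and>
       Lp_norm q lborel (harmonic_neg_power s f) \<le> ennreal C * Lp_norm p lborel f"
    using bd unfolding harmonic_neg_power_bounded_def by blast
  show ?thesis
  \<comment> \<open>The constant in the definition of boundedness may be negative, in which case
    \<open>ennreal C\<close> is 0.\<close>
  proof (rule that[of "max C 0"])
    fix f :: "'a \<Rightarrow> real"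
    assume f[measurable]: "f \<in> borel_measurable borel" and f0: "\<And>x. 0 \<le> f x"
      and norm: "Lp_norm p lborel (\<lambda>x. complex_of_real (f x)) \<le> 1"
    have "(\<lambda>x. complex_of_real (f x)) \<in> Lp_space p lborel"
      using norm by (auto simp: Lp_space_def intro: le_less_trans)
    note * = C[OF this]
    have eq: "harmonic_neg_power s (\<lambda>y. complex_of_real (f y)) = (\<lambda>x. complex_of_real (enn2real (harmonic.T s f x)))"
      using harmonic_neg_power_of_real[OF s f f0] by (intro ext)
    have "AE x in lborel. harmonic.T s f x < \<infinity>"
      using conjunct1[OF *] f0 by (subst (asm) integrable_harmonic_kernel_iff[OF s]) auto
    moreover have "ennreal C * Lp_norm p lborel (\<lambda>x. complex_of_real (f x)) \<le> ennreal (max C 0) * 1"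
      using norm by (intro mult_mono ennreal_leI) auto
    ultimately show "(AE x in lborel. harmonic.T s f x < \<infinity>) \<and>
      Lp_norm q lborel (\<lambda>x. complex_of_real (enn2real (harmonic.T s f x))) \<le> ennreal (max C 0)"
      using * unfolding eq by (auto intro: order_trans)
  qed simp
qed

lemma strong_type_if_bounded:
  assumes s: "s > 0" and pq: "p \<ge> 1" "q \<ge> 1"
    and bd: "harmonic_neg_power_bounded TYPE('a::euclidean_space) s (ennreal p) (ennreal q)"
  shows "harmonic_strong_type TYPE('a) s p q"
proof -
  obtain C where C: "C \<ge> 0" "\<And>f :: 'a \<Rightarrow> real. f \<in> borel_measurable borel \<Longrightarrow> (\<And>x. 0 \<le> f x) \<Longrightarrow>
      Lp_norm (ennreal p) lborel (\<lambda>x. complex_of_real (f x)) \<le> 1 \<Longrightarrow>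
      (AE x in lborel. harmonic.T s f x < \<infinity>) \<and>
      Lp_norm (ennreal q) lborel (\<lambda>x. complex_of_real (enn2real (harmonic.T s f x))) \<le> ennreal C"
    using bounded_on_nonneg[OF s bd] by blast
  show ?thesis
    unfolding harmonic.strong_type_def
  proof (intro exI[of _ "C powr q"] conjI[of "0 \<le> _"] ballI impI)
    fix f :: "'a \<Rightarrow> real"
    assume f: "f \<in> borel_measurable borel" "\<forall>x. 0 \<le> f x" "(\<integral>\<^sup>+x. ennreal (f x powr p) \<partial>lborel) \<le> 1"
    have "Lp_norm (ennreal p) lborel (\<lambda>x. complex_of_real (f x)) \<le> ennreal 1"
      using f pq by (subst Lp_norm_ennreal_le_iff) auto
    then show "(AE x in lborel. harmonic.T s f x < \<infinity>) \<and> (\<integral>\<^sup>+x. ennreal (enn2real (harmonic.T s f x) powr q) \<partial>lborel) \<le> ennreal (C powr q)"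
      using C(2)[OF f(1)] f(2) C(1) pq by (simp add: Lp_norm_ennreal_le_iff)
  qed simp
qed

text \<open>The essential supremum is taken after \<open>enn2real\<close> and does not see points
  where T f is infinite; the required absolute convergence excludes these almost everywhere.\<close>

lemma T_AE_bounded_if_bounded_into_infinity:
  assumes s: "s > 0" and p: "p \<ge> 1"
    and bd: "harmonic_neg_power_bounded TYPE('a::euclidean_space) s (ennreal p) \<infinity>"
  obtains C where "C \<ge> 0" "\<And>f :: 'a \<Rightarrow> real. f \<in> borel_measurable borel \<Longrightarrow> (\<And>x. 0 \<le> f x) \<Longrightarrow>
      (\<integral>\<^sup>+x. ennreal (f x powr p) \<partial>lborel) \<le> 1 \<Longrightarrow> AE x in lborel. harmonic.T s f x \<le> ennreal C"
proof -
  obtain C where C: "C \<ge> 0" "\<And>f :: 'a \<Rightarrow> real. f \<in> borel_measurable borel \<Longrightarrow> (\<And>x. 0 \<le> f x) \<Longrightarrow>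
      Lp_norm (ennreal p) lborel (\<lambda>x. complex_of_real (f x)) \<le> 1 \<Longrightarrow>
      (AE x in lborel. harmonic.T s f x < \<infinity>) \<and>
      Lp_norm \<infinity> lborel (\<lambda>x. complex_of_real (enn2real (harmonic.T s f x))) \<le> ennreal C"
    using bounded_on_nonneg[OF s bd] by blast
  show ?thesis
  proof (rule that[OF C(1)])
    fix f :: "'a \<Rightarrow> real"
    assume f: "f \<in> borel_measurable borel" "\<And>x. 0 \<le> f x" "(\<integral>\<^sup>+x. ennreal (f x powr p) \<partial>lborel) \<le> 1"
    have "Lp_norm (ennreal p) lborel (\<lambda>x. complex_of_real (f x)) \<le> ennreal 1"
      using f p by (subst Lp_norm_ennreal_le_iff) auto
    then have *: "AE x in lborel. harmonic.T s f x < \<infinity>"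
      "esssup lborel (\<lambda>x. ennreal (enn2real (harmonic.T s f x))) \<le> ennreal C"
      using C(2)[OF f(1,2)] by (auto simp: Lp_norm_def)
    show "AE x in lborel. harmonic.T s f x \<le> ennreal C"
      using *(1) esssup_AE[of "\<lambda>x. ennreal (enn2real (harmonic.T s f x))" lborel]
      by eventually_elim (use *(2) in \<open>auto simp: less_top intro: order_trans\<close>)
  qed
qed

section \<open>Necessary conditions on the exponents\<close>

lemma mass_in_Lp_if_bounded_from_infinity:
  assumes s: "s > 0" and q: "q \<ge> 1"
    and bd: "harmonic_neg_power_bounded TYPE('a::euclidean_space) s \<infinity> (ennreal q)"
  shows "(\<integral>\<^sup>+x. ennreal (enn2real (harmonic.T s (\<lambda>_. 1) (x::'a)) powr q) \<partial>lborel) < \<infinity>"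
proof -
  obtain C where C: "C \<ge> 0" "\<And>f :: 'a \<Rightarrow> real. f \<in> borel_measurable borel \<Longrightarrow> (\<And>x. 0 \<le> f x) \<Longrightarrow>
      Lp_norm \<infinity> lborel (\<lambda>x. complex_of_real (f x)) \<le> 1 \<Longrightarrow>
      (AE x in lborel. harmonic.T s f x < \<infinity>) \<and>
      Lp_norm (ennreal q) lborel (\<lambda>x. complex_of_real (enn2real (harmonic.T s f x))) \<le> ennreal C"
    using bounded_on_nonneg[OF s bd] by blast
  have "Lp_norm \<infinity> (lborel :: 'a measure) (\<lambda>x. complex_of_real 1) \<le> 1"
    by (auto simp: Lp_norm_def intro!: esssup_I)
  then have "Lp_norm (ennreal q) (lborel :: 'a measure) (\<lambda>x. complex_of_real (enn2real (harmonic.T s (\<lambda>_. 1) x))) \<le> ennreal C"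
    using C(2)[of "\<lambda>_. 1"] by simp
  then show ?thesis
    using C(1) q by (auto simp: Lp_norm_ennreal_le_iff intro: le_less_trans)
qed

text \<open>The lower mass bound puts (1+|x|^2)^(-sq) below a multiple of the given integrand, and
  that weight is integrable only if 2sq > d.\<close>

lemma mass_in_Lp_imp:
  assumes s: "s > 0" and q: "q \<ge> 1"
    and fin: "(\<integral>\<^sup>+x. ennreal (enn2real (harmonic.T s (\<lambda>_. 1) (x::'a::euclidean_space)) powr q) \<partial>lborel) < \<infinity>"
  shows "real DIM('a) < 2 * s * q"
proof -
  obtain M where M: "\<And>x::'a. (\<integral>\<^sup>+y. harmonic_nn s x y \<partial>lborel) \<le> ennreal M"
    by (rule harmonic_mass_bounded[OF s]) blast
  obtain c where c: "c > 0" "\<And>x::'a. ennreal (c * (1 + (norm x)\<^sup>2) powr (- s)) \<le> (\<integral>\<^sup>+y. harmonic_nn s x y \<partial>lborel)"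
    using harmonic_mass_ge[OF s] by blast
  have "ennreal (c powr q) * (\<integral>\<^sup>+x. ennreal ((1 + (norm x)\<^sup>2) powr (- (2 * s * q / 2))) \<partial>(lborel :: 'a measure))
    = (\<integral>\<^sup>+x. ennreal (c powr q) * ennreal ((1 + (norm x)\<^sup>2) powr (- (2 * s * q / 2))) \<partial>(lborel :: 'a measure))"
    by (rule nn_integral_cmult[symmetric]) measurable
  also have "\<dots> \<le> (\<integral>\<^sup>+x. ennreal (enn2real (harmonic.T s (\<lambda>_. 1) (x::'a)) powr q) \<partial>lborel)"
  proof (rule nn_integral_mono)
    fix x :: 'a
    have T: "harmonic.T s (\<lambda>_. 1) x = (\<integral>\<^sup>+y. harmonic_nn s x y \<partial>lborel)" by (simp add: harmonic.T_def)
    have "c * (1 + (norm x)\<^sup>2) powr (- s) = enn2real (ennreal (c * (1 + (norm x)\<^sup>2) powr (- s)))"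
      using c(1) by simp
    \<comment> \<open>Monotonicity of \<open>enn2real\<close> requires the larger value to be
      finite, so the upper mass bound is used here too.\<close>
    also have "\<dots> \<le> enn2real (harmonic.T s (\<lambda>_. 1) x)"
      unfolding T using c(2)[of x] M[of x] by (intro enn2real_mono) (auto intro: le_less_trans)
    finally have "(c * (1 + (norm x)\<^sup>2) powr (- s)) powr q \<le> enn2real (harmonic.T s (\<lambda>_. 1) x) powr q"
      using c q by (intro powr_mono2) auto
    then show "ennreal (c powr q) * ennreal ((1 + (norm x)\<^sup>2) powr (- (2 * s * q / 2))) \<le> ennreal (enn2real (harmonic.T s (\<lambda>_. 1) x) powr q)"
      by (simp add: powr_mult powr_powr ennreal_mult''[symmetric] ennreal_leI)
  qed
  finally have "ennreal (c powr q) * (\<integral>\<^sup>+x. ennreal ((1 + (norm x)\<^sup>2) powr (- (2 * s * q / 2))) \<partial>(lborel :: 'a measure)) < \<infinity>"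
    using fin by (rule le_less_trans)
  then have "(\<integral>\<^sup>+x. ennreal ((1 + (norm x)\<^sup>2) powr (- (2 * s * q / 2))) \<partial>(lborel :: 'a measure)) < \<infinity>"
    using c(1) by (auto simp: ennreal_mult_less_top)
  then show ?thesis by (simp only: nn_integral_weight_less_top_iff)
qed

text \<open>Normalized indicators g of balls of radius e about the origin have norm 1 in L^1, while
  T g(x) >= c|x|^(2s-d) for e <= |x| <= 1/4, since the lower kernel bound is uniform over the ball.
  If q were critical or larger, the integral of |x|^(-d) over these annuli would stay bounded as e
  tends to 0.\<close>

lemma strong_type_from_one_imp:
  assumes s: "0 < s" "2 * s < real DIM('a::euclidean_space)" and q: "q \<ge> 1"
    and strong: "harmonic_strong_type TYPE('a) s 1 q"
  shows "q * (real DIM('a) - 2 * s) < real DIM('a)"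
proof (rule ccontr)
  assume "\<not> q * (real DIM('a) - 2 * s) < real DIM('a)"
  then have qd: "(2 * s - real DIM('a)) * q \<le> - real DIM('a)" by (simp add: algebra_simps)
  obtain C where T: "\<And>g :: 'a \<Rightarrow> real. g \<in> borel_measurable borel \<Longrightarrow> (\<And>x. 0 \<le> g x) \<Longrightarrow>
      (\<integral>\<^sup>+x. ennreal (g x powr 1) \<partial>lborel) \<le> 1 \<Longrightarrow>
      (AE x in lborel. harmonic.T s g x < \<infinity>) \<and> (\<integral>\<^sup>+x. ennreal (enn2real (harmonic.T s g x) powr q) \<partial>lborel) \<le> ennreal C"
    using strong unfolding harmonic.strong_type_def by blast
  obtain c where c: "c > 0" "\<And>x y::'a. 0 < norm x \<Longrightarrow> norm x \<le> 1 / 4 \<Longrightarrow> norm y \<le> norm x \<Longrightarrow>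
    ennreal (c * norm x powr (2 * s - DIM('a))) \<le> harmonic_nn s x y"
    using harmonic_nn_ge_near_origin[OF s(1)] by blast
  define A where "A n = ball (0::'a) (1 / 4) - ball 0 (1 / Suc n)" for n
  have A[measurable]: "A n \<in> sets borel" for n by (simp add: A_def)
  have le_A: "(\<integral>\<^sup>+x\<in>A n. ennreal (norm x powr (- real DIM('a))) \<partial>lborel) \<le> ennreal (1 / c powr q) * ennreal C" for n
  proof -
    define e where "e = 1 / real (Suc n)"
    define m where "m = measure lborel (ball (0::'a) e)"
    have m: "m > 0" "emeasure lborel (ball (0::'a) e) = ennreal m"
      using emeasure_lborel_ball_finite[of "0::'a" e]
      by (auto simp: m_def e_def less_top[symmetric] simp del: of_nat_Suc intro!: emeasure_eq_ennreal_measure)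
    define g where "g x = indicator (ball 0 e) x / m" for x :: 'a
    have g[measurable]: "g \<in> borel_measurable borel" unfolding g_def by (intro borel_measurable_divide borel_measurable_indicator) auto
    have g0: "0 \<le> g x" for x using m by (simp add: g_def)
    have eg: "ennreal (g x) = ennreal (1 / m) * indicator (ball 0 e) x" for x
      by (simp add: g_def indicator_def)
    have g1: "(\<integral>\<^sup>+x. ennreal (g x) \<partial>lborel) = 1"
      unfolding eg using m by (simp add: nn_integral_cmult_indicator ennreal_mult''[symmetric])
    note Tg = T[OF g g0]
    have "(\<integral>\<^sup>+x\<in>A n. ennreal (norm x powr (- real DIM('a))) \<partial>lborel)
      \<le> (\<integral>\<^sup>+x. ennreal (1 / c powr q) * ennreal (enn2real (harmonic.T s g x) powr q) \<partial>lborel)"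
    proof (rule nn_integral_mono_AE, rule eventually_mono[of "\<lambda>x. harmonic.T s g x < \<infinity>"])
      show "AE x in lborel. harmonic.T s g x < \<infinity>" using Tg g0 g1 by simp
      fix x assume fin: "harmonic.T s g x < \<infinity>"
      show "ennreal (norm x powr (- real DIM('a))) * indicator (A n) x \<le> ennreal (1 / c powr q) * ennreal (enn2real (harmonic.T s g x) powr q)"
      proof (cases "x \<in> A n")
        case True
        have e0: "e > 0" by (simp add: e_def)
        have x: "e \<le> norm x" "norm x \<le> 1 / 4" using True by (auto simp: A_def e_def)
        have x0: "0 < norm x" using x e0 by linarith
        have "ennreal (c * norm x powr (2 * s - DIM('a))) = (\<integral>\<^sup>+y. ennreal (c * norm x powr (2 * s - DIM('a))) * ennreal (g y) \<partial>lborel)"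
          using g1 by (simp add: nn_integral_cmult)
        also have "\<dots> \<le> harmonic.T s g x"
          unfolding harmonic.T_def
        proof (rule nn_integral_mono)
          fix y
          show "ennreal (c * norm x powr (2 * s - DIM('a))) * ennreal (g y) \<le> harmonic_nn s x y * ennreal (g y)"
            using c(2)[of x y] x x0 by (cases "norm y < e") (auto intro!: mult_right_mono simp: g_def)
        qed
        finally have "c * norm x powr (2 * s - DIM('a)) \<le> enn2real (harmonic.T s g x)"
          using enn2real_mono[of "ennreal (c * norm x powr (2 * s - DIM('a)))" "harmonic.T s g x"] fin c(1) by simp
        then have "(c * norm x powr (2 * s - DIM('a))) powr q \<le> enn2real (harmonic.T s g x) powr q"
          using c(1) q by (intro powr_mono2) auto
        moreover have "(c * norm x powr (2 * s - DIM('a))) powr q = c powr q * norm x powr ((2 * s - DIM('a)) * q)"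
          unfolding powr_mult powr_powr ..
        \<comment> \<open>For |x| < 1 a smaller exponent gives a larger power, and (2s-d)q <= -d is
          the negated claim.\<close>
        moreover have "c powr q * norm x powr (- real DIM('a)) \<le> c powr q * norm x powr ((2 * s - DIM('a)) * q)"
          using x e0 qd by (intro mult_left_mono powr_mono') auto
        ultimately have "c powr q * norm x powr (- real DIM('a)) \<le> enn2real (harmonic.T s g x) powr q" by linarith
        then have "norm x powr (- real DIM('a)) \<le> 1 / c powr q * enn2real (harmonic.T s g x) powr q"
          using c(1) by (simp add: field_simps)
        then show ?thesis using True by (simp add: ennreal_mult''[symmetric] ennreal_leI)
      qed simp
    qed
    also have "\<dots> \<le> ennreal (1 / c powr q) * ennreal C"
      using Tg g0 g1 harmonic.T_measurable[OF g, of s] by (subst nn_integral_cmult) (auto intro!: mult_left_mono)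
    finally show ?thesis .
  qed
  have "(\<integral>\<^sup>+x\<in>ball 0 (1 / 4). ennreal (norm x powr (- real DIM('a))) \<partial>(lborel :: 'a measure))
    = (\<integral>\<^sup>+x\<in>(\<Union>n. A n). ennreal (norm x powr (- real DIM('a))) \<partial>lborel)"
  proof (rule nn_integral_cong)
    fix x :: 'a
    have "x \<in> (\<Union>n. A n)" if "x \<noteq> 0" "x \<in> ball 0 (1 / 4)"
    proof -
      have "0 < norm x" using that(1) by simp
      then obtain n where "inverse (real (Suc n)) < norm x" using reals_Archimedean by blast
      then have "x \<in> A n" using that(2) by (simp add: A_def inverse_eq_divide del: of_nat_Suc)
      then show ?thesis by blast
    qed
    then show "ennreal (norm x powr (- real DIM('a))) * indicator (ball 0 (1 / 4)) x = ennreal (norm x powr (- real DIM('a))) * indicator (\<Union>n. A n) x"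
      unfolding A_def by (cases "x = 0") (auto simp: indicator_def)
  qed
  also have "\<dots> = emeasure (density lborel (\<lambda>x. ennreal (norm x powr (- real DIM('a))))) (\<Union>n. A n)"
    by (subst emeasure_density) auto
  also have "\<dots> = (SUP n. emeasure (density lborel (\<lambda>x. ennreal (norm x powr (- real DIM('a))))) (A n))"
  proof (rule SUP_emeasure_incseq[symmetric])
    show "incseq A"
    proof (rule incseq_SucI)
      fix n
      have "ball (0::'a) (1 / Suc (Suc n)) \<subseteq> ball 0 (1 / Suc n)"
        by (intro subset_ball divide_left_mono) auto
      then show "A n \<subseteq> A (Suc n)" unfolding A_def by blast
    qed
  qed auto
  also have "\<dots> \<le> ennreal (1 / c powr q) * ennreal C"
    using le_A by (intro SUP_least) (simp add: emeasure_density)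
  finally show False
    by (subst (asm) nn_integral_norm_powr_ball_eq_top) (auto simp: top_unique ennreal_mult_eq_top_iff)
qed

section \<open>The mapping properties\<close>

text \<open>For v <= 1 the natural exponent 2s/d can be lowered since v^(2s/d) <= v^\<alpha>; for v
  > 1 the total mass suffices. Finite total mass, which the Riesz kernel lacks, is what opens the
  range 1/p - 1/q < a/d besides the scaling line.\<close>

lemma harmonic_restricted_weak_kernel:
  assumes s: "0 < s" "2 * s < real DIM('a::euclidean_space)" and \<alpha>: "0 < \<alpha>" "\<alpha> \<le> 2 * s / DIM('a)"
  obtains B where "restricted_weak_kernel (harmonic_nn s :: 'a \<Rightarrow> 'a \<Rightarrow> ennreal) B \<alpha>"
proof -
  obtain M where M: "M > 0" "\<And>x::'a. (\<integral>\<^sup>+y. harmonic_nn s x y \<partial>lborel) \<le> ennreal M"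
    using harmonic_mass_bounded[OF s(1)] by blast
  have s': "s < real DIM('a) / 2" using s by simp
  obtain C where C: "C > 0" "\<And>(x::'a) F v. F \<in> sets borel \<Longrightarrow> v > 0 \<Longrightarrow> emeasure lborel F \<le> ennreal v \<Longrightarrow>
    (\<integral>\<^sup>+y\<in>F. harmonic_nn s x y \<partial>lborel) \<le> ennreal (C * v powr (2 * s / DIM('a)))"
    using harmonic_nn_set_le[OF s(1) s'] by blast
  have "restricted_weak_kernel (harmonic_nn s :: 'a \<Rightarrow> 'a \<Rightarrow> ennreal) (M + C) \<alpha>"
  proof
    show "M + C > 0" using M C by simp
    fix x :: 'a and F :: "'a set" and v :: real
    assume F: "F \<in> sets borel" "v > 0" "emeasure lborel F \<le> ennreal v"
    show "(\<integral>\<^sup>+y\<in>F. harmonic_nn s x y \<partial>lborel) \<le> ennreal ((M + C) * v powr \<alpha>)"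
    proof (cases "v \<le> 1")
      case True
      have "C * v powr (2 * s / DIM('a)) \<le> (M + C) * v powr \<alpha>"
        using M C F True \<alpha> by (intro mult_mono powr_mono') auto
      then show ?thesis using C(2)[OF F, of x] by (meson ennreal_leI order_trans)
    next
      case False
      have "(\<integral>\<^sup>+y\<in>F. harmonic_nn s x y \<partial>lborel) \<le> (\<integral>\<^sup>+y. harmonic_nn s x y \<partial>lborel)"
        by (intro nn_integral_mono) (auto simp: indicator_def)
      also have "\<dots> \<le> ennreal M" by (rule M)
      also have "M * 1 \<le> (M + C) * v powr \<alpha>"
        using M C False \<alpha> by (intro mult_mono ge_one_powr_ge_zero) auto
      then have "ennreal M \<le> ennreal ((M + C) * v powr \<alpha>)" by (intro ennreal_leI) simp
      finally show ?thesis .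
    qed
  qed (use \<alpha> in auto)
  then show ?thesis by (rule that)
qed

text \<open>The gap condition is the integrability of the complementary power:
  (1+|x|^2)^(-sqp/(p-q)) is integrable exactly when 2s qp/(p-q) > d, that is 1/q - 1/p <
  2s/d.\<close>

lemma harmonic_strong_type_if_le:
  fixes s p q :: real
  assumes s: "s > 0" and pq: "1 \<le> q" "q \<le> p" and gap: "1 / q - 1 / p < 2 * s / DIM('a::euclidean_space)"
  shows "harmonic_strong_type TYPE('a) s p q"
proof (rule harmonic_mass[OF s, where 'a = 'a])
  fix M :: real
  assume M: "M > 0"
    "\<And>x::'a. (\<integral>\<^sup>+y. harmonic_nn s x y \<partial>lborel) \<le> ennreal (M / (1 + (norm x)\<^sup>2) powr s)"
    "\<And>x::'a. (\<integral>\<^sup>+y. ennreal ((1 + (norm y)\<^sup>2) powr s) * harmonic_nn s x y \<partial>lborel) \<le> ennreal M"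
  show ?thesis
  proof (rule harmonic.strong_type_weight[OF pq])
    show "1 \<le> (1 + (norm x)\<^sup>2) powr s" for x :: 'a using s by (simp add: ge_one_powr_ge_zero)
    show "0 < M" by fact
    show "(\<integral>\<^sup>+x. ennreal (((1 + (norm x)\<^sup>2) powr s) powr (- (q * p / (p - q)))) \<partial>(lborel :: 'a measure)) < \<infinity>"
      if "q < p"
    proof -
      have "real DIM('a) < 2 * s * (q * p / (p - q))"
      proof -
        have "1 / q - 1 / p = (p - q) / (q * p)" using pq by (simp add: field_simps)
        then have "(p - q) / (q * p) * DIM('a) < 2 * s" using gap by (simp add: field_simps)
        then show ?thesis using that pq by (simp add: field_simps)
      qed
      then have "(\<integral>\<^sup>+x. ennreal ((1 + (norm x)\<^sup>2) powr (- (2 * s * (q * p / (p - q)) / 2))) \<partial>(lborel :: 'a measure)) < \<infinity>"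
        by (simp only: nn_integral_weight_less_top_iff)
      moreover have "((1 + (norm x)\<^sup>2) powr s) powr (- (q * p / (p - q))) = (1 + (norm x)\<^sup>2) powr (- (2 * s * (q * p / (p - q)) / 2))"
        for x :: 'a
      proof -
        have "s * - e = - (2 * s * e / 2)" for e by simp
        then show ?thesis unfolding powr_powr by (rule arg_cong)
      qed
      ultimately show ?thesis by simp
    qed
    show "(\<lambda>x. (1 + (norm x)\<^sup>2) powr s) \<in> borel_measurable (borel :: 'a measure)" by measurable
  qed (use M in auto)
qed

text \<open>With \<alpha> = 2s/d the condition p\<alpha> > 1 of \<open>T_bounded\<close> becomes 2sp
  > d.\<close>

lemma harmonic_T_bounded:
  fixes s p :: real
  assumes s: "0 < s" "2 * s < real DIM('a::euclidean_space)" and p: "p \<ge> 1" "real DIM('a) < 2 * s * p"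
  obtains C where "C \<ge> 0" "\<And>(f :: 'a \<Rightarrow> real) x. f \<in> borel_measurable borel \<Longrightarrow> (\<And>x. 0 \<le> f x) \<Longrightarrow>
    (\<integral>\<^sup>+x. ennreal (f x powr p) \<partial>lborel) \<le> 1 \<Longrightarrow> harmonic.T s f x \<le> ennreal C"
proof -
  obtain M where M: "M > 0" "\<And>x::'a. (\<integral>\<^sup>+y. harmonic_nn s x y \<partial>lborel) \<le> ennreal M"
    using harmonic_mass_bounded[OF s(1)] by blast
  have "0 < 2 * s / DIM('a)" using s by simp
  from harmonic_restricted_weak_kernel[OF s this order_refl]
  obtain B where "restricted_weak_kernel (harmonic_nn s :: 'a \<Rightarrow> 'a \<Rightarrow> ennreal) B (2 * s / DIM('a))" .
  then interpret restricted_weak_kernel "harmonic_nn s :: 'a \<Rightarrow> 'a \<Rightarrow> ennreal" B "2 * s / DIM('a)" .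
  have pa: "p * (2 * s / DIM('a)) > 1" using p by (simp add: field_simps)
  show ?thesis
  proof (rule that)
    show "0 \<le> M + B / (p * (2 * s / DIM('a)) - 1)" using M B pa by simp
    fix f :: "'a \<Rightarrow> real" and x
    assume "f \<in> borel_measurable borel" "\<And>x. 0 \<le> f x" "(\<integral>\<^sup>+x. ennreal (f x powr p) \<partial>lborel) \<le> 1"
    then show "harmonic.T s f x \<le> ennreal (M + B / (p * (2 * s / DIM('a)) - 1))"
      using p pa M by (intro T_bounded) auto
  qed
qed

text \<open>Sufficiency is the mass bound for q = 1 and, for larger q, the dual of the bound from
  the conjugate L^p to L^\<infinity>. Necessity is the test on small balls, to which the case q =
  \<infinity> is reduced.\<close>

lemma harmonic_bounded_one_iff:
  fixes s :: real and q :: ennreal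
  assumes s: "0 < s" "2 * s < real DIM('a::euclidean_space)" and q: "1 \<le> q"
  shows "harmonic_neg_power_bounded TYPE('a) s 1 q \<longleftrightarrow> q < ennreal (DIM('a) / (DIM('a) - 2 * s))"
proof
  define d where "d = real DIM('a)"
  have d: "2 * s < d" using s by (simp add: d_def)
  assume bd: "harmonic_neg_power_bounded TYPE('a) s 1 q"
  show "q < ennreal (DIM('a) / (DIM('a) - 2 * s))"
  proof (cases q)
    case (real r)
    with q have r: "r \<ge> 1" by simp
    have "harmonic_strong_type TYPE('a) s 1 r"
      using bd real by (intro strong_type_if_bounded[OF s(1) _ r]) auto
    from strong_type_from_one_imp[OF s r this] have "r < d / (d - 2 * s)"
      using d by (simp add: d_def field_simps)
    then show ?thesis using real r by (simp add: d_def ennreal_lessI)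
  next
    case top
    \<comment> \<open>The excluded critical exponent. A bound into L^\<infinity> together with the
      one into L^1 would give (T f)^r <= C^(r-1) T f and hence a bound into L^r; the necessary
      condition then reads r < r.\<close>
    define r where "r = d / (d - 2 * s)"
    have r: "r \<ge> 1" using d s by (simp add: r_def field_simps)
    obtain M where M: "M > 0" "\<And>x::'a. (\<integral>\<^sup>+y. harmonic_nn s x y \<partial>lborel) \<le> ennreal M"
      using harmonic_mass_bounded[OF s(1)] by blast
    from bd top have "harmonic_neg_power_bounded TYPE('a) s (ennreal 1) \<infinity>" by simp
    from T_AE_bounded_if_bounded_into_infinity[OF s(1) order_refl this]
    obtain C where C: "C \<ge> 0" "\<And>f :: 'a \<Rightarrow> real. f \<in> borel_measurable borel \<Longrightarrow> (\<And>x. 0 \<le> f x) \<Longrightarrow>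
      (\<integral>\<^sup>+x. ennreal (f x powr 1) \<partial>lborel) \<le> 1 \<Longrightarrow> AE x in lborel. harmonic.T s f x \<le> ennreal C"
      by blast
    have "harmonic_strong_type TYPE('a) s 1 1"
      using s by (intro harmonic_strong_type_if_le) auto
    then obtain C1 where C1: "C1 \<ge> 0" "\<And>g :: 'a \<Rightarrow> real. g \<in> borel_measurable borel \<Longrightarrow> (\<And>x. 0 \<le> g x) \<Longrightarrow>
      (\<integral>\<^sup>+x. ennreal (g x powr 1) \<partial>lborel) \<le> 1 \<Longrightarrow>
      (AE x in lborel. harmonic.T s g x < \<infinity>) \<and> (\<integral>\<^sup>+x. ennreal (enn2real (harmonic.T s g x) powr 1) \<partial>lborel) \<le> ennreal C1"
      unfolding harmonic.strong_type_def by blast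
    have "harmonic_strong_type TYPE('a) s 1 r"
      unfolding harmonic.strong_type_def
    proof (intro exI[of _ "C powr (r - 1) * C1"] conjI[of "0 \<le> _"] ballI impI conjI)
      show "0 \<le> C powr (r - 1) * C1" using C1 by simp
      fix f :: "'a \<Rightarrow> real"
      assume f: "f \<in> borel_measurable borel" "\<forall>x. 0 \<le> f x" "(\<integral>\<^sup>+x. ennreal (f x powr 1) \<partial>lborel) \<le> 1"
      show "AE x in lborel. harmonic.T s f x < \<infinity>" using C1(2)[OF f(1) _ f(3)] f(2) by blast
      have "(\<integral>\<^sup>+x. ennreal (enn2real (harmonic.T s f x) powr r) \<partial>lborel)
        \<le> (\<integral>\<^sup>+x. ennreal (C powr (r - 1)) * ennreal (enn2real (harmonic.T s f x) powr 1) \<partial>lborel)"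
      proof (rule nn_integral_mono_AE, rule eventually_mono[OF C(2)[OF f(1) _ f(3)]])
        fix x assume "harmonic.T s f x \<le> ennreal C"
        then have "enn2real (harmonic.T s f x) \<le> C"
          using enn2real_mono[of "harmonic.T s f x" "ennreal C"] C(1) by simp
        then have "enn2real (harmonic.T s f x) powr (r - 1) * enn2real (harmonic.T s f x) powr 1 \<le> C powr (r - 1) * enn2real (harmonic.T s f x) powr 1"
          using r by (intro mult_right_mono powr_mono2) auto
        then show "ennreal (enn2real (harmonic.T s f x) powr r) \<le> ennreal (C powr (r - 1)) * ennreal (enn2real (harmonic.T s f x) powr 1)"
          unfolding powr_add[symmetric] by (simp add: ennreal_mult''[symmetric] ennreal_leI)
      qed (use f in auto)
      also have "\<dots> \<le> ennreal (C powr (r - 1)) * ennreal C1"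
        using C1(2)[OF f(1) _ f(3)] f(2) harmonic.T_measurable[OF f(1), of s]
        by (subst nn_integral_cmult) (auto intro!: mult_left_mono)
      also have "\<dots> = ennreal (C powr (r - 1) * C1)" using C1 by (simp add: ennreal_mult''[symmetric])
      finally show "(\<integral>\<^sup>+x. ennreal (enn2real (harmonic.T s f x) powr r) \<partial>lborel) \<le> ennreal (C powr (r - 1) * C1)" .
    qed
    from strong_type_from_one_imp[OF s r this] have "r < r"
      using d by (simp add: d_def r_def field_simps)
    then show ?thesis by simp
  qed
next
  assume q': "q < ennreal (DIM('a) / (DIM('a) - 2 * s))"
  then obtain r where r: "q = ennreal r" "r \<ge> 0" by (cases q) auto
  with q have r1: "r \<ge> 1" by simp
  have "r < DIM('a) / (DIM('a) - 2 * s)" using q' r by (simp add: ennreal_less_iff)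
  then have lt: "r * (DIM('a) - 2 * s) < DIM('a)" using s by (simp add: field_simps)
  have "harmonic_strong_type TYPE('a) s 1 r"
  proof (cases "r = 1")
    case True
    then show ?thesis using s by (auto intro!: harmonic_strong_type_if_le)
  next
    case False
    with r1 have r2: "r > 1" by simp
    \<comment> \<open>For the conjugate exponent, r(d-2s) < d becomes 2sp > d.\<close>
    define p where "p = r / (r - 1)"
    have p: "p > 1" "p / (p - 1) = r" using r2 by (auto simp: p_def field_simps)
    have "real DIM('a) < 2 * s * p" using lt r2 by (simp add: p_def field_simps)
    with p obtain C where C: "C \<ge> 0" "\<And>(f :: 'a \<Rightarrow> real) x. f \<in> borel_measurable borel \<Longrightarrow> (\<And>x. 0 \<le> f x) \<Longrightarrow>
      (\<integral>\<^sup>+x. ennreal (f x powr p) \<partial>lborel) \<le> 1 \<Longrightarrow> harmonic.T s f x \<le> ennreal C"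
      using harmonic_T_bounded[OF s, of p] by (metis less_imp_le)
    show ?thesis
      unfolding p(2)[symmetric]
      using C by (intro harmonic.strong_type_from_one_if_T_bounded[OF p(1) C(1)] AE_I2) auto
  qed
  then show "harmonic_neg_power_bounded TYPE('a) s 1 q"
    using bounded_if_strong_type[OF s(1) order_refl r1] r by simp
qed

text \<open>Necessity goes by duality to bounds out of L^1: the conjugate of the condition r'(d-2s)
  < d, with r' = r/(r-1), is 2sr > d.\<close>

lemma harmonic_bounded_into_infinity_iff:
  fixes s :: real and p :: ennreal
  assumes s: "0 < s" "2 * s < real DIM('a::euclidean_space)" and p: "1 \<le> p"
  shows "harmonic_neg_power_bounded TYPE('a) s p \<infinity> \<longleftrightarrow> p > ennreal (DIM('a) / (2 * s))"
proof (cases p)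
  case top
  then show ?thesis using bounded_from_infinity_if[OF s(1), of \<infinity>, where 'a = 'a] by (simp add: less_top[symmetric])
next
  case (real r)
  with p have r: "r \<ge> 1" by simp
  have lt_iff: "p > ennreal (DIM('a) / (2 * s)) \<longleftrightarrow> real DIM('a) < 2 * s * r"
    using real r s by (simp add: ennreal_less_iff field_simps)
  show ?thesis
    unfolding lt_iff
  proof
    assume "real DIM('a) < 2 * s * r"
    from harmonic_T_bounded[OF s r this] obtain C where C: "C \<ge> 0" "\<And>(f :: 'a \<Rightarrow> real) x. f \<in> borel_measurable borel \<Longrightarrow> (\<And>x. 0 \<le> f x) \<Longrightarrow>
      (\<integral>\<^sup>+x. ennreal (f x powr r) \<partial>lborel) \<le> 1 \<Longrightarrow> harmonic.T s f x \<le> ennreal C"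
      by blast
    then show "harmonic_neg_power_bounded TYPE('a) s p \<infinity>"
      using bounded_into_infinity_if[OF s(1) r C] real by simp
  next
    assume bd: "harmonic_neg_power_bounded TYPE('a) s p \<infinity>"
    \<comment> \<open>The conjugate of 1 is infinite, so the duality for finite exponents does not
      reach it; the case is settled by the equivalence for L^1 with q = \<infinity>.\<close>
    have "r \<noteq> 1"
    proof
      assume "r = 1"
      with bd real have "harmonic_neg_power_bounded TYPE('a) s 1 \<infinity>" by simp
      then show False using harmonic_bounded_one_iff[OF s, of \<infinity>] by simp
    qed
    with r have r1: "r > 1" by simp
    have bd': "harmonic_neg_power_bounded TYPE('a) s (ennreal r) \<infinity>" using bd real by simp
    from T_AE_bounded_if_bounded_into_infinity[OF s(1) r this]
    obtain C where C: "C \<ge> 0" "\<And>f :: 'a \<Rightarrow> real. f \<in> borel_measurable borel \<Longrightarrow> (\<And>x. 0 \<le> f x) \<Longrightarrow>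
      (\<integral>\<^sup>+x. ennreal (f x powr r) \<partial>lborel) \<le> 1 \<Longrightarrow> AE x in lborel. harmonic.T s f x \<le> ennreal C"
      by blast
    have "harmonic_strong_type TYPE('a) s 1 (r / (r - 1))"
      by (rule harmonic.strong_type_from_one_if_T_bounded[OF r1 C])
    moreover have "r / (r - 1) \<ge> 1" using r1 by (simp add: field_simps)
    ultimately have "r / (r - 1) * (DIM('a) - 2 * s) < DIM('a)"
      by (intro strong_type_from_one_imp[OF s])
    then show "real DIM('a) < 2 * s * r" using r1 by (simp add: field_simps)
  qed
qed

text \<open>For finite q the constant function 1 is extremal, so the question is whether T 1 lies in
  L^q; two-sided mass bounds compare it with (1+|x|^2)^(-s).\<close>

lemma harmonic_bounded_from_infinity_iff:
  fixes s :: real and q :: ennreal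
  assumes s: "0 < s" and q: "1 \<le> q"
  shows "harmonic_neg_power_bounded TYPE('a::euclidean_space) s \<infinity> q \<longleftrightarrow> q > ennreal (DIM('a) / (2 * s))"
proof (cases q)
  case top
  then show ?thesis using bounded_from_infinity_if[OF s, of \<infinity>, where 'a = 'a] by (simp add: less_top[symmetric])
next
  case (real r)
  with q have r: "r \<ge> 1" by simp
  have lt_iff: "q > ennreal (DIM('a) / (2 * s)) \<longleftrightarrow> real DIM('a) < 2 * s * r"
    using real r s by (simp add: ennreal_less_iff field_simps)
  show ?thesis
    unfolding lt_iff
  proof
    assume bd: "harmonic_neg_power_bounded TYPE('a) s \<infinity> q"
    then have "harmonic_neg_power_bounded TYPE('a) s \<infinity> (ennreal r)" using real by simp
    from mass_in_Lp_if_bounded_from_infinity[OF s r this] show "real DIM('a) < 2 * s * r"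
      by (rule mass_in_Lp_imp[OF s r])
  next
    assume lt: "real DIM('a) < 2 * s * r"
    have "(\<integral>\<^sup>+x. ennreal (enn2real (harmonic.T s (\<lambda>_. 1) (x::'a)) powr r) \<partial>lborel) < \<infinity>"
    proof (rule harmonic_mass[OF s, where 'a = 'a])
      fix M :: real
      assume M: "M > 0" "\<And>x::'a. (\<integral>\<^sup>+y. harmonic_nn s x y \<partial>lborel) \<le> ennreal (M / (1 + (norm x)\<^sup>2) powr s)"
      have "(\<integral>\<^sup>+x. ennreal (enn2real (harmonic.T s (\<lambda>_. 1) (x::'a)) powr r) \<partial>lborel)
        \<le> (\<integral>\<^sup>+x. ennreal (M powr r) * ennreal ((1 + (norm x)\<^sup>2) powr (- (2 * s * r / 2))) \<partial>(lborel :: 'a measure))"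
      proof (rule nn_integral_mono)
        fix x :: 'a
        have "harmonic.T s (\<lambda>_. 1) x \<le> ennreal (M / (1 + (norm x)\<^sup>2) powr s)"
          using M(2)[of x] by (simp add: harmonic.T_def)
        then have "enn2real (harmonic.T s (\<lambda>_. 1) x) \<le> M / (1 + (norm x)\<^sup>2) powr s"
          using enn2real_mono[of "harmonic.T s (\<lambda>_. 1) x" "ennreal (M / (1 + (norm x)\<^sup>2) powr s)"] M(1) by simp
        then have "enn2real (harmonic.T s (\<lambda>_. 1) x) powr r \<le> (M / (1 + (norm x)\<^sup>2) powr s) powr r"
          using r by (intro powr_mono2) auto
        also have "\<dots> = M powr r * (1 + (norm x)\<^sup>2) powr (- (2 * s * r / 2))"
          using M(1) by (simp add: powr_divide powr_powr powr_minus_divide)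
        finally show "ennreal (enn2real (harmonic.T s (\<lambda>_. 1) x) powr r) \<le> ennreal (M powr r) * ennreal ((1 + (norm x)\<^sup>2) powr (- (2 * s * r / 2)))"
          by (simp only: ennreal_mult''[OF powr_ge_zero, symmetric] ennreal_leI)
      qed
      also have "\<dots> = ennreal (M powr r) * (\<integral>\<^sup>+x. ennreal ((1 + (norm x)\<^sup>2) powr (- (2 * s * r / 2))) \<partial>(lborel :: 'a measure))"
        by (rule nn_integral_cmult) measurable
      also have "\<dots> < \<infinity>"
        unfolding infinity_ennreal_def ennreal_mult_less_top
        using lt by (simp only: nn_integral_weight_less_top_iff flip: infinity_ennreal_def) simp
      finally show ?thesis .
    qed
    then show "harmonic_neg_power_bounded TYPE('a) s \<infinity> q"
      using r real by (intro bounded_from_infinity_if[OF s]) auto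
  qed
qed

text \<open>Sufficiency is the weighted estimate with q = 1. Conversely, by duality a bound from L^r
  to L^1 puts T 1 into the conjugate space, so d < 2sr/(r-1), which rearranges to r(d-2s) <
  d.\<close>

lemma harmonic_bounded_into_one_iff:
  fixes s :: real and p :: ennreal
  assumes s: "0 < s" "2 * s < real DIM('a::euclidean_space)" and p: "1 \<le> p"
  shows "harmonic_neg_power_bounded TYPE('a) s p 1 \<longleftrightarrow> p < ennreal (DIM('a) / (DIM('a) - 2 * s))"
proof (cases p)
  \<comment> \<open>Both sides are false: a bound from L^\<infinity> to L^1 would need 1 > d/(2s),
    against 2s < d.\<close>
  case top
  have "\<not> 1 > ennreal (DIM('a) / (2 * s))"
    using s ennreal_less_iff[of "DIM('a) / (2 * s)" 1] by (simp add: divide_less_eq)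
  then show ?thesis using harmonic_bounded_from_infinity_iff[OF s(1), of 1, where 'a = 'a] top by simp
next
  case (real r)
  with p have r: "r \<ge> 1" by simp
  have lt_iff: "p < ennreal (DIM('a) / (DIM('a) - 2 * s)) \<longleftrightarrow> r * (DIM('a) - 2 * s) < DIM('a)"
    using real r s by (simp add: ennreal_less_iff pos_less_divide_eq)
  show ?thesis
    unfolding lt_iff
  proof
    assume "r * (DIM('a) - 2 * s) < DIM('a)"
    then have "1 / 1 - 1 / r < 2 * s / DIM('a)" using r by (simp add: field_simps)
    then have "harmonic_strong_type TYPE('a) s r 1"
      using r by (intro harmonic_strong_type_if_le[OF s(1)]) auto
    then show "harmonic_neg_power_bounded TYPE('a) s p 1"
      using bounded_if_strong_type[OF s(1) r order_refl] real by simp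
  next
    assume bd: "harmonic_neg_power_bounded TYPE('a) s p 1"
    show "r * (DIM('a) - 2 * s) < DIM('a)"
    proof (cases "r = 1")
      case False
      with r have r1: "r > 1" by simp
      have "harmonic_strong_type TYPE('a) s r 1"
        using bd real by (intro strong_type_if_bounded[OF s(1) r order_refl]) simp
      then obtain C where C: "C \<ge> 0" "\<And>g :: 'a \<Rightarrow> real. g \<in> borel_measurable borel \<Longrightarrow> (\<And>x. 0 \<le> g x) \<Longrightarrow>
        (\<integral>\<^sup>+x. ennreal (g x powr r) \<partial>lborel) \<le> 1 \<Longrightarrow>
        (AE x in lborel. harmonic.T s g x < \<infinity>) \<and> (\<integral>\<^sup>+x. ennreal (enn2real (harmonic.T s g x) powr 1) \<partial>lborel) \<le> ennreal C"
        unfolding harmonic.strong_type_def by blast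
      have "(\<integral>\<^sup>+x. ennreal (enn2real (harmonic.T s (\<lambda>_. 1) (x::'a)) powr (r / (r - 1))) \<partial>lborel) < \<infinity>"
      proof (rule harmonic.mass_in_Lp_if_into_L1[OF r1 C(1)])
        fix h :: "'a \<Rightarrow> real"
        assume h: "h \<in> borel_measurable borel" "\<And>x. 0 \<le> h x" "(\<integral>\<^sup>+x. ennreal (h x powr r) \<partial>lborel) \<le> 1"
        have "(\<integral>\<^sup>+x. harmonic.T s h x \<partial>lborel) = (\<integral>\<^sup>+x. ennreal (enn2real (harmonic.T s h x) powr 1) \<partial>lborel)"
          using C(2)[OF h] by (intro nn_integral_cong_AE, elim conjE eventually_mono) simp
        then show "(\<integral>\<^sup>+x. harmonic.T s h x \<partial>lborel) \<le> ennreal C" using C(2)[OF h] by simp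
      qed
      moreover have "r / (r - 1) \<ge> 1" using r1 by (simp add: field_simps)
      ultimately have "real DIM('a) < 2 * s * (r / (r - 1))" by (intro mass_in_Lp_imp[OF s(1)])
      then show ?thesis using r1 by (simp add: field_simps)
    qed (use s in simp)
  qed
qed

text \<open>The upper condition on 1/q serves the range q <= p through the weight. For q > p the
  kernel is used with exponent \<alpha> = 1/p - 1/q exactly, which the lower condition allows; every
  such pair then lies on the scaling line of its own \<alpha>, endpoint included.\<close>

lemma harmonic_bounded_interior:
  fixes s p q :: real
  assumes s: "0 < s" "2 * s < real DIM('a::euclidean_space)" and pq: "1 < p" "1 < q"
    and lo: "1 / p - 2 * s / DIM('a) \<le> 1 / q" and hi: "1 / q < 1 / p + 2 * s / DIM('a)"
  shows "harmonic_neg_power_bounded TYPE('a) s (ennreal p) (ennreal q)"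
proof -
  have "harmonic_strong_type TYPE('a) s p q"
  proof (cases "q \<le> p")
    case True
    then show ?thesis using pq hi by (intro harmonic_strong_type_if_le[OF s(1)]) auto
  next
    case False
    define \<alpha> where "\<alpha> = 1 / p - 1 / q"
    have \<alpha>: "0 < \<alpha>" "\<alpha> \<le> 2 * s / DIM('a)" using False pq lo by (auto simp: \<alpha>_def field_simps)
    from harmonic_restricted_weak_kernel[OF s \<alpha>]
    obtain B where "restricted_weak_kernel (harmonic_nn s :: 'a \<Rightarrow> 'a \<Rightarrow> ennreal) B \<alpha>" .
    then show ?thesis
      using False pq by (intro restricted_weak_kernel.strong_type_Hardy_Littlewood_Sobolev) (auto simp: \<alpha>_def)
  qed
  then show ?thesis using pq by (intro bounded_if_strong_type[OF s(1)]) auto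
qed

theorem theorem8:
  fixes a d :: real
  assumes d_def: "d = real DIM('a::euclidean_space)"
    and a_pos: "0 < a" and a_less: "a < d"
  shows
    "(\<forall>q::ennreal. 1 \<le> q \<longrightarrow>
        (harmonic_neg_power_bounded TYPE('a) (a / 2) 1 q \<longleftrightarrow> q < ennreal (d / (d - a)))) \<and>
     (\<forall>p::ennreal. 1 \<le> p \<longrightarrow>
        (harmonic_neg_power_bounded TYPE('a) (a / 2) p \<infinity> \<longleftrightarrow> p > ennreal (d / a))) \<and>
     (\<forall>q::ennreal. 1 \<le> q \<longrightarrow>
        (harmonic_neg_power_bounded TYPE('a) (a / 2) \<infinity> q \<longleftrightarrow> q > ennreal (d / a))) \<and>
     (\<forall>p::ennreal. 1 \<le> p \<longrightarrow>
        (harmonic_neg_power_bounded TYPE('a) (a / 2) p 1 \<longleftrightarrow> p < ennreal (d / (d - a)))) \<and>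
     (\<forall>p q::real. 1 < p \<longrightarrow> 1 < q \<longrightarrow> 1 / p - a / d \<le> 1 / q \<longrightarrow> 1 / q < 1 / p + a / d \<longrightarrow>
        harmonic_neg_power_bounded TYPE('a) (a / 2) (ennreal p) (ennreal q))"
proof -
  have s: "0 < a / 2" "2 * (a / 2) < real DIM('a)" using assms by auto
  show ?thesis
    using harmonic_bounded_one_iff[OF s] harmonic_bounded_into_infinity_iff[OF s]
      harmonic_bounded_from_infinity_iff[OF s(1), where 'a = 'a] harmonic_bounded_into_one_iff[OF s]
      harmonic_bounded_interior[OF s]
    by (simp add: d_def)
qed

end
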